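(* Let $d\ge1$, $q\in(0,1)$, and let $A,B,\Sigma,\Theta$ be real $d\times d$ matrices. Let $(X(t))_{t\ge0}$ be the ($\mathbb{R}^d$-valued) solution of $$dX(t)=\big(AX(t)+BX(qt)\big)dt+\big(\Sigma X(t)+\Theta X(qt)\big)dW(t),\quad t\ge0,\qquad X(0)=X_0,$$ with $\mathbb{E}(\|X_0\|^4)<\infty$. Suppose that all eigenvalues of $A$ have negative real parts. Let $C$ be the positive definite matrix satisfying $A^TC+CA=-I$, and let $\underline{\gamma}^2$ and $\overline{\gamma}^2$, with $0<\underline{\gamma}^2\le\overline{\gamma}^2$, be the minimum and maximum eigenvalues of $C$, respectively. Consider the two estimates $$\text{(A)}\quad \mathbb{E}(\|X(t)\|^2)\le K\,\mathbb{E}[\|X_0\|^2]\,(1+t)^{\alpha}\ \text{ for all } t\ge0,\qquad \text{(B)}\quad \limsup_{t\to\infty}\frac{\log\|X(t)\|}{\log t}\le\frac12(\alpha+1)\ \text{ a.s.}$$ Then the following hold. (i) Suppose $$-\frac{1}{\overline{\gamma}^2}+\frac{1}{\underline{\gamma}^2}\|\Sigma^TC\Sigma\|<0 .$$ Then there exist $\alpha\in\mathbb{R}$ and $K>0$ such that (A) and (B) hold. Therefore the process is globally polynomially bounded in mean-square and almost surely globally polynomially bounded. (ii) Suppose $$-\frac{1}{\overline{\gamma}^2}+\frac{1}{\underline{\gamma}^2}\Big(\|\Sigma^TC\Sigma\|+\|\Theta^TC\Theta\|+2\|B^TC\|+2\|\Sigma^TC\Theta\|\Big)<0 .$$ Then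 there exist $\alpha<0$ and $K>0$ such that (A) and (B) hold. Therefore the equilibrium solution is globally polynomially stable in mean-square, and the solution process is almost surely globally polynomially bounded. (iii) Suppose $$-\frac{1}{\overline{\gamma}^2}+\frac{1}{\underline{\gamma}^2}\Big(\|\Sigma^TC\Sigma\|+\frac{\|\Theta^TC\Theta\|}{q}+\frac{2}{\sqrt q}\|B^TC\|+\frac{2}{\sqrt q}\|\Sigma^TC\Theta\|\Big)<0 .$$ Then there exist $\alpha<-1$ and $K>0$ such that (A) and (B) hold. Therefore the equilibrium solution is globally polynomially stable in mean-square and a.s. globally polynomially stable.
   Context: $(W(t))_{t\ge0}$ is a standard one-dimensional Brownian motion, and $X_0$ is an $\mathbb{R}^d$-valued random variable independent of $W$. The solution $X$ is the pathwise unique strong solution: the continuous process adapted to the (completed) filtration generated by $X_0$ and $W$ satisfying the integrated (Itô) form of the equation; existence and uniqueness may be taken as known. $\|\cdot\|$ is the Euclidean norm on $\mathbb{R}^d$ and also the induced operator norm on $d\times d$ matrices; $I$ is the identity matrix; ${}^T$ denotes transpose. Convention: $\log0=-\infty$. Definitions. The solution is globally polynomially bounded in mean-square if there are constants $K>0$, $\alpha_1\in\mathbb{R}$ (independent of $X_0$) with $\mathbb{E}(\|X(t)\|^2)\le K\,\mathbb{E}(\|X_0\|^2)(1+t)^{\alpha_1}$ for all $t\ge0$; almost surely globally polynomially bounded if there is $\alpha_2\in\mathbb{R}$ (independent of $X_0$) with $\limsup_{t\to\infty}\log\|X(t)\|/\log t\le\alpha_2$ a.s. The equilibrium (zero) solution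 is globally polynomially stable in mean-square if the first property holds with $\alpha_1<0$, and almost surely globally polynomially stable if the second holds with $\alpha_2<0$. *)

theory Defs
  imports "HOL-Probability.Probability"
begin

definition matrix_eigenvalue :: "'a::field ^ 'n ^ 'n \<Rightarrow> 'a \<Rightarrow> bool" where
  "matrix_eigenvalue A k \<longleftrightarrow> (\<exists>v. v \<noteq> 0 \<and> A *v v = k *s v)"

definition cmatrix :: "real ^ 'n ^ 'm \<Rightarrow> complex ^ 'n ^ 'm" where
  "cmatrix A = (\<chi> i j. complex_of_real (A $ i $ j))"

definition positive_definite :: "real ^ 'n ^ 'n \<Rightarrow> bool" where
  "positive_definite C \<longleftrightarrow> transpose C = C \<and> (\<forall>x. x \<noteq> 0 \<longrightarrow> x \<bullet> (C *v x) > 0)"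

definition opnorm :: "real ^ 'n ^ 'm \<Rightarrow> real" where
  "opnorm A = onorm (\<lambda>x. A *v x)"

text \<open>Processes are indexed by \<^typ>\<open>real\<close>; only their values at times \<open>t \<ge> 0\<close> are ever used.\<close>

definition brownian_motion :: "'w measure \<Rightarrow> (real \<Rightarrow> 'w \<Rightarrow> real) \<Rightarrow> bool" where
  "brownian_motion M W \<longleftrightarrow>
     (\<forall>t\<ge>0. W t \<in> borel_measurable M) \<and>
     (AE \<omega> in M. W 0 \<omega> = 0) \<and>
     (\<forall>s t. 0 \<le> s \<and> s < t \<longrightarrow>
        distributed M lborel (\<lambda>\<omega>. W t \<omega> - W s \<omega>) (\<lambda>x. ennreal (normal_density 0 (sqrt (t - s)) x))) \<and>
     (\<forall>n (\<tau> :: nat \<Rightarrow> real). 0 \<le> \<tau> 0 \<and> mono \<tau> \<longrightarrow>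
        prob_space.indep_vars M (\<lambda>_. borel) (\<lambda>i \<omega>. W (\<tau> (Suc i)) \<omega> - W (\<tau> i) \<omega>) {..<n}) \<and>
     (AE \<omega> in M. continuous_on {0..} (\<lambda>t. W t \<omega>))"

definition indep_of_process ::
    "'w measure \<Rightarrow> ('w \<Rightarrow> 'b::topological_space) \<Rightarrow> (real \<Rightarrow> 'w \<Rightarrow> real) \<Rightarrow> bool" where
  "indep_of_process M X0 W \<longleftrightarrow>
     prob_space.indep_set M
       (sets (vimage_algebra (space M) X0 borel))
       (sets (vimage_algebra (space M) (\<lambda>\<omega>. \<lambda>s\<in>{0..}. W s \<omega>) (\<Pi>\<^sub>M s\<in>{0..}. borel)))"

text \<open>The time-\<open>t\<close> sigma-algebra (as a measurable space) of the completed filtration generated by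
  \<open>X0\<close> and \<open>W\<close>. The base space is not assumed complete, so the null sets are those of its
  completion.\<close>

definition completed_filtration ::
    "'w measure \<Rightarrow> ('w \<Rightarrow> 'b::topological_space) \<Rightarrow> (real \<Rightarrow> 'w \<Rightarrow> real) \<Rightarrow> real \<Rightarrow> 'w measure" where
  "completed_filtration M X0 W t =
     sigma (space M)
       ({X0 -` S \<inter> space M | S. S \<in> sets borel} \<union>
        {W s -` S \<inter> space M | s S. 0 \<le> s \<and> s \<le> t \<and> S \<in> sets borel} \<union>
        null_sets (completion M))"

text \<open>A simple process on \<open>[0,t]\<close> is \<open>\<Sum>i<N. \<xi> i\<close> times the indicator of
  \<open>(\<tau> i, \<tau> (Suc i)]\<close>, with \<open>\<xi> i\<close> bounded and known at time \<open>\<tau> i\<close>.\<close>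

definition simple_process ::
    "'w measure \<Rightarrow> (real \<Rightarrow> 'w measure) \<Rightarrow> real \<Rightarrow> nat \<Rightarrow> (nat \<Rightarrow> real) \<Rightarrow>
     (nat \<Rightarrow> 'w \<Rightarrow> 'b::euclidean_space) \<Rightarrow> bool" where
  "simple_process M F t N \<tau> \<xi> \<longleftrightarrow>
     \<tau> 0 = 0 \<and> \<tau> N = t \<and>
     (\<forall>i<N. \<tau> i \<le> \<tau> (Suc i) \<and> \<xi> i \<in> borel_measurable (F (\<tau> i)) \<and> bounded (\<xi> i ` space M))"

definition simple_value ::
    "nat \<Rightarrow> (nat \<Rightarrow> real) \<Rightarrow> (nat \<Rightarrow> 'w \<Rightarrow> 'b::euclidean_space) \<Rightarrow> real \<Rightarrow> 'w \<Rightarrow> 'b" where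
  "simple_value N \<tau> \<xi> s \<omega> = (\<Sum>i<N. indicator {\<tau> i<..\<tau> (Suc i)} s *\<^sub>R \<xi> i \<omega>)"

definition simple_integral_wrt ::
    "(real \<Rightarrow> 'w \<Rightarrow> real) \<Rightarrow> nat \<Rightarrow> (nat \<Rightarrow> real) \<Rightarrow> (nat \<Rightarrow> 'w \<Rightarrow> 'b::euclidean_space) \<Rightarrow> 'w \<Rightarrow> 'b" where
  "simple_integral_wrt W N \<tau> \<xi> \<omega> = (\<Sum>i<N. (W (\<tau> (Suc i)) \<omega> - W (\<tau> i) \<omega>) *\<^sub>R \<xi> i \<omega>)"

text \<open>Convergence to zero in probability. Measurability is demanded explicitly because
  \<^const>\<open>emeasure\<close> is zero on nonmeasurable sets.\<close>

definition vanishes_in_probability :: "'w measure \<Rightarrow> (nat \<Rightarrow> 'w \<Rightarrow> ennreal) \<Rightarrow> bool" where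
  "vanishes_in_probability M Y \<longleftrightarrow>
     (\<forall>n. Y n \<in> borel_measurable M) \<and>
     (\<forall>\<epsilon>>0. (\<lambda>n. emeasure M {\<omega> \<in> space M. \<epsilon> < Y n \<omega>}) \<longlonglongrightarrow> 0)"

text \<open>\<open>I\<close> is (a version of) the Ito integral of \<open>H\<close> over \<open>[0,t]\<close>: the limit in probability
  of integrals of simple processes that approximate \<open>H\<close> in \<open>L\<^sup>2([0,t])\<close>, in probability.
  This is the usual extension to integrands that are only pathwise square-integrable; it determines
  \<open>I\<close> up to null sets.\<close>

definition has_ito_integral ::
    "'w measure \<Rightarrow> (real \<Rightarrow> 'w measure) \<Rightarrow> (real \<Rightarrow> 'w \<Rightarrow> real) \<Rightarrow>
     (real \<Rightarrow> 'w \<Rightarrow> 'b::euclidean_space) \<Rightarrow> real \<Rightarrow> ('w \<Rightarrow> 'b) \<Rightarrow> bool" where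
  "has_ito_integral M F W H t I \<longleftrightarrow>
     (\<exists>(N :: nat \<Rightarrow> nat) \<tau> \<xi>.
        (\<forall>n. simple_process M F t (N n) (\<tau> n) (\<xi> n)) \<and>
        vanishes_in_probability (completion M)
          (\<lambda>n \<omega>. \<integral>\<^sup>+s\<in>{0..t}. ennreal ((norm (simple_value (N n) (\<tau> n) (\<xi> n) s \<omega> - H s \<omega>))\<^sup>2) \<partial>lborel) \<and>
        vanishes_in_probability (completion M)
          (\<lambda>n \<omega>. ennreal (norm (simple_integral_wrt W (N n) (\<tau> n) (\<xi> n) \<omega> - I \<omega>))))"

definition pantograph_solution ::
    "'w measure \<Rightarrow> (real \<Rightarrow> 'w \<Rightarrow> real) \<Rightarrow> real \<Rightarrow>
     real ^ 'n ^ 'n \<Rightarrow> real ^ 'n ^ 'n \<Rightarrow> real ^ 'n ^ 'n \<Rightarrow> real ^ 'n ^ 'n \<Rightarrow>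
     ('w \<Rightarrow> real ^ 'n) \<Rightarrow> (real \<Rightarrow> 'w \<Rightarrow> real ^ 'n) \<Rightarrow> bool" where
  "pantograph_solution M W q A B S \<Theta> X0 X \<longleftrightarrow>
     (\<forall>t\<ge>0. X t \<in> borel_measurable (completed_filtration M X0 W t)) \<and>
     (AE \<omega> in M. continuous_on {0..} (\<lambda>t. X t \<omega>)) \<and>
     (AE \<omega> in M. X 0 \<omega> = X0 \<omega>) \<and>
     (\<forall>t\<ge>0. \<exists>I.
        has_ito_integral M (completed_filtration M X0 W) W
          (\<lambda>s \<omega>. S *v X s \<omega> + \<Theta> *v X (q * s) \<omega>) t I \<and>
        (AE \<omega> in M. X t \<omega> = X0 \<omega> + integral {0..t} (\<lambda>s. A *v X s \<omega> + B *v X (q * s) \<omega>) + I \<omega>))"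

definition admissible_solution ::
    "'w measure \<Rightarrow> (real \<Rightarrow> 'w \<Rightarrow> real) \<Rightarrow> real \<Rightarrow>
     real ^ 'n ^ 'n \<Rightarrow> real ^ 'n ^ 'n \<Rightarrow> real ^ 'n ^ 'n \<Rightarrow> real ^ 'n ^ 'n \<Rightarrow>
     ('w \<Rightarrow> real ^ 'n) \<Rightarrow> (real \<Rightarrow> 'w \<Rightarrow> real ^ 'n) \<Rightarrow> bool" where
  "admissible_solution M W q A B S \<Theta> X0 X \<longleftrightarrow>
     X0 \<in> borel_measurable M \<and>
     indep_of_process M X0 W \<and>
     (\<integral>\<^sup>+\<omega>. ennreal (norm (X0 \<omega>) ^ 4) \<partial>M) < \<infinity> \<and>
     pantograph_solution M W q A B S \<Theta> X0 X"

text \<open>Second moments are taken in \<^typ>\<open>ennreal\<close>, so that an infinite moment is not mistaken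
  for zero. The value of \<^const>\<open>nn_integral\<close> is the same over \<open>M\<close> and over its completion.\<close>

definition mean_square :: "'w measure \<Rightarrow> ('w \<Rightarrow> real ^ 'n) \<Rightarrow> ennreal" where
  "mean_square M Y = (\<integral>\<^sup>+\<omega>. ennreal ((norm (Y \<omega>))\<^sup>2) \<partial>completion M)"

definition ms_estimate ::
    "'w measure \<Rightarrow> ('w \<Rightarrow> real ^ 'n) \<Rightarrow> (real \<Rightarrow> 'w \<Rightarrow> real ^ 'n) \<Rightarrow> real \<Rightarrow> real \<Rightarrow> bool" where
  "ms_estimate M X0 X K \<alpha> \<longleftrightarrow>
     (\<forall>t\<ge>0. mean_square M (X t) \<le> ennreal K * mean_square M X0 * ennreal ((1 + t) powr \<alpha>))"

definition elog :: "real \<Rightarrow> ereal" where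
  "elog x = (if x = 0 then - \<infinity> else ereal (ln x))"

definition as_estimate :: "'w measure \<Rightarrow> (real \<Rightarrow> 'w \<Rightarrow> real ^ 'n) \<Rightarrow> real \<Rightarrow> bool" where
  "as_estimate M X \<beta> \<longleftrightarrow>
     (AE \<omega> in M. Limsup at_top (\<lambda>t. elog (norm (X t \<omega>)) / ereal (ln t)) \<le> ereal \<beta>)"

text \<open>Below, \<open>Sol X0 X\<close> says that \<open>X\<close> is the solution with initial value \<open>X0\<close>; the constants
  are uniform in \<open>X0\<close>.\<close>

definition ms_polynomially_bounded ::
    "'w measure \<Rightarrow> (('w \<Rightarrow> real ^ 'n) \<Rightarrow> (real \<Rightarrow> 'w \<Rightarrow> real ^ 'n) \<Rightarrow> bool) \<Rightarrow> bool" where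
  "ms_polynomially_bounded M Sol \<longleftrightarrow>
     (\<exists>K \<alpha>. 0 < K \<and> (\<forall>X0 X. Sol X0 X \<longrightarrow> ms_estimate M X0 X K \<alpha>))"

definition as_polynomially_bounded ::
    "'w measure \<Rightarrow> (('w \<Rightarrow> real ^ 'n) \<Rightarrow> (real \<Rightarrow> 'w \<Rightarrow> real ^ 'n) \<Rightarrow> bool) \<Rightarrow> bool" where
  "as_polynomially_bounded M Sol \<longleftrightarrow>
     (\<exists>\<alpha>. \<forall>X0 X. Sol X0 X \<longrightarrow> as_estimate M X \<alpha>)"

definition ms_polynomially_stable ::
    "'w measure \<Rightarrow> (('w \<Rightarrow> real ^ 'n) \<Rightarrow> (real \<Rightarrow> 'w \<Rightarrow> real ^ 'n) \<Rightarrow> bool) \<Rightarrow> bool" where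
  "ms_polynomially_stable M Sol \<longleftrightarrow>
     (\<exists>K \<alpha>. 0 < K \<and> \<alpha> < 0 \<and> (\<forall>X0 X. Sol X0 X \<longrightarrow> ms_estimate M X0 X K \<alpha>))"

definition as_polynomially_stable ::
    "'w measure \<Rightarrow> (('w \<Rightarrow> real ^ 'n) \<Rightarrow> (real \<Rightarrow> 'w \<Rightarrow> real ^ 'n) \<Rightarrow> bool) \<Rightarrow> bool" where
  "as_polynomially_stable M Sol \<longleftrightarrow>
     (\<exists>\<alpha><0. \<forall>X0 X. Sol X0 X \<longrightarrow> as_estimate M X \<alpha>)"

end

theory Submission
  imports Defs
begin

text \<open>The solution is the limit in probability of its Euler scheme, so no Ito formula and no stopping
  of continuous-time integrals is needed. With \<open>V x = x \<bullet> (C *v x)\<close> and \<open>v\<^sub>k\<close> the mean of \<open>V\<close> at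
  the \<open>k\<close>-th step, orthogonality of the Brownian increments gives
  \<open>v\<^sub>k\<^sub>+\<^sub>1 \<le> (1 + a h) v\<^sub>k + b h v\<^sub>j\<close> with \<open>j = \<lfloor>q k\<rfloor>\<close>, where in the cases (i), (ii), (iii) the
  coefficients satisfy \<open>a < 0\<close>, \<open>a + b < 0\<close> and \<open>a + b / q < 0\<close>. This recursion is dominated by a
  power of \<open>1 + \<delta> t\<close> whose exponent \<open>\<alpha>\<close> satisfies \<open>a + b q\<^sup>\<alpha> < 0\<close> when it is negative. Fatou's
  lemma transfers the bound to the solution, which yields (A). For (B), Kolmogorov's inequality
  on the intervals \<open>[n, n + 1]\<close> is passed to the limit along dyadic grids and combined with the
  Borel-Cantelli lemma.

  Convergence of the scheme does not presuppose moments of the solution: the local errors of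
  the solution, regarded as a perturbed scheme, are small uniformly in probability by Lenglart's
  inequality, and truncating them leaves a perturbed scheme with small second moments.\<close>

section \<open>Linear algebra of the Lyapunov form\<close>

text \<open>\<open>has_ito_integral\<close> describes each integral at one fixed time and only up to
  null sets, so there is no path of integrals to stop; every estimate is proved for finite sums and
  carried over in probability. Young's inequality with a free weight \<open>r\<close> splits the
  delayed cross terms of the Lyapunov form and so shifts weight between the coefficients a and b of
  present and delayed energy. A small \<open>r\<close> makes a negative in (i); r = 1 minimises a +
  b and reproduces the condition of (ii); r = 1 / sqrt q minimises a + b / q and reproduces that of
  (iii). A power of time is the natural comparison function because the delay scales time: for v(t)
  = t^\<alpha> one has v(q t) = q^\<alpha> v(t), while v'(t) = \<alpha> v(t) / t fades. Hence the
  sign of a + b q^\<alpha> decides, and (ii) and (iii) state it at \<alpha> = 0 and \<alpha> = -1.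
  Strictness leaves a slack \<open>e\<close>, which pays for the second-order term of the Euler step
  and for a slightly larger exponent \<alpha>' in (B): at level n^((\<alpha>'+1)/2) the exceedance
  probabilities are of order n^(\<alpha>-\<alpha>'-1), which is summable.\<close>

lemma square_add_le: "(x + y)\<^sup>2 \<le> 2 * x\<^sup>2 + 2 * (y::real)\<^sup>2"
  using sum_squares_bound[of x y] by (simp add: power2_sum)

lemma norm_add_square_le: "(norm (x + y))\<^sup>2 \<le> 2 * (norm x)\<^sup>2 + 2 * (norm (y::'a::real_normed_vector))\<^sup>2"
  by (rule order_trans[OF power_mono[OF norm_triangle_ineq norm_ge_zero] square_add_le])

lemma symmetric_form:
  fixes C :: "real^'n^'n"
  assumes "transpose C = C"
  shows "x \<bullet> (C *v y) = y \<bullet> (C *v x)"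
proof -
  have "x \<bullet> (C *v y) = (transpose C *v x) \<bullet> y"
    by (simp add: dot_lmul_matrix transpose_matrix_vector)
  then show ?thesis using assms by (simp add: inner_commute)
qed

lemma opnorm_ge0: "0 \<le> opnorm (A :: real^'n^'m)"
  unfolding opnorm_def by (rule onorm_pos_le) (rule matrix_vector_mul_bounded_linear)

lemma opnorm_bound: "norm (A *v x) \<le> opnorm (A :: real^'n^'m) * norm x"
  unfolding opnorm_def by (rule onorm) (rule matrix_vector_mul_bounded_linear)

lemma opnorm_form_bound: "x \<bullet> (A *v y) \<le> opnorm (A :: real^'n^'m) * (norm x * norm y)"
proof -
  have "x \<bullet> (A *v y) \<le> norm x * norm (A *v y)" by (rule norm_cauchy_schwarz)
  also have "\<dots> \<le> norm x * (opnorm A * norm y)" by (intro mult_left_mono opnorm_bound) auto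
  finally show ?thesis by (simp add: mult_ac)
qed

text \<open>A null vector of a positive semidefinite form lies in the kernel, since the quadratic
  \<open>t \<mapsto> (x + t y) \<bullet> D (x + t y)\<close> is nonnegative and vanishes at \<open>0\<close>.\<close>
lemma semidefinite_kernel:
  fixes D :: "real^'n^'n"
  assumes sym: "transpose D = D" and pos: "\<And>x. 0 \<le> x \<bullet> (D *v x)" and x: "x \<bullet> (D *v x) = 0"
  shows "D *v x = 0"
proof -
  let ?y = "D *v x"
  have *: "0 \<le> 2 * t * (norm ?y)\<^sup>2 + t\<^sup>2 * (?y \<bullet> (D *v ?y))" for t
  proof -
    have "(x + t *\<^sub>R ?y) \<bullet> (D *v (x + t *\<^sub>R ?y))
        = x \<bullet> (D *v x) + t * (x \<bullet> (D *v ?y)) + t * (?y \<bullet> (D *v x)) + t\<^sup>2 * (?y \<bullet> (D *v ?y))"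
      by (simp add: matrix_vector_right_distrib matrix_vector_mult_scaleR inner_add_left
          inner_add_right power2_eq_square algebra_simps)
    then show ?thesis
      using pos[of "x + t *\<^sub>R ?y"] x symmetric_form[OF sym, of x ?y]
      by (simp add: power2_norm_eq_inner)
  qed
  define a where "a = (norm ?y)\<^sup>2"
  define b where "b = ?y \<bullet> (D *v ?y)"
  have b: "0 \<le> b" unfolding b_def by (rule pos)
  have "a \<le> 0"
  proof (rule ccontr)
    assume "\<not> a \<le> 0"
    then have a: "0 < a" by simp
    \<comment> \<open>The quadratic has its minimum at -a / b; the added 1 keeps the witness defined
      when b = 0.\<close>
    have "0 \<le> 2 * (- (a / (b + 1))) * a + (- (a / (b + 1)))\<^sup>2 * b"
      using *[of "- (a / (b + 1))"] by (simp add: a_def b_def)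
    also have "\<dots> = (a\<^sup>2 / (b + 1)) * (b / (b + 1) - 2)"
    proof -
      have "(a / (b + 1))\<^sup>2 * b = (a\<^sup>2 / (b + 1)) * (b / (b + 1))"
        by (simp add: power2_eq_square)
      then show ?thesis by (simp add: power2_eq_square right_diff_distrib)
    qed
    also have "\<dots> < 0"
      using a b by (intro mult_pos_neg) (auto simp: field_simps intro!: divide_pos_pos)
    finally show False by simp
  qed
  then show ?thesis by (simp add: a_def)
qed

text \<open>The Rayleigh quotient attains its minimum \<open>m\<close> on the unit sphere. Then C -
  m I is semidefinite with the minimiser as null vector, so the minimiser is an eigenvector for
  \<open>m\<close>, and the eigenvalue bound applies to \<open>m\<close>.\<close>

lemma min_eigenvalue_form:
  fixes C :: "real^'n^'n"
  assumes sym: "transpose C = C" and min: "\<And>k. matrix_eigenvalue C k \<Longrightarrow> l \<le> k"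
  shows "l * (norm x)\<^sup>2 \<le> x \<bullet> (C *v x)"
proof -
  have "continuous_on (sphere 0 1) (\<lambda>x. x \<bullet> (C *v x))"
    by (intro continuous_intros linear_continuous_on matrix_vector_mul_bounded_linear)
  moreover have "sphere (0::real^'n) 1 \<noteq> {}" by simp
  ultimately obtain x0 where x0: "norm x0 = 1" and le: "\<And>x. norm x = 1 \<Longrightarrow> x0 \<bullet> (C *v x0) \<le> x \<bullet> (C *v x)"
    using continuous_attains_inf[of "sphere (0::real^'n) 1" "\<lambda>x. x \<bullet> (C *v x)"] by auto
  define m where "m = x0 \<bullet> (C *v x0)"
  have ge: "m * (norm x)\<^sup>2 \<le> x \<bullet> (C *v x)" for x
  proof (cases "x = 0")
    case False
    have "m \<le> (x /\<^sub>R norm x) \<bullet> (C *v (x /\<^sub>R norm x))"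
      using le[of "x /\<^sub>R norm x"] False by (simp add: m_def)
    also have "\<dots> = (x \<bullet> (C *v x)) / (norm x)\<^sup>2"
      by (simp add: matrix_vector_mult_scaleR power2_eq_square field_simps)
    finally show ?thesis using False by (simp add: field_simps)
  qed simp
  define D where "D = C - m *\<^sub>R mat 1"
  have Dv: "D *v x = C *v x - m *\<^sub>R x" for x
    by (simp add: D_def matrix_vector_mult_diff_rdistrib scaleR_matrix_vector_assoc[symmetric])
  have "transpose D = D"
    using sym by (simp add: D_def transpose_def vec_eq_iff mat_def eq_commute)
  moreover have "0 \<le> x \<bullet> (D *v x)" for x
    using ge[of x] by (simp add: Dv inner_diff_right power2_norm_eq_inner)
  moreover have "x0 \<bullet> (D *v x0) = 0"
    using x0 by (simp add: Dv inner_diff_right m_def[symmetric] power2_norm_eq_inner[symmetric])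
  ultimately have "D *v x0 = 0" by (rule semidefinite_kernel)
  then have "C *v x0 = m *s x0" by (simp add: Dv scalar_mult_eq_scaleR)
  moreover have "x0 \<noteq> 0" using x0 by auto
  ultimately have "matrix_eigenvalue C m" unfolding matrix_eigenvalue_def by blast
  then have "l * (norm x)\<^sup>2 \<le> m * (norm x)\<^sup>2" using min by (intro mult_right_mono) auto
  then show ?thesis using ge[of x] by linarith
qed

lemma max_eigenvalue_form:
  fixes C :: "real^'n^'n"
  assumes sym: "transpose C = C" and max: "\<And>k. matrix_eigenvalue C k \<Longrightarrow> k \<le> u"
  shows "x \<bullet> (C *v x) \<le> u * (norm x)\<^sup>2"
proof -
  have neg: "(- C) *v v = - (C *v v)" for v :: "real^'n"
    by (simp add: matrix_vector_mult_def vec_eq_iff sum_negf)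
  have "- u \<le> k" if k: "matrix_eigenvalue (- C) k" for k
  proof -
    obtain v where v: "v \<noteq> 0" "(- C) *v v = k *s v"
      using k unfolding matrix_eigenvalue_def by blast
    have "C *v v = (- k) *s v" 
    proof -
      have "C *v v = - (k *s v)" using v(2) neg[of v] by (metis minus_minus)
      then show ?thesis by (simp add: vec_eq_iff)
    qed
    then have "matrix_eigenvalue C (- k)" using v(1) unfolding matrix_eigenvalue_def by blast
    from max[OF this] show ?thesis by simp
  qed
  moreover have "transpose (- C) = - C" using sym by (simp add: transpose_def vec_eq_iff)
  ultimately have "(- u) * (norm x)\<^sup>2 \<le> x \<bullet> ((- C) *v x)" by (intro min_eigenvalue_form)
  then show ?thesis by (simp add: neg)
qed

text \<open>One step of the Euler scheme from the state \<open>x\<close> with delayed state \<open>y\<close>, the noise having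
  been averaged out.\<close>
lemma lyapunov_step:
  fixes A B S T C :: "real^'n^'n"
  defines "V \<equiv> \<lambda>x. x \<bullet> (C *v x)"
  assumes sym: "transpose C = C" and lyap: "transpose A ** C + C ** A = - mat 1"
    and lo: "\<And>x. l * (norm x)\<^sup>2 \<le> V x" and hi: "\<And>x. V x \<le> u * (norm x)\<^sup>2"
    and l: "0 < l" and u: "0 < u" and r: "0 < r" and e: "0 < e"
    and a: "a = - 1 / u + (opnorm (transpose S ** C ** S)
        + r * (opnorm (transpose B ** C) + opnorm (transpose S ** C ** T))) / l"
    and b: "b = (opnorm (transpose T ** C ** T)
        + (opnorm (transpose B ** C) + opnorm (transpose S ** C ** T)) / r) / l"
  obtains h0 where "0 < h0"
    and "\<And>h x y. 0 < h \<Longrightarrow> h < h0 \<Longrightarrow>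
      V (x + h *\<^sub>R (A *v x + B *v y)) + h * V (S *v x + T *v y)
        \<le> (1 + (a + e) * h) * V x + (b + e) * h * V y"
proof -
  let ?s = "opnorm (transpose S ** C ** S)" and ?t = "opnorm (transpose T ** C ** T)"
  let ?b = "opnorm (transpose B ** C)" and ?st = "opnorm (transpose S ** C ** T)"
  have tr: "(D *v x) \<bullet> z = x \<bullet> (transpose D *v z)" for D :: "real^'n^'n" and x z
    by (metis dot_lmul_matrix vector_transpose_matrix)
  have tr3: "x \<bullet> ((transpose D ** C ** E) *v z) = (D *v x) \<bullet> (C *v (E *v z))" for D E :: "real^'n^'n" and x z
    unfolding matrix_vector_mul_assoc[symmetric] tr[symmetric] ..
  have Vadd: "V (x + z) = V x + 2 * (x \<bullet> (C *v z)) + V z" for x z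
    using symmetric_form[OF sym, of x z]
    by (simp add: V_def matrix_vector_right_distrib inner_add_left inner_add_right)
  have V0: "0 \<le> V x" for x using lo[of x] l by (smt (verit) mult_nonneg_nonneg zero_le_power2)
  have VA: "2 * (x \<bullet> (C *v (A *v x))) = - (norm x)\<^sup>2" for x
  proof -
    have "x \<bullet> ((transpose A ** C + C ** A) *v x) = x \<bullet> (transpose A *v (C *v x)) + x \<bullet> (C *v (A *v x))"
      by (simp add: matrix_vector_mult_add_rdistrib inner_add_right matrix_vector_mul_assoc)
    also have "x \<bullet> (transpose A *v (C *v x)) = x \<bullet> (C *v (A *v x))"
      by (metis tr symmetric_form[OF sym])
    finally have "2 * (x \<bullet> (C *v (A *v x))) = x \<bullet> ((- mat 1) *v x)" using lyap by simp
    also have "(- mat 1) *v x = - x" 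
      by (metis (no_types) diff_0 matrix_vector_mul_lid matrix_vector_mult_0 matrix_vector_mult_diff_rdistrib)
    finally show ?thesis by (simp add: power2_norm_eq_inner)
  qed
  \<comment> \<open>The weight \<open>r\<close> fixes how the mixed terms with
    \<open>transpose B ** C\<close> and \<open>transpose S ** C ** T\<close> are shared between the
    present state x and the delayed state y.\<close>
  have young: "2 * (norm x * norm y) \<le> r * (norm x)\<^sup>2 + (norm y)\<^sup>2 / r" for x y :: "real^'n"
  proof -
    have "0 \<le> (r * norm x - norm y)\<^sup>2 / r" using r by simp
    also have "\<dots> = r * (norm x)\<^sup>2 + (norm y)\<^sup>2 / r - 2 * (norm x * norm y)"
      using r by (simp add: field_simps power2_eq_square)
    finally show ?thesis by simp
  qed
  have VB: "2 * (x \<bullet> (C *v (B *v y))) \<le> ?b * (r * (norm x)\<^sup>2 + (norm y)\<^sup>2 / r)" for x y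
  proof -
    have "x \<bullet> (C *v (B *v y)) = y \<bullet> ((transpose B ** C) *v x)"
      by (metis tr symmetric_form[OF sym] matrix_vector_mul_assoc)
    also have "\<dots> \<le> ?b * (norm y * norm x)" by (rule opnorm_form_bound)
    finally have "2 * (x \<bullet> (C *v (B *v y))) \<le> ?b * (2 * (norm x * norm y))" by (simp add: mult_ac)
    also have "\<dots> \<le> ?b * (r * (norm x)\<^sup>2 + (norm y)\<^sup>2 / r)"
      by (intro mult_left_mono young opnorm_ge0)
    finally show ?thesis .
  qed
  have VS: "V (S *v x + T *v y) \<le> ?s * (norm x)\<^sup>2 + ?st * (r * (norm x)\<^sup>2 + (norm y)\<^sup>2 / r) + ?t * (norm y)\<^sup>2" for x y
  proof -
    have 1: "V (S *v x) \<le> ?s * (norm x)\<^sup>2"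
      using opnorm_form_bound[of x "transpose S ** C ** S" x]
      by (simp add: V_def tr3 power2_eq_square)
    have 2: "V (T *v y) \<le> ?t * (norm y)\<^sup>2"
      using opnorm_form_bound[of y "transpose T ** C ** T" y]
      by (simp add: V_def tr3 power2_eq_square)
    have "(S *v x) \<bullet> (C *v (T *v y)) \<le> ?st * (norm x * norm y)"
      using opnorm_form_bound[of x "transpose S ** C ** T" y]
      by (simp add: V_def tr3 power2_eq_square)
    moreover have "?st * (2 * (norm x * norm y)) \<le> ?st * (r * (norm x)\<^sup>2 + (norm y)\<^sup>2 / r)"
      by (intro mult_left_mono young opnorm_ge0)
    ultimately show ?thesis using 1 2 unfolding Vadd by (simp add: mult_ac)
  qed
  \<comment> \<open>\<open>c\<close> bounds the form on the drift in terms of the energies of both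
    states: \<open>u\<close> passes from the form to the norm and 1 / \<open>l\<close> back. The
    summand 1 makes \<open>c\<close> positive, so that e / c is a meaningful step size.\<close>
  define c where "c = 2 * u * ((opnorm A)\<^sup>2 + (opnorm B)\<^sup>2) / l + 1"
  have c: "0 < c" unfolding c_def using u l by (intro add_nonneg_pos) auto
  have VG: "V (A *v x + B *v y) \<le> c * (V x + V y)" for x y
  proof -
    have "norm (A *v x + B *v y) \<le> opnorm A * norm x + opnorm B * norm y"
      using norm_triangle_ineq[of "A *v x" "B *v y"] opnorm_bound[of A x] opnorm_bound[of B y] by linarith
    then have "(norm (A *v x + B *v y))\<^sup>2 \<le> (opnorm A * norm x + opnorm B * norm y)\<^sup>2"
      by (intro power_mono) auto
    also have "\<dots> \<le> 2 * (opnorm A * norm x)\<^sup>2 + 2 * (opnorm B * norm y)\<^sup>2"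
      by (rule square_add_le)
    also have "\<dots> \<le> 2 * ((opnorm A)\<^sup>2 + (opnorm B)\<^sup>2) * ((norm x)\<^sup>2 + (norm y)\<^sup>2)"
      by (simp add: power_mult_distrib algebra_simps)
    finally have "u * (norm (A *v x + B *v y))\<^sup>2 \<le> u * (2 * ((opnorm A)\<^sup>2 + (opnorm B)\<^sup>2) * ((norm x)\<^sup>2 + (norm y)\<^sup>2))"
      using u by (intro mult_left_mono) auto
    then have "V (A *v x + B *v y) \<le> 2 * u * ((opnorm A)\<^sup>2 + (opnorm B)\<^sup>2) / l * (l * ((norm x)\<^sup>2 + (norm y)\<^sup>2))"
      using hi[of "A *v x + B *v y"] l by (simp add: mult_ac)
    also have "\<dots> \<le> c * (V x + V y)"
      using lo[of x] lo[of y] u l V0[of x] V0[of y]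
      by (intro mult_mono) (auto simp: c_def algebra_simps)
    finally show ?thesis .
  qed
  have main: "2 * (x \<bullet> (C *v (A *v x + B *v y))) + V (S *v x + T *v y) \<le> a * V x + b * V y" for x y
  proof -
    have n: "(norm z)\<^sup>2 \<le> V z / l" for z using lo[of z] l by (simp add: field_simps)
    have n2: "- (norm z)\<^sup>2 \<le> - (V z / u)" for z using hi[of z] u by (simp add: field_simps)
    have "2 * (x \<bullet> (C *v (A *v x + B *v y))) + V (S *v x + T *v y)
       \<le> - (norm x)\<^sup>2 + (?s + r * (?b + ?st)) * (norm x)\<^sup>2 + (?t + (?b + ?st) / r) * (norm y)\<^sup>2"
      using VA[of x] VB[of x y] VS[of x y]
      by (simp add: matrix_vector_right_distrib inner_add_right algebra_simps add_divide_distrib)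
    also have "\<dots> \<le> - (V x / u) + (?s + r * (?b + ?st)) * (V x / l) + (?t + (?b + ?st) / r) * (V y / l)"
      using r by (intro add_mono n2 mult_left_mono n) (auto intro!: add_nonneg_nonneg mult_nonneg_nonneg divide_nonneg_nonneg opnorm_ge0)
    finally show ?thesis by (simp add: a b algebra_simps add_divide_distrib)
  qed
  show thesis
  \<comment> \<open>Below this step size the quadratic term
    \<open>h\<^sup>2 * V (A *v x + B *v y)\<close> costs at most e h of each energy, which is
    exactly the slack in the conclusion.\<close>
  proof (rule that[of "e / c"])
    fix h x y assume h: "0 < h" "h < e / c"
    have "h * (2 * (x \<bullet> (C *v (A *v x + B *v y))) + V (S *v x + T *v y)) \<le> h * (a * V x + b * V y)"
      using main[of x y] h by (intro mult_left_mono) auto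
    moreover have "h\<^sup>2 * V (A *v x + B *v y) \<le> e * h * (V x + V y)"
    proof -
      have "h * V (A *v x + B *v y) \<le> h * (c * (V x + V y))"
        using VG[of x y] h by (intro mult_left_mono) auto
      also have "\<dots> = (h * c) * (V x + V y)" by simp
      also have "\<dots> \<le> e * (V x + V y)"
        using h c V0[of x] V0[of y] by (intro mult_right_mono) (auto simp: field_simps)
      finally have "h * (h * V (A *v x + B *v y)) \<le> h * (e * (V x + V y))"
        using h by (intro mult_left_mono) auto
      then show ?thesis by (simp add: power2_eq_square mult_ac)
    qed
    moreover have "V (x + h *\<^sub>R z) = V x + h * (2 * (x \<bullet> (C *v z))) + h\<^sup>2 * V z" for z
    proof -
      have "V (h *\<^sub>R z) = h\<^sup>2 * V z" "C *v (h *\<^sub>R z) = h *\<^sub>R (C *v z)"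
        by (simp_all add: V_def matrix_vector_mult_scaleR power2_eq_square)
      then show ?thesis unfolding Vadd by simp
    qed
    ultimately show "V (x + h *\<^sub>R (A *v x + B *v y)) + h * V (S *v x + T *v y)
        \<le> (1 + (a + e) * h) * V x + (b + e) * h * V y"
      by (simp add: distrib_left distrib_right mult_ac)
  qed (use e c in simp)
qed

section \<open>Scalar comparison for delayed recursions\<close>

text \<open>Grid index of the delayed time \<open>q t\<close>; the minimum only serves to make \<open>delay q k \<le> k\<close>
  hold unconditionally.\<close>
definition delay :: "real \<Rightarrow> nat \<Rightarrow> nat" where
  "delay q k = min k (nat \<lfloor>q * real k\<rfloor>)"

lemma delay_le: "delay q k \<le> k"
  by (simp add: delay_def)

lemma delay_bounds:
  assumes "0 < q" "q < 1"
  shows "real (delay q k) \<le> q * real k" and "q * real k < real (delay q k) + 1"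
proof -
  have "q * real k \<le> real k" using assms by (simp add: mult_left_le_one_le)
  then have "nat \<lfloor>q * real k\<rfloor> \<le> k" by (metis floor_mono floor_of_nat nat_int nat_mono)
  then have d: "delay q k = nat \<lfloor>q * real k\<rfloor>" by (simp add: delay_def)
  have "0 \<le> q * real k" using assms by simp
  then show "real (delay q k) \<le> q * real k" "q * real k < real (delay q k) + 1"
    unfolding d by linarith+
qed

text \<open>With nonnegative coefficients the right-hand side is monotone in the earlier values, so
  domination propagates. The delayed index may lie far back, hence the strong induction.\<close>

lemma delay_comparison:
  fixes v w :: "nat \<Rightarrow> real"
  assumes "0 \<le> a" "0 \<le> b"
    and v: "\<And>k. k < n \<Longrightarrow> v (Suc k) \<le> a * v k + b * v (delay q k)"
    and w: "\<And>k. k < n \<Longrightarrow> a * w k + b * w (delay q k) \<le> w (Suc k)"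
    and 0: "v 0 \<le> w 0" and k: "k \<le> n"
  shows "v k \<le> w k"
  using k
proof (induction k rule: less_induct)
  case (less k)
  show ?case
  proof (cases k)
    case (Suc j)
    have "v (Suc j) \<le> a * v j + b * v (delay q j)" using v less.prems Suc by simp
    also have "\<dots> \<le> a * w j + b * w (delay q j)"
      using less Suc assms(1,2) delay_le[of q j]
      by (intro add_mono mult_left_mono less.IH) auto
    also have "\<dots> \<le> w (Suc j)" using w less.prems Suc by simp
    finally show ?thesis using Suc by simp
  qed (use 0 in simp)
qed

text \<open>One function serves all small step sizes at once, so constants survive the limit h to 0.
  The sign of 1 + a h is what \<open>delay_comparison\<close> asks for. The bound on the delayed
  value by the power at the undelayed time serves the drift and noise estimates, which involve both
  states.\<close>

definition supersolution ::
    "real \<Rightarrow> real \<Rightarrow> real \<Rightarrow> real \<Rightarrow> (real \<Rightarrow> real) \<Rightarrow> real \<Rightarrow> real \<Rightarrow> bool" where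
  "supersolution q a b \<alpha> \<phi> K h0 \<longleftrightarrow> 0 < h0 \<and> 0 < K \<and> \<phi> 0 = 1 \<and>
     (\<forall>t\<ge>0. 0 < \<phi> t \<and> \<phi> t \<le> K * (1 + t) powr \<alpha>) \<and>
     (\<forall>h k. 0 < h \<longrightarrow> h < h0 \<longrightarrow> 0 \<le> 1 + a * h \<and>
        \<phi> (real (delay q k) * h) \<le> K * (1 + real k * h) powr \<alpha> \<and>
        (1 + a * h) * \<phi> (real k * h) + b * h * \<phi> (real (delay q k) * h) \<le> \<phi> (real (Suc k) * h))"

text \<open>The function is (1 + d t)^\<alpha>. Going back to the delayed grid time multiplies it by
  at most q^\<alpha>, so one step changes it by a relative rate a + b q^\<alpha>, and a small
  \<open>d\<close> makes the function decay more slowly than that.\<close>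

lemma supersolution_decay:
  assumes q: "0 < q" "q < 1" and b: "0 \<le> b" and \<alpha>: "\<alpha> < 0" and ab: "a + b * q powr \<alpha> < 0"
  obtains \<phi> K h0 where "supersolution q a b \<alpha> \<phi> K h0"
proof -
  \<comment> \<open>The relative decay rate of \<phi> is fastest at time 0, where it equals
    -\<alpha> d; this choice keeps it below -(a + b q^\<alpha>).\<close>
  define d where "d = min 1 ((a + b * q powr \<alpha>) / \<alpha>)"
  have d: "0 < d" "d \<le> 1" using ab \<alpha> by (auto simp: d_def divide_neg_neg)
  have "d \<le> (a + b * q powr \<alpha>) / \<alpha>" by (simp add: d_def)
  then have d2: "a + b * q powr \<alpha> \<le> \<alpha> * d" using \<alpha> by (simp add: field_simps)
  define \<phi> where "\<phi> t = (1 + d * t) powr \<alpha>" for t :: real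
  \<comment> \<open>The bound 1 - q absorbs the rounding of the delayed index: it gives q (1 + d t)
    \<le> 1 + d t' for the rounded time t'. The other bound keeps 1 + a h nonnegative.\<close>
  define h0 where "h0 = min (1 - q) (1 / (\<bar>a\<bar> + 1))"
  have q1: "1 \<le> q powr \<alpha>"
    using q \<alpha> by (smt (verit) powr_mono2' powr_one_eq_one)
  have le: "\<phi> t \<le> d powr \<alpha> * (1 + t) powr \<alpha>" if t: "0 \<le> t" for t
  proof -
    have "\<phi> t \<le> (d * (1 + t)) powr \<alpha>"
      unfolding \<phi>_def using d t \<alpha> by (intro powr_mono2') (auto simp: algebra_simps intro!: add_pos_nonneg)
    then show ?thesis using d t by (simp add: powr_mult)
  qed
  have dl: "\<phi> (real (delay q k) * h) \<le> q powr \<alpha> * \<phi> (real k * h)" if h: "0 < h" "h < h0" for h k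
  proof -
    have "d * h \<le> h" using d h by (simp add: mult_left_le_one_le)
    also have "h \<le> 1 - q" using h by (simp add: h0_def)
    finally have dh: "d * h \<le> 1 - q" .
    have "(q * real k - 1) * (d * h) \<le> real (delay q k) * (d * h)"
      using delay_bounds(2)[OF q, of k] d h by (intro mult_right_mono) auto
    then have "q * (1 + d * (real k * h)) \<le> 1 + d * (real (delay q k) * h)"
      using dh by (simp add: algebra_simps)
    then have "\<phi> (real (delay q k) * h) \<le> (q * (1 + d * (real k * h))) powr \<alpha>"
      unfolding \<phi>_def using d h \<alpha> q
      by (intro powr_mono2') (auto intro!: mult_pos_pos add_pos_nonneg)
    then show ?thesis using q d h by (simp add: powr_mult \<phi>_def)
  qed
  have step: "(1 + a * h) * \<phi> (real k * h) + b * h * \<phi> (real (delay q k) * h) \<le> \<phi> (real (Suc k) * h)"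
    if h: "0 < h" "h < h0" for h k
  proof -
    define t where "t = real k * h"
    define x where "x = d * h / (1 + d * t)"
    have t: "0 \<le> t" using h by (simp add: t_def)
    have dt: "0 < 1 + d * t" using t d by (intro add_pos_nonneg) auto
    have x: "0 \<le> x" "x \<le> d * h"
      using d h t dt divide_left_mono[of 1 "1 + d * t" "d * h"] by (auto simp: x_def)
    have p: "0 < \<phi> t" using dt by (simp add: \<phi>_def)
    have "(1 + a * h) * \<phi> t + b * h * \<phi> (real (delay q k) * h) \<le> (1 + a * h) * \<phi> t + b * h * (q powr \<alpha> * \<phi> t)"
      using dl[OF h, of k] b h by (intro add_left_mono mult_left_mono) (auto simp: t_def)
    also have "\<dots> = \<phi> t * (1 + (a + b * q powr \<alpha>) * h)" by (simp add: algebra_simps)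
    \<comment> \<open>Here x is the relative growth of 1 + d t in one step. Since \<alpha> is
      negative, ln (1 + x) \<le> x \<le> d h turns the rate into the logarithm of (1 + x)^\<alpha>,
      and exp y \<ge> 1 + y removes the logarithm.\<close>
    also have "\<dots> \<le> \<phi> t * (1 + \<alpha> * ln (1 + x))"
    proof -
      have "(a + b * q powr \<alpha>) * h \<le> \<alpha> * (d * h)" 
        using h mult_right_mono[OF d2, of h] by (simp add: mult.assoc)
      also have "\<dots> \<le> \<alpha> * ln (1 + x)"
        using x \<alpha> ln_add_one_self_le_self[of x] by (intro mult_left_mono_neg) auto
      finally show ?thesis using p by (intro mult_left_mono) auto
    qed
    also have "\<dots> \<le> \<phi> t * (1 + x) powr \<alpha>"
      using p x exp_ge_add_one_self[of "\<alpha> * ln (1 + x)"] by (intro mult_left_mono) (auto simp: powr_def)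
    also have "\<dots> = ((1 + d * t) * (1 + x)) powr \<alpha>"
      using dt x by (simp add: \<phi>_def powr_mult)
    also have "(1 + d * t) * (1 + x) = 1 + d * (real (Suc k) * h)"
      using dt by (simp add: x_def t_def field_simps)
    finally show ?thesis by (simp add: \<phi>_def t_def)
  qed
  have K: "\<phi> t \<le> (q powr \<alpha> * d powr \<alpha>) * (1 + t) powr \<alpha>" if "0 \<le> t" for t
  proof -
    have "\<phi> t \<le> 1 * (d powr \<alpha> * (1 + t) powr \<alpha>)" using le[OF that] by simp
    also have "\<dots> \<le> q powr \<alpha> * (d powr \<alpha> * (1 + t) powr \<alpha>)" by (intro mult_right_mono q1) auto
    finally show ?thesis by simp
  qed
  have "supersolution q a b \<alpha> \<phi> (q powr \<alpha> * d powr \<alpha>) h0"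
    unfolding supersolution_def
  proof (intro conjI allI impI)
    show "0 < h0" using q by (simp add: h0_def)
    show "0 < q powr \<alpha> * d powr \<alpha>" using q d by simp
    show "\<phi> 0 = 1" by (simp add: \<phi>_def)
    show "0 < \<phi> t" "\<phi> t \<le> q powr \<alpha> * d powr \<alpha> * (1 + t) powr \<alpha>" if "0 \<le> t" for t
      using K[OF that] d that by (auto simp: \<phi>_def) (smt (verit) mult_nonneg_nonneg)
    fix h :: real and k :: nat assume h: "0 < h" "h < h0"
    have "h * (\<bar>a\<bar> + 1) \<le> 1" using h by (simp add: h0_def pos_less_divide_eq)
    moreover have "- (a * h) \<le> h * (\<bar>a\<bar> + 1)" using h mult_left_mono[of "- a" "\<bar>a\<bar> + 1" h] by (simp add: mult.commute)
    ultimately show "0 \<le> 1 + a * h" by simp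
    have "\<phi> (real (delay q k) * h) \<le> q powr \<alpha> * \<phi> (real k * h)" by (rule dl[OF h])
    also have "\<dots> \<le> q powr \<alpha> * (d powr \<alpha> * (1 + real k * h) powr \<alpha>)"
      using h by (intro mult_left_mono le) auto
    finally show "\<phi> (real (delay q k) * h) \<le> q powr \<alpha> * d powr \<alpha> * (1 + real k * h) powr \<alpha>" by simp
    show "(1 + a * h) * \<phi> (real k * h) + b * h * \<phi> (real (delay q k) * h) \<le> \<phi> (real (Suc k) * h)"
      by (rule step[OF h])
  qed
  then show thesis by (rule that)
qed

text \<open>For (1 + t)^n with n large, two regimes suffice. At late times the delayed value is
  smaller by a factor below r^n, so a < 0 dominates; for t \<le> 1 the growth rate n / (1 + t) alone
  outweighs b. An integer exponent allows Bernoulli's inequality.\<close>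

lemma supersolution_growth:
  assumes q: "0 < q" "q < 1" and b: "0 \<le> b" and a: "a < 0"
  obtains \<alpha> \<phi> K h0 where "0 < \<alpha>" and "supersolution q a b \<alpha> \<phi> K h0"
proof -
  \<comment> \<open>This is (1 + q t) / (1 + t) at t = 1, and the quotient decreases in t.\<close>
  define r where "r = (1 + q) / 2"
  have r: "0 < r" "r < 1" using q by (auto simp: r_def)
  have "(\<lambda>n. b * r ^ n) \<longlonglongrightarrow> b * 0" using r by (intro tendsto_intros) (auto intro: LIMSEQ_realpow_zero)
  then have "eventually (\<lambda>n. b * r ^ n < - a) sequentially"
    using a by (intro order_tendstoD) auto
  moreover have "eventually (\<lambda>n. max 1 (2 * b) \<le> real n) sequentially"
    using eventually_ge_at_top[of "nat \<lceil>max 1 (2 * b)\<rceil>"] by eventually_elim linarith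
  ultimately have "eventually (\<lambda>n. b * r ^ n < - a \<and> max 1 (2 * b) \<le> real n) sequentially"
    by eventually_elim simp
  then obtain n where n: "b * r ^ n < - a" "1 \<le> n" "2 * b \<le> real n"
    by (auto simp: eventually_sequentially)
  define \<phi> where "\<phi> t = (1 + t) ^ n" for t :: real
  have dl: "\<phi> (real (delay q k) * h) \<le> \<phi> (q * (real k * h))" if h: "0 < h" for h k
  proof -
    have "real (delay q k) * h \<le> (q * real k) * h"
      using delay_bounds(1)[OF q] h by (intro mult_right_mono) auto
    then show ?thesis unfolding \<phi>_def using h by (intro power_mono) (auto simp: mult.assoc)
  qed
  have step: "(1 + a * h) * \<phi> (real k * h) + b * h * \<phi> (real (delay q k) * h) \<le> \<phi> (real (Suc k) * h)"
    if h: "0 < h" for h k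
  proof -
    define t where "t = real k * h"
    have t: "0 \<le> t" using h by (simp add: t_def)
    define s where "s = (1 + q * t) / (1 + t)"
    have s: "0 \<le> s" "s \<le> 1" using q t by (auto simp: s_def mult_left_le_one_le field_simps)
    have "b * s ^ n \<le> real n / (1 + t) - a"
    proof (cases "t \<le> 1")
      case True
      have "b * s ^ n \<le> b" using b s by (simp add: power_le_one mult_left_le)
      also have "\<dots> \<le> real n / 2" using n by simp
      also have "\<dots> \<le> real n / (1 + t)" using True t by (intro divide_left_mono) auto
      finally show ?thesis using a by simp
    next
      case False
      have "0 \<le> (1 - q) * (t - 1)" using False q by (intro mult_nonneg_nonneg) auto
      then have "s \<le> r" using t by (simp add: s_def r_def field_simps)
      then have "b * s ^ n \<le> b * r ^ n" using b s by (intro mult_left_mono power_mono) auto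
      also have "\<dots> < - a" by (rule n)
      finally show ?thesis using t by (smt (verit) divide_nonneg_nonneg of_nat_0_le_iff)
    qed
    then have "b * h * s ^ n \<le> (real n / (1 + t) - a) * h"
      using h mult_right_mono[of "b * s ^ n" "real n / (1 + t) - a" h] by (simp add: mult_ac)
    then have *: "1 + a * h + b * h * s ^ n \<le> 1 + real n * (h / (1 + t))"
      by (simp add: algebra_simps)
    have "(1 + a * h) * \<phi> t + b * h * \<phi> (real (delay q k) * h) \<le> (1 + a * h) * \<phi> t + b * h * \<phi> (q * t)"
      using dl[OF h, of k] b h by (intro add_left_mono mult_left_mono) (auto simp: t_def)
    also have "\<phi> (q * t) = s ^ n * \<phi> t"
      using t by (simp add: \<phi>_def s_def power_divide)
    also have "(1 + a * h) * \<phi> t + b * h * (s ^ n * \<phi> t) = (1 + a * h + b * h * s ^ n) * \<phi> t"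
      by (simp add: algebra_simps)
    also have "\<dots> \<le> (1 + real n * (h / (1 + t))) * \<phi> t"
      using * t by (intro mult_right_mono) (auto simp: \<phi>_def)
    also have "\<dots> \<le> (1 + h / (1 + t)) ^ n * \<phi> t"
    proof (intro mult_right_mono)
      have "- 1 \<le> h / (1 + t)" using h t by (smt (verit) divide_nonneg_nonneg)
      then show "1 + real n * (h / (1 + t)) \<le> (1 + h / (1 + t)) ^ n" by (rule Bernoulli_inequality)
    qed (use t in \<open>auto simp: \<phi>_def\<close>)
    also have "\<dots> = ((1 + h / (1 + t)) * (1 + t)) ^ n" by (simp add: \<phi>_def power_mult_distrib)
    also have "(1 + h / (1 + t)) * (1 + t) = 1 + real (Suc k) * h"
      using t by (simp add: t_def field_simps)
    finally show ?thesis by (simp add: \<phi>_def t_def)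
  qed
  have pw: "(1 + t) powr real n = \<phi> t" if "0 \<le> t" for t
    using that by (simp add: \<phi>_def powr_realpow)
  have "supersolution q a b (real n) \<phi> 1 (1 / (\<bar>a\<bar> + 1))"
    unfolding supersolution_def
  proof (intro conjI allI impI)
    show "0 < \<phi> t" "\<phi> t \<le> 1 * (1 + t) powr real n" if "0 \<le> t" for t
      using that by (auto simp: pw) (simp add: \<phi>_def)
    fix h :: real and k :: nat assume h: "0 < h" "h < 1 / (\<bar>a\<bar> + 1)"
    have "h * (\<bar>a\<bar> + 1) \<le> 1" using h by (simp add: pos_less_divide_eq)
    moreover have "- (a * h) \<le> h * (\<bar>a\<bar> + 1)" using h mult_left_mono[of "- a" "\<bar>a\<bar> + 1" h] by (simp add: mult.commute)
    ultimately show "0 \<le> 1 + a * h" by simp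
    have "real (delay q k) * h \<le> real k * h" using delay_le[of q k] h by (intro mult_right_mono) auto
    then have "\<phi> (real (delay q k) * h) \<le> \<phi> (real k * h)"
      unfolding \<phi>_def using h by (intro power_mono) auto
    then show "\<phi> (real (delay q k) * h) \<le> 1 * (1 + real k * h) powr real n" using h by (simp add: pw)
    show "(1 + a * h) * \<phi> (real k * h) + b * h * \<phi> (real (delay q k) * h) \<le> \<phi> (real (Suc k) * h)"
      by (rule step[OF h(1)])
  qed (auto simp: \<phi>_def)
  then show thesis using n(2) by (intro that[of "real n"]) auto
qed

text \<open>Continuity in e at 0. The gain in a and b later pays for the step size in
  \<open>lyapunov_step\<close>; the gain in the exponent leaves room between the supersolution and
  the exponent that is claimed.\<close>

lemma exponent_slack:
  fixes q :: real
  assumes q: "0 < q" and ab: "a + b * q powr \<alpha> < 0"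
  obtains e where "0 < e" and "(a + e) + (b + e) * q powr (\<alpha> - e) < 0"
proof -
  have "((\<lambda>e. (a + e) + (b + e) * q powr (\<alpha> - e)) \<longlongrightarrow> (a + 0) + (b + 0) * q powr (\<alpha> - 0)) (at_right 0)"
    using q by (intro tendsto_intros) auto
  then have "eventually (\<lambda>e. (a + e) + (b + e) * q powr (\<alpha> - e) < 0) (at_right 0)"
    using ab by (intro order_tendstoD) auto
  moreover have "eventually (\<lambda>e::real. 0 < e) (at_right 0)" by (simp add: eventually_at_right_less)
  ultimately have "eventually (\<lambda>e. 0 < e \<and> (a + e) + (b + e) * q powr (\<alpha> - e) < 0) (at_right 0)"
    by eventually_elim simp
  then show thesis using that eventually_happens[of _ "at_right (0::real)"] by auto
qed

section \<open>Maximal inequalities for discrete stochastic sums\<close>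

context prob_space
begin

text \<open>The outer probability of \<open>Q\<close> is at most \<open>\<eta>\<close>; no measurability of \<open>Q\<close> is implied.\<close>
definition prob_le :: "('a \<Rightarrow> bool) \<Rightarrow> real \<Rightarrow> bool" where
  "prob_le Q \<eta> \<longleftrightarrow> (\<exists>E\<in>events. prob E \<le> \<eta> \<and> (\<forall>\<omega>\<in>space M - E. \<not> Q \<omega>))"

lemma prob_leI: "E \<in> events \<Longrightarrow> prob E \<le> \<eta> \<Longrightarrow> (\<And>\<omega>. \<omega> \<in> space M \<Longrightarrow> Q \<omega> \<Longrightarrow> \<omega> \<in> E) \<Longrightarrow> prob_le Q \<eta>"
  unfolding prob_le_def by blast

lemma prob_le_mono:
  "prob_le Q \<eta> \<Longrightarrow> \<eta> \<le> \<eta>' \<Longrightarrow> (\<And>\<omega>. \<omega> \<in> space M \<Longrightarrow> Q' \<omega> \<Longrightarrow> Q \<omega>) \<Longrightarrow> prob_le Q' \<eta>'"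
  unfolding prob_le_def by (meson DiffD1 order_trans)

lemma prob_leD:
  assumes "prob_le Q \<eta>" "{\<omega>\<in>space M. Q \<omega>} \<in> events"
  shows "prob {\<omega>\<in>space M. Q \<omega>} \<le> \<eta>"
proof -
  obtain E where E: "E \<in> events" "prob E \<le> \<eta>" "\<forall>\<omega>\<in>space M - E. \<not> Q \<omega>"
    using assms(1) unfolding prob_le_def by blast
  then have "prob {\<omega>\<in>space M. Q \<omega>} \<le> prob E" by (intro finite_measure_mono) auto
  then show ?thesis using E by simp
qed

lemma prob_le_disj:
  assumes "prob_le Q a" "prob_le R b"
  shows "prob_le (\<lambda>\<omega>. Q \<omega> \<or> R \<omega>) (a + b)"
proof -
  obtain E E' where E: "E \<in> events" "prob E \<le> a" "\<forall>\<omega>\<in>space M - E. \<not> Q \<omega>"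
    and E': "E' \<in> events" "prob E' \<le> b" "\<forall>\<omega>\<in>space M - E'. \<not> R \<omega>"
    using assms unfolding prob_le_def by blast
  have "prob (E \<union> E') \<le> a + b"
    using measure_Un_le[OF E(1) E'(1)] E E' by linarith
  then show ?thesis using E E' by (intro prob_leI[of "E \<union> E'"]) auto
qed

lemma prob_le_AE: "AE \<omega> in M. \<not> Q \<omega> \<Longrightarrow> prob_le Q 0"
  unfolding eventually_ae_filter
  by (auto intro!: prob_leI simp: null_sets_def measure_def)

lemma prob_le_finite:
  assumes "\<And>i. i < n \<Longrightarrow> prob_le (Q i) a" "0 \<le> a"
  shows "prob_le (\<lambda>\<omega>. \<exists>i<n. Q i \<omega>) (real n * a)"
  using assms(1)
proof (induction n)
  case (Suc n)
  have "prob_le (\<lambda>\<omega>. (\<exists>i<n. Q i \<omega>) \<or> Q n \<omega>) (real n * a + a)"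
    using Suc by (intro prob_le_disj) auto
  then show ?case by (rule prob_le_mono) (auto simp: less_Suc_eq algebra_simps)
qed (auto intro: prob_leI[of "{}"])

lemma prob_le_tendsto_0:
  assumes "(\<lambda>n. emeasure M {\<omega>\<in>space M. Q n \<omega>}) \<longlonglongrightarrow> 0" "0 < \<eta>"
    and "\<And>n. {\<omega>\<in>space M. Q n \<omega>} \<in> events"
  shows "eventually (\<lambda>n. prob_le (Q n) \<eta>) sequentially"
proof -
  have "eventually (\<lambda>n. emeasure M {\<omega>\<in>space M. Q n \<omega>} < ennreal \<eta>) sequentially"
    using assms by (intro order_tendstoD) auto
  then show ?thesis
  proof eventually_elim
    case (elim n)
    then have "prob {\<omega>\<in>space M. Q n \<omega>} \<le> \<eta>"
      using assms(2) by (simp add: emeasure_eq_measure ennreal_less_iff)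
    then show ?case using assms(3) by (intro prob_leI[of "{\<omega>\<in>space M. Q n \<omega>}"]) auto
  qed
qed

lemma prob_le_second_moment:
  fixes f :: "'a \<Rightarrow> real"
  assumes f: "f \<in> borel_measurable M" "integrable M (\<lambda>\<omega>. (f \<omega>)\<^sup>2)" and m: "(\<integral>\<omega>. (f \<omega>)\<^sup>2 \<partial>M) \<le> m" and r: "0 < r"
  shows "prob_le (\<lambda>\<omega>. r < f \<omega>) (m / r\<^sup>2)"
proof (rule prob_leI)
  show "{\<omega>\<in>space M. r\<^sup>2 \<le> (f \<omega>)\<^sup>2} \<in> events" using f by measurable
  have "prob {\<omega>\<in>space M. r\<^sup>2 \<le> (f \<omega>)\<^sup>2} \<le> (\<integral>\<omega>. (f \<omega>)\<^sup>2 \<partial>M) / r\<^sup>2"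
    using f r by (intro integral_Markov_inequality_measure[where A = "{}"]) auto
  also have "\<dots> \<le> m / r\<^sup>2" using m by (intro divide_right_mono) auto
  finally show "prob {\<omega>\<in>space M. r\<^sup>2 \<le> (f \<omega>)\<^sup>2} \<le> m / r\<^sup>2" .
  show "\<omega> \<in> {\<omega>\<in>space M. r\<^sup>2 \<le> (f \<omega>)\<^sup>2}" if "\<omega> \<in> space M" "r < f \<omega>" for \<omega>
    using that r by (auto intro!: power_mono)
qed

lemma prob_le_borel_cantelli:
  assumes Q: "\<And>n. prob_le (Q n) (a n)" and sum: "summable a"
  shows "AE \<omega> in M. eventually (\<lambda>n. \<not> Q n \<omega>) sequentially"
proof -
  have "\<forall>n. \<exists>E\<in>events. prob E \<le> a n \<and> (\<forall>\<omega>\<in>space M - E. \<not> Q n \<omega>)"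
    using Q unfolding prob_le_def by blast
  then obtain E where E: "\<And>n. E n \<in> events" "\<And>n. prob (E n) \<le> a n"
    "\<And>n \<omega>. \<omega> \<in> space M - E n \<Longrightarrow> \<not> Q n \<omega>" by metis
  have "summable (\<lambda>n. prob (E n))"
    by (rule summable_comparison_test'[OF sum, of 0]) (simp add: E(2))
  then have "AE \<omega> in M. eventually (\<lambda>n. \<omega> \<in> space M - E n) sequentially"
    using E(1) by (intro borel_cantelli_AE1) (auto simp: less_top[symmetric])
  then show ?thesis
  proof eventually_elim
    case (elim \<omega>)
    then show ?case by eventually_elim (rule E(3))
  qed
qed

end

text \<open>What the estimates use of Brownian motion: given the past, an increment has mean zero
  and second moment t - s. Testing against integrable past-measurable Z expresses this without
  conditional expectations. The locale is later interpreted with the completed measure and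
  filtration.\<close>

locale brownian_filtration = prob_space P for P :: "'w measure" +
  fixes F :: "real \<Rightarrow> 'w measure" and W :: "real \<Rightarrow> 'w \<Rightarrow> real"
  assumes subalg: "0 \<le> t \<Longrightarrow> subalgebra P (F t)"
    and filtration: "0 \<le> s \<Longrightarrow> s \<le> t \<Longrightarrow> subalgebra (F t) (F s)"
    and W_adapted: "0 \<le> t \<Longrightarrow> W t \<in> borel_measurable (F t)"
    and increment:
      "\<lbrakk>0 \<le> s; s \<le> t; Z \<in> borel_measurable (F s); integrable P Z\<rbrakk> \<Longrightarrow>
        integrable P (\<lambda>\<omega>. (W t \<omega> - W s \<omega>) * Z \<omega>) \<and> (\<integral>\<omega>. (W t \<omega> - W s \<omega>) * Z \<omega> \<partial>P) = 0"
    and increment_square: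
      "\<lbrakk>0 \<le> s; s \<le> t; Z \<in> borel_measurable (F s); integrable P Z\<rbrakk> \<Longrightarrow>
        integrable P (\<lambda>\<omega>. (W t \<omega> - W s \<omega>)\<^sup>2 * Z \<omega>) \<and>
        (\<integral>\<omega>. (W t \<omega> - W s \<omega>)\<^sup>2 * Z \<omega> \<partial>P) = (t - s) * (\<integral>\<omega>. Z \<omega> \<partial>P)"
begin

lemma F_measurable: "0 \<le> s \<Longrightarrow> U \<in> borel_measurable (F s) \<Longrightarrow> U \<in> borel_measurable P"
  using measurable_from_subalg[OF subalg] by blast

lemma F_measurable_mono:
  "0 \<le> s \<Longrightarrow> s \<le> t \<Longrightarrow> U \<in> borel_measurable (F s) \<Longrightarrow> U \<in> borel_measurable (F t)"
  using measurable_from_subalg[OF filtration] by blast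

lemma W_increment_measurable:
  assumes "0 \<le> s" "s \<le> t"
  shows "(\<lambda>\<omega>. W t \<omega> - W s \<omega>) \<in> borel_measurable (F t)"
  using F_measurable_mono[OF assms W_adapted[OF assms(1)]] W_adapted[of t] assms by simp

section \<open>Square-integrable adapted vectors\<close>

definition L2 :: "real \<Rightarrow> ('w \<Rightarrow> real ^ 'n) \<Rightarrow> bool" where
  "L2 s U \<longleftrightarrow> U \<in> borel_measurable (F s) \<and> integrable P (\<lambda>\<omega>. (norm (U \<omega>))\<^sup>2)"

lemma L2_integrable_inner:
  assumes "0 \<le> s" "L2 s U" "L2 s Z"
  shows "integrable P (\<lambda>\<omega>. U \<omega> \<bullet> Z \<omega>)"
proof (rule Bochner_Integration.integrable_bound)
  show "integrable P (\<lambda>\<omega>. (norm (U \<omega>))\<^sup>2 + (norm (Z \<omega>))\<^sup>2)"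
    using assms by (auto simp: L2_def)
  show "(\<lambda>\<omega>. U \<omega> \<bullet> Z \<omega>) \<in> borel_measurable P"
    using assms by (auto simp: L2_def intro!: borel_measurable_inner F_measurable)
  show "AE \<omega> in P. norm (U \<omega> \<bullet> Z \<omega>) \<le> norm ((norm (U \<omega>))\<^sup>2 + (norm (Z \<omega>))\<^sup>2)"
  proof (intro AE_I2)
    fix \<omega>
    have "\<bar>U \<omega> \<bullet> Z \<omega>\<bar> \<le> norm (U \<omega>) * norm (Z \<omega>)" by (rule Cauchy_Schwarz_ineq2)
    moreover have "2 * (norm (U \<omega>) * norm (Z \<omega>)) \<le> (norm (U \<omega>))\<^sup>2 + (norm (Z \<omega>))\<^sup>2"
      using sum_squares_bound[of "norm (U \<omega>)" "norm (Z \<omega>)"] by simp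
    moreover have "0 \<le> norm (U \<omega>) * norm (Z \<omega>)" by simp
    ultimately show "norm (U \<omega> \<bullet> Z \<omega>) \<le> norm ((norm (U \<omega>))\<^sup>2 + (norm (Z \<omega>))\<^sup>2)" by simp
  qed
qed

lemma L2_mono: "0 \<le> s \<Longrightarrow> s \<le> t \<Longrightarrow> L2 s U \<Longrightarrow> L2 t U"
  using F_measurable_mono by (auto simp: L2_def)

lemma L2_zero [simp]: "L2 s (\<lambda>_. 0)"
  by (simp add: L2_def)

lemma L2_dominated:
  assumes "0 \<le> s" "U \<in> borel_measurable (F s)" "integrable P g"
    and "\<And>\<omega>. \<omega> \<in> space P \<Longrightarrow> (norm (U \<omega>))\<^sup>2 \<le> g \<omega>"
  shows "L2 s U"
  unfolding L2_def
proof (intro conjI Bochner_Integration.integrable_bound[OF assms(3)] AE_I2)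
  have "U \<in> borel_measurable P" using assms F_measurable by blast
  then show "(\<lambda>\<omega>. (norm (U \<omega>))\<^sup>2) \<in> borel_measurable P" by measurable
  show "norm ((norm (U \<omega>))\<^sup>2) \<le> norm (g \<omega>)" if "\<omega> \<in> space P" for \<omega>
    using assms(4)[OF that] by simp
qed (fact assms)

lemma L2_add:
  assumes s: "0 \<le> s" and U: "L2 s U" and Z: "L2 s Z"
  shows "L2 s (\<lambda>\<omega>. U \<omega> + Z \<omega>)"
proof (rule L2_dominated[OF s])
  show "(\<lambda>\<omega>. U \<omega> + Z \<omega>) \<in> borel_measurable (F s)" using U Z by (auto simp: L2_def)
  show "integrable P (\<lambda>\<omega>. 2 * (norm (U \<omega>))\<^sup>2 + 2 * (norm (Z \<omega>))\<^sup>2)"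
    using U Z by (simp add: L2_def)
qed (rule norm_add_square_le)

lemma matrix_measurable: "U \<in> borel_measurable N \<Longrightarrow> (\<lambda>\<omega>. (D :: real^'n^'m) *v U \<omega>) \<in> borel_measurable N"
proof -
  assume U: "U \<in> borel_measurable N"
  have "(\<lambda>x. D *v x) \<in> borel_measurable borel"
    by (intro borel_measurable_continuous_onI linear_continuous_on matrix_vector_mul_bounded_linear)
  from measurable_compose[OF U this] show ?thesis .
qed

lemma L2_matrix:
  assumes s: "0 \<le> s" and U: "L2 s U"
  shows "L2 s (\<lambda>\<omega>. (D :: real^'n^'m) *v U \<omega>)"
proof (rule L2_dominated[OF s])
  show "(\<lambda>\<omega>. D *v U \<omega>) \<in> borel_measurable (F s)" using U by (auto simp: L2_def intro: matrix_measurable)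
  show "integrable P (\<lambda>\<omega>. (opnorm D)\<^sup>2 * (norm (U \<omega>))\<^sup>2)" using U by (simp add: L2_def)
  show "(norm (D *v U \<omega>))\<^sup>2 \<le> (opnorm D)\<^sup>2 * (norm (U \<omega>))\<^sup>2" for \<omega>
    using power_mono[OF opnorm_bound[of D "U \<omega>"]] by (simp add: power_mult_distrib)
qed

lemma L2_scaleR:
  assumes s: "0 \<le> s" and U: "L2 s U" and g: "g \<in> borel_measurable (F s)" "\<And>\<omega>. \<bar>g \<omega>\<bar> \<le> c"
  shows "L2 s (\<lambda>\<omega>. g \<omega> *\<^sub>R U \<omega>)"
proof (rule L2_dominated[OF s])
  show "(\<lambda>\<omega>. g \<omega> *\<^sub>R U \<omega>) \<in> borel_measurable (F s)" using U g by (auto simp: L2_def)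
  show "integrable P (\<lambda>\<omega>. c\<^sup>2 * (norm (U \<omega>))\<^sup>2)" using U by (simp add: L2_def)
  show "(norm (g \<omega> *\<^sub>R U \<omega>))\<^sup>2 \<le> c\<^sup>2 * (norm (U \<omega>))\<^sup>2" for \<omega>
    using power_mono[OF g(2)[of \<omega>], of 2] by (simp add: power_mult_distrib mult_right_mono)
qed

text \<open>Expanding the form, the terms linear in the increment integrate to zero and the squared
  increment contributes its length. An arbitrary matrix is allowed so that the identity yields both
  square integrability and the norm, while the Lyapunov matrix yields the energy.\<close>

lemma quad_step:
  fixes U Z :: "'w \<Rightarrow> real ^ 'n" and C :: "real ^ 'n ^ 'n"
  assumes st: "0 \<le> s" "s \<le> t" and U: "L2 s U" and Z: "L2 s Z"
  defines "U' \<equiv> \<lambda>\<omega>. U \<omega> + (W t \<omega> - W s \<omega>) *\<^sub>R Z \<omega>"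
  shows "L2 t U'"
    and "(\<integral>\<omega>. U' \<omega> \<bullet> (C *v U' \<omega>) \<partial>P)
        = (\<integral>\<omega>. U \<omega> \<bullet> (C *v U \<omega>) \<partial>P) + (t - s) * (\<integral>\<omega>. Z \<omega> \<bullet> (C *v Z \<omega>) \<partial>P)"
proof -
  have main: "integrable P (\<lambda>\<omega>. U' \<omega> \<bullet> (D *v U' \<omega>)) \<and> (\<integral>\<omega>. U' \<omega> \<bullet> (D *v U' \<omega>) \<partial>P)
        = (\<integral>\<omega>. U \<omega> \<bullet> (D *v U \<omega>) \<partial>P) + (t - s) * (\<integral>\<omega>. Z \<omega> \<bullet> (D *v Z \<omega>) \<partial>P)" for D :: "real ^ 'n ^ 'n"
  proof -
    let ?X = "\<lambda>\<omega>. U \<omega> \<bullet> (D *v Z \<omega>) + Z \<omega> \<bullet> (D *v U \<omega>)" and ?Y = "\<lambda>\<omega>. Z \<omega> \<bullet> (D *v Z \<omega>)"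
    let ?U = "\<lambda>\<omega>. U \<omega> \<bullet> (D *v U \<omega>)"
    have i: "integrable P ?X" "integrable P ?Y" "integrable P ?U"
      using st U Z by (auto intro!: Bochner_Integration.integrable_add L2_integrable_inner[of s] L2_matrix)
    have m: "U \<in> borel_measurable (F s)" "Z \<in> borel_measurable (F s)" using U Z by (auto simp: L2_def)
    have m': "?X \<in> borel_measurable (F s)" "?Y \<in> borel_measurable (F s)"
      using m by (auto intro!: borel_measurable_add borel_measurable_inner matrix_measurable)
    note X = increment[OF st m'(1) i(1)] and Y = increment_square[OF st m'(2) i(2)]
    have eq: "U' \<omega> \<bullet> (D *v U' \<omega>) = ?U \<omega> + (W t \<omega> - W s \<omega>) * ?X \<omega> + (W t \<omega> - W s \<omega>)\<^sup>2 * ?Y \<omega>" for \<omega>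
      by (simp add: U'_def matrix_vector_right_distrib matrix_vector_mult_scaleR inner_add_left
          inner_add_right power2_eq_square distrib_left mult_ac)
    show ?thesis
      unfolding eq using i X Y by simp
  qed
  show "(\<integral>\<omega>. U' \<omega> \<bullet> (C *v U' \<omega>) \<partial>P)
        = (\<integral>\<omega>. U \<omega> \<bullet> (C *v U \<omega>) \<partial>P) + (t - s) * (\<integral>\<omega>. Z \<omega> \<bullet> (C *v Z \<omega>) \<partial>P)"
    using main by blast
  have "U' \<in> borel_measurable (F t)"
  proof -
    have "U \<in> borel_measurable (F s)" "Z \<in> borel_measurable (F s)" using U Z by (auto simp: L2_def)
    then show ?thesis
      unfolding U'_def
      by (intro borel_measurable_add borel_measurable_scaleR W_increment_measurable[OF st]
          F_measurable_mono[OF st])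
  qed
  moreover have "integrable P (\<lambda>\<omega>. (norm (U' \<omega>))\<^sup>2)"
    using main[of "mat 1"] by (simp add: power2_norm_eq_inner)
  ultimately show "L2 t U'" by (simp add: L2_def)
qed

lemma norm_step:
  fixes U Z :: "'w \<Rightarrow> real ^ 'n"
  assumes "0 \<le> s" "s \<le> t" "L2 s U" "L2 s Z"
  shows "(\<integral>\<omega>. (norm (U \<omega> + (W t \<omega> - W s \<omega>) *\<^sub>R Z \<omega>))\<^sup>2 \<partial>P)
        = (\<integral>\<omega>. (norm (U \<omega>))\<^sup>2 \<partial>P) + (t - s) * (\<integral>\<omega>. (norm (Z \<omega>))\<^sup>2 \<partial>P)"
  using quad_step(2)[OF assms, of "mat 1"] by (simp add: power2_norm_eq_inner)

section \<open>Discrete stochastic sums and their maxima\<close>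

definition stoch_sum :: "(nat \<Rightarrow> real) \<Rightarrow> (nat \<Rightarrow> 'w \<Rightarrow> real ^ 'n) \<Rightarrow> nat \<Rightarrow> 'w \<Rightarrow> real ^ 'n" where
  "stoch_sum p \<zeta> k \<omega> = (\<Sum>i<k. (W (p (Suc i)) \<omega> - W (p i) \<omega>) *\<^sub>R \<zeta> i \<omega>)"

lemma stoch_sum_simps [simp]:
  "stoch_sum p \<zeta> 0 \<omega> = 0"
  "stoch_sum p \<zeta> (Suc k) \<omega> = stoch_sum p \<zeta> k \<omega> + (W (p (Suc k)) \<omega> - W (p k) \<omega>) *\<^sub>R \<zeta> k \<omega>"
  by (simp_all add: stoch_sum_def)

lemma stoch_sum_diff:
  "stoch_sum p (\<lambda>i \<omega>. \<zeta> i \<omega> - \<xi> i \<omega>) k \<omega> = stoch_sum p \<zeta> k \<omega> - stoch_sum p \<xi> k \<omega>"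
  by (simp add: stoch_sum_def scaleR_diff_right sum_subtractf)

lemma stoch_sum_measurable:
  assumes p: "\<And>k. k \<le> K \<Longrightarrow> 0 \<le> p k" "\<And>k. k < K \<Longrightarrow> p k \<le> p (Suc k)"
    and \<zeta>: "\<And>k. k < K \<Longrightarrow> \<zeta> k \<in> borel_measurable (F (p k))"
    and "k \<le> K"
  shows "stoch_sum p \<zeta> k \<in> borel_measurable (F (p k))"
  using \<open>k \<le> K\<close>
proof (induction k)
  case 0
  then show ?case by (simp add: stoch_sum_def)
next
  case (Suc k)
  then have k: "0 \<le> p k" "p k \<le> p (Suc k)" "stoch_sum p \<zeta> k \<in> borel_measurable (F (p k))" "\<zeta> k \<in> borel_measurable (F (p k))"
    using p(1)[of k] p(2)[of k] \<zeta>[of k] by auto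
  have "(\<lambda>\<omega>. stoch_sum p \<zeta> k \<omega> + (W (p (Suc k)) \<omega> - W (p k) \<omega>) *\<^sub>R \<zeta> k \<omega>) \<in> borel_measurable (F (p (Suc k)))"
    by (intro borel_measurable_add borel_measurable_scaleR W_increment_measurable
        F_measurable_mono[OF k(1,2)] k)
  then show ?case by (simp add: stoch_sum_def[abs_def] add.commute)
qed

text \<open>Kolmogorov's inequality. The sum is frozen at the first passage above the level; freezing keeps
  the summands adapted, and the frozen sum still exceeds the level.\<close>
lemma maximal_inequality:
  fixes \<zeta> :: "nat \<Rightarrow> 'w \<Rightarrow> real ^ 'n"
  assumes p: "\<And>k. k \<le> K \<Longrightarrow> 0 \<le> p k" "\<And>k. k < K \<Longrightarrow> p k \<le> p (Suc k)"
    and \<zeta>: "\<And>k. k < K \<Longrightarrow> L2 (p k) (\<zeta> k)"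
    and l: "0 < l"
  shows "prob_le (\<lambda>\<omega>. \<exists>k\<le>K. l < norm (stoch_sum p \<zeta> k \<omega>))
      ((\<Sum>k<K. (p (Suc k) - p k) * (\<integral>\<omega>. (norm (\<zeta> k \<omega>))\<^sup>2 \<partial>P)) / l\<^sup>2)"
proof -
  let ?M = "stoch_sum p \<zeta>"
  \<comment> \<open>The factor looks at the sums up to index k, all known at time
    \<open>p k\<close>. The summand that carries the sum over the level is therefore still included,
    and only later ones are dropped.\<close>
  define g :: "nat \<Rightarrow> 'w \<Rightarrow> real" where "g k \<omega> = (if \<forall>j\<in>{..k}. norm (?M j \<omega>) \<le> l then 1 else 0)" for k \<omega>
  define \<xi> where "\<xi> k \<omega> = g k \<omega> *\<^sub>R \<zeta> k \<omega>" for k \<omega>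
  let ?N = "stoch_sum p \<xi>"
  have pm: "p i \<le> p j" if "i \<le> j" "j \<le> K" for i j
    using that
  proof (induction j rule: dec_induct)
    case (step n)
    then show ?case using p(2)[of n] by simp
  qed simp
  have gm: "g k \<in> borel_measurable (F (p k))" if "k < K" for k
  proof -
    have m: "?M j \<in> borel_measurable (F (p k))" if "j \<le> k" for j
    proof (rule F_measurable_mono)
      show "0 \<le> p j" "p j \<le> p k" using that \<open>k < K\<close> p(1)[of j] pm[of j k] by simp_all
      show "?M j \<in> borel_measurable (F (p j))"
        by (rule stoch_sum_measurable[of K p]) (use that \<open>k < K\<close> \<zeta> in \<open>auto simp: L2_def intro: p\<close>)
    qed
    have "Measurable.pred (F (p k)) (\<lambda>\<omega>. \<forall>j\<in>{..k}. norm (?M j \<omega>) \<le> l)"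
      
      by (intro pred_intros_finite)
        (auto simp: pred_def intro!: borel_measurable_le measurable_compose[OF m borel_measurable_norm])
    then show ?thesis unfolding g_def by (intro measurable_If) (auto simp: pred_def)
  qed
  have \<xi>: "L2 (p k) (\<xi> k)" if "k < K" for k
    unfolding \<xi>_def
  proof (rule L2_scaleR[where c = 1])
    show "\<bar>g k \<omega>\<bar> \<le> 1" for \<omega> by (simp add: g_def)
  qed (use that p(1)[of k] \<zeta>[of k] gm[of k] in simp_all)
  have N: "L2 (p k) (?N k) \<and> (\<integral>\<omega>. (norm (?N k \<omega>))\<^sup>2 \<partial>P) \<le> (\<Sum>k<k. (p (Suc k) - p k) * (\<integral>\<omega>. (norm (\<zeta> k \<omega>))\<^sup>2 \<partial>P))"
    if "k \<le> K" for k
    using that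
  proof (induction k)
    case 0
    then show ?case by (simp add: stoch_sum_def[abs_def])
  next
    case (Suc k)
    then have k: "0 \<le> p k" "p k \<le> p (Suc k)" "L2 (p k) (?N k)" "L2 (p k) (\<xi> k)" "L2 (p k) (\<zeta> k)"
      using p(1)[of k] p(2)[of k] \<xi>[of k] \<zeta>[of k] by auto
    have eq: "?N (Suc k) = (\<lambda>\<omega>. ?N k \<omega> + (W (p (Suc k)) \<omega> - W (p k) \<omega>) *\<^sub>R \<xi> k \<omega>)" by auto
    have "(\<integral>\<omega>. (norm (\<xi> k \<omega>))\<^sup>2 \<partial>P) \<le> (\<integral>\<omega>. (norm (\<zeta> k \<omega>))\<^sup>2 \<partial>P)"
      using k by (intro integral_mono) (auto simp: L2_def \<xi>_def g_def)
    then have "(p (Suc k) - p k) * (\<integral>\<omega>. (norm (\<xi> k \<omega>))\<^sup>2 \<partial>P) \<le> (p (Suc k) - p k) * (\<integral>\<omega>. (norm (\<zeta> k \<omega>))\<^sup>2 \<partial>P)"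
      using k by (intro mult_left_mono) auto
    moreover have "(\<integral>\<omega>. (norm (?N k \<omega>))\<^sup>2 \<partial>P) \<le> (\<Sum>k<k. (p (Suc k) - p k) * (\<integral>\<omega>. (norm (\<zeta> k \<omega>))\<^sup>2 \<partial>P))"
      using Suc by simp
    ultimately have "(\<integral>\<omega>. (norm (?N (Suc k) \<omega>))\<^sup>2 \<partial>P) \<le> (\<Sum>k<Suc k. (p (Suc k) - p k) * (\<integral>\<omega>. (norm (\<zeta> k \<omega>))\<^sup>2 \<partial>P))"
      unfolding eq norm_step[OF k(1-4)] by simp
    moreover have "L2 (p (Suc k)) (?N (Suc k))" unfolding eq by (rule quad_step(1)[OF k(1-4)])
    ultimately show ?case by blast
  qed
  have Nm: "?N K \<in> borel_measurable P" using N[of K] p(1)[of K] by (auto simp: L2_def intro: F_measurable)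
  have Ni: "integrable P (\<lambda>\<omega>. (norm (?N K \<omega>))\<^sup>2)" using N[of K] by (auto simp: L2_def)
  have exit: "l < norm (?N K \<omega>)" if ex: "\<exists>k\<le>K. l < norm (?M k \<omega>)" for \<omega>
  proof -
    define k where "k = (LEAST k. l < norm (?M k \<omega>))"
    obtain k' where k': "k' \<le> K" "l < norm (?M k' \<omega>)" using ex by blast
    have k: "l < norm (?M k \<omega>)" unfolding k_def using k'(2) by (rule LeastI)
    have kK: "k \<le> K" using k' Least_le[of "\<lambda>k. l < norm (?M k \<omega>)" k'] by (simp add: k_def)
    have less: "norm (?M j \<omega>) \<le> l" if "j < k" for j using not_less_Least[of j] that by (force simp: k_def)
    have "?N j \<omega> = ?M j \<omega>" if "j \<le> k" for j
      using that by (induction j) (auto simp: \<xi>_def g_def less)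
    then have eq: "?N k \<omega> = ?M k \<omega>" by simp
    have "?N j \<omega> = ?N k \<omega>" if "k \<le> j" for j
      using that
    proof (induction j rule: dec_induct)
      case (step j)
      have "g j \<omega> = 0" using k step.hyps by (auto simp: g_def not_le)
      then show ?case using step by (simp add: \<xi>_def)
    qed simp
    from this[OF kK] eq k show ?thesis by simp
  qed
  have "prob_le (\<lambda>\<omega>. l < norm (?N K \<omega>))
      ((\<Sum>k<K. (p (Suc k) - p k) * (\<integral>\<omega>. (norm (\<zeta> k \<omega>))\<^sup>2 \<partial>P)) / l\<^sup>2)"
    using Nm Ni N[of K] l by (intro prob_le_second_moment) auto
  then show ?thesis by (rule prob_le_mono) (auto intro: exit)
qed

text \<open>Lenglart's inequality, obtained by freezing the sum before its quadratic variation exceeds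
  \<open>d\<close>.\<close>
lemma lenglart:
  fixes \<zeta> :: "nat \<Rightarrow> 'w \<Rightarrow> real ^ 'n"
  assumes p: "\<And>k. k \<le> K \<Longrightarrow> 0 \<le> p k" "\<And>k. k < K \<Longrightarrow> p k < p (Suc k)"
    and \<zeta>: "\<And>k. k < K \<Longrightarrow> \<zeta> k \<in> borel_measurable (F (p k))"
    and l: "0 < l" and d: "0 \<le> d"
    and Q: "prob_le (\<lambda>\<omega>. d < (\<Sum>k<K. (p (Suc k) - p k) * (norm (\<zeta> k \<omega>))\<^sup>2)) \<eta>"
  shows "prob_le (\<lambda>\<omega>. \<exists>k\<le>K. l < norm (stoch_sum p \<zeta> k \<omega>)) (d / l\<^sup>2 + \<eta>)"
proof -
  define q where "q k \<omega> = (\<Sum>j<k. (p (Suc j) - p j) * (norm (\<zeta> j \<omega>))\<^sup>2)" for k \<omega>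
  define g :: "nat \<Rightarrow> 'w \<Rightarrow> real" where "g k \<omega> = (if q (Suc k) \<omega> \<le> d then 1 else 0)" for k \<omega>
  define \<xi> where "\<xi> k \<omega> = g k \<omega> *\<^sub>R \<zeta> k \<omega>" for k \<omega>
  have pm: "p i \<le> p j" if "i \<le> j" "j \<le> K" for i j
    using that
  proof (induction j rule: dec_induct)
    case (step n)
    then show ?case using p(2)[of n] by simp
  qed simp
  have q_mono: "q i \<omega> \<le> q j \<omega>" if "i \<le> j" "j \<le> K" for i j \<omega>
    unfolding q_def
  proof (intro sum_mono2)
    fix k assume "k \<in> {..<j} - {..<i}"
    then show "0 \<le> (p (Suc k) - p k) * (norm (\<zeta> k \<omega>))\<^sup>2"
      using that p(2)[of k] by (intro mult_nonneg_nonneg) auto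
  qed (use that in auto)
  have gm: "g k \<in> borel_measurable (F (p k))" if "k < K" for k
  proof -
    have "\<zeta> j \<in> borel_measurable (F (p k))" if "j \<le> k" for j
      using \<open>k < K\<close> that p(1)[of j] \<zeta>[of j] pm[of j k] by (intro F_measurable_mono[of "p j" "p k"]) auto
    then have "q (Suc k) \<in> borel_measurable (F (p k))"
      unfolding q_def by (intro borel_measurable_sum borel_measurable_times borel_measurable_power borel_measurable_norm) auto
    then show ?thesis unfolding g_def by measurable
  qed
  have bd: "(p (Suc k) - p k) * (norm (\<xi> k \<omega>))\<^sup>2 \<le> d" if "k < K" for k \<omega>
  proof (cases "q (Suc k) \<omega> \<le> d")
    case True
    have "0 \<le> q k \<omega>" using q_mono[of 0 k \<omega>] that by (simp add: q_def)
    then show ?thesis using True by (simp add: \<xi>_def g_def q_def)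
  qed (use d in \<open>simp add: \<xi>_def g_def\<close>)
  \<comment> \<open>Times increase strictly, so the bound \<open>d\<close> on a single term divides
    out to a bound on \<open>\<xi> k\<close> itself; this replaces any moment assumption on
    \<zeta>.\<close>
  have \<xi>: "L2 (p k) (\<xi> k)" if "k < K" for k
  proof (rule L2_dominated)
    show "\<xi> k \<in> borel_measurable (F (p k))" 
      unfolding \<xi>_def using gm[OF that] \<zeta>[OF that] by (intro borel_measurable_scaleR)
    show "(norm (\<xi> k \<omega>))\<^sup>2 \<le> d / (p (Suc k) - p k)" for \<omega>
      using bd[OF that, of \<omega>] p(2)[OF that] by (simp add: field_simps)
  qed (use p(1)[of k] that in auto)
  have total: "(\<Sum>k<n. (p (Suc k) - p k) * (norm (\<xi> k \<omega>))\<^sup>2) \<le> d" if "n \<le> K" for n \<omega>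
    using that
  proof (induction n)
    case (Suc n)
    show ?case
    proof (cases "q (Suc n) \<omega> \<le> d")
      case True
      have "(\<Sum>k<Suc n. (p (Suc k) - p k) * (norm (\<xi> k \<omega>))\<^sup>2) \<le> q (Suc n) \<omega>"
        unfolding q_def
      proof (intro sum_mono mult_left_mono)
        fix k assume "k \<in> {..<Suc n}"
        then show "0 \<le> p (Suc k) - p k" using p(2)[of k] Suc.prems by simp
      qed (auto simp: \<xi>_def g_def)
      then show ?thesis using True by simp
    next
      case False
      then have "\<xi> n \<omega> = 0" by (simp add: \<xi>_def g_def)
      then show ?thesis using Suc by simp
    qed
  qed (use d in simp)
  have "(\<Sum>k<K. (p (Suc k) - p k) * (\<integral>\<omega>. (norm (\<xi> k \<omega>))\<^sup>2 \<partial>P))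
      = (\<integral>\<omega>. (\<Sum>k<K. (p (Suc k) - p k) * (norm (\<xi> k \<omega>))\<^sup>2) \<partial>P)"
    using \<xi> by (subst Bochner_Integration.integral_sum) (auto simp: L2_def)
  also have "\<dots> \<le> (\<integral>\<omega>. d \<partial>P)"
    using \<xi> total[of K] by (intro integral_mono) (auto simp: L2_def)
  finally have "(\<Sum>k<K. (p (Suc k) - p k) * (\<integral>\<omega>. (norm (\<xi> k \<omega>))\<^sup>2 \<partial>P)) \<le> d" by (simp add: prob_space)
  then have "(\<Sum>k<K. (p (Suc k) - p k) * (\<integral>\<omega>. (norm (\<xi> k \<omega>))\<^sup>2 \<partial>P)) / l\<^sup>2 \<le> d / l\<^sup>2"
    by (intro divide_right_mono) auto
  moreover have "prob_le (\<lambda>\<omega>. \<exists>k\<le>K. l < norm (stoch_sum p \<xi> k \<omega>))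
      ((\<Sum>k<K. (p (Suc k) - p k) * (\<integral>\<omega>. (norm (\<xi> k \<omega>))\<^sup>2 \<partial>P)) / l\<^sup>2)"
  proof (rule maximal_inequality[of K p])
    show "p k \<le> p (Suc k)" if "k < K" for k using p(2)[OF that] by simp
    show "0 \<le> p k" if "k \<le> K" for k by (rule p(1)[OF that])
    show "L2 (p k) (\<xi> k)" if "k < K" for k by (rule \<xi>[OF that])
  qed (rule l)
  ultimately have "prob_le (\<lambda>\<omega>. \<exists>k\<le>K. l < norm (stoch_sum p \<xi> k \<omega>)) (d / l\<^sup>2)"
    by (elim prob_le_mono)
  from prob_le_disj[OF this Q] show ?thesis
  proof (rule prob_le_mono)
    fix \<omega> assume ex: "\<exists>k\<le>K. l < norm (stoch_sum p \<zeta> k \<omega>)"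
    show "(\<exists>k\<le>K. l < norm (stoch_sum p \<xi> k \<omega>)) \<or> d < (\<Sum>k<K. (p (Suc k) - p k) * (norm (\<zeta> k \<omega>))\<^sup>2)"
    proof (rule disjCI)
      assume "\<not> d < (\<Sum>k<K. (p (Suc k) - p k) * (norm (\<zeta> k \<omega>))\<^sup>2)"
      then have "q K \<omega> \<le> d" by (simp add: q_def)
      then have "\<xi> k \<omega> = \<zeta> k \<omega>" if "k < K" for k
        using q_mono[of "Suc k" K \<omega>] that by (simp add: \<xi>_def g_def)
      then have "stoch_sum p \<xi> k \<omega> = stoch_sum p \<zeta> k \<omega>" if "k \<le> K" for k
        unfolding stoch_sum_def using that by (intro sum.cong) auto
      then show "\<exists>k\<le>K. l < norm (stoch_sum p \<xi> k \<omega>)" using ex by auto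
    qed
  qed simp
qed

end

section \<open>Left Riemann sums of the Ito integral\<close>

lemma floor_grid_tendsto:
  fixes u :: real
  assumes "filterlim c at_top sequentially"
  shows "(\<lambda>m::nat. real_of_int \<lfloor>u * c m\<rfloor> / c m) \<longlonglongrightarrow> u"
proof (rule tendsto_sandwich)
  have pos: "eventually (\<lambda>m. 0 < c m) sequentially"
    using assms by (auto simp: filterlim_at_top_dense)
  then show "eventually (\<lambda>m. u - 1 / c m \<le> real_of_int \<lfloor>u * c m\<rfloor> / c m) sequentially"
  proof eventually_elim
    case (elim m)
    have "u * c m - 1 \<le> real_of_int \<lfloor>u * c m\<rfloor>" by linarith
    then have "(u * c m - 1) / c m \<le> real_of_int \<lfloor>u * c m\<rfloor> / c m" using elim by (intro divide_right_mono) auto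
    then show ?case using elim by (simp add: diff_divide_distrib)
  qed
  from pos show "eventually (\<lambda>m. real_of_int \<lfloor>u * c m\<rfloor> / c m \<le> u) sequentially"
    by eventually_elim (simp add: divide_le_eq)
  have "(\<lambda>m. 1 / c m) \<longlonglongrightarrow> 0"
    using tendsto_inverse_0_at_top[OF assms] by (simp add: inverse_eq_divide)
  from tendsto_diff[OF tendsto_const[of u] this] show "(\<lambda>m. u - 1 / c m) \<longlonglongrightarrow> u" by simp
qed simp

section \<open>Modulus of continuity, uniformly in probability\<close>

definition modulus_le :: "(real \<Rightarrow> 'b::real_normed_vector) \<Rightarrow> real \<Rightarrow> real \<Rightarrow> real \<Rightarrow> bool" where
  "modulus_le f T \<delta> \<kappa> \<longleftrightarrow> (\<forall>u\<in>{0..T}. \<forall>v\<in>{0..T}. \<bar>u - v\<bar> < \<delta> \<longrightarrow> norm (f u - f v) \<le> \<kappa>)"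

lemma modulus_leD: "modulus_le f T \<delta> \<kappa> \<Longrightarrow> 0 \<le> u \<Longrightarrow> u \<le> T \<Longrightarrow> 0 \<le> v \<Longrightarrow> v \<le> T \<Longrightarrow> \<bar>u - v\<bar> < \<delta> \<Longrightarrow> norm (f u - f v) \<le> \<kappa>"
  by (simp add: modulus_le_def)

text \<open>Rounding u and v down to rationals keeps them in the interval, and the strict inequality
  on their distance survives eventually; the closed bound passes to the limit. This reduces an
  uncountable condition to a countable, measurable one.\<close>

lemma modulus_le_rational:
  fixes f :: "real \<Rightarrow> 'b::real_normed_vector"
  assumes cont: "continuous_on {0..} f"
    and r: "\<And>u v. u \<in> \<rat> \<Longrightarrow> v \<in> \<rat> \<Longrightarrow> u \<in> {0..T} \<Longrightarrow> v \<in> {0..T} \<Longrightarrow> \<bar>u - v\<bar> < \<delta> \<Longrightarrow> norm (f u - f v) \<le> \<kappa>"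
  shows "modulus_le f T \<delta> \<kappa>"
  unfolding modulus_le_def
proof (intro ballI impI)
  fix u v assume uv: "u \<in> {0..T}" "v \<in> {0..T}" "\<bar>u - v\<bar> < \<delta>"
  define g where "g x m = real_of_int \<lfloor>x * real (Suc m)\<rfloor> / real (Suc m)" for x m
  have lim: "g x \<longlonglongrightarrow> x" for x
    unfolding g_def by (intro floor_grid_tendsto filterlim_compose[OF filterlim_real_sequentially filterlim_Suc])
  have g: "g x m \<in> \<rat>" "0 \<le> g x m" "g x m \<le> x" if x: "0 \<le> x" for x m
  proof -
    have f: "real_of_int \<lfloor>x * real (Suc m)\<rfloor> \<le> x * real (Suc m)" by (rule of_int_floor_le)
    show "g x m \<in> \<rat>" by (simp add: g_def)
    show "0 \<le> g x m" using x by (simp add: g_def)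
    show "g x m \<le> x" using f unfolding g_def by (subst divide_le_eq) auto
  qed
  have flim: "(\<lambda>m. f (g x m)) \<longlonglongrightarrow> f x" if x: "0 \<le> x" for x
    using continuous_on_tendsto_compose[OF cont lim[of x]] x g(2)[OF x] by auto
  have "(\<lambda>m. norm (f (g u m) - f (g v m))) \<longlonglongrightarrow> norm (f u - f v)"
    using uv by (intro tendsto_intros flim) auto
  moreover have "eventually (\<lambda>m. norm (f (g u m) - f (g v m)) \<le> \<kappa>) sequentially"
  proof -
    have "(\<lambda>m. \<bar>g u m - g v m\<bar>) \<longlonglongrightarrow> \<bar>u - v\<bar>" by (intro tendsto_intros lim)
    from order_tendstoD(2)[OF this uv(3)] show ?thesis
    proof eventually_elim
      case (elim m)
      then show ?case using uv g[of u m] g[of v m] by (intro r) auto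
    qed
  qed
  ultimately show "norm (f u - f v) \<le> \<kappa>" by (rule tendsto_upperbound) simp
qed

text \<open>The exceptional events for \<delta> = 1 / (n + 1) decrease, and their intersection is
  null because a continuous path is uniformly continuous on a compact interval. Continuity from
  above then gives a deterministic \<delta>, which takes the place of moment bounds on the
  path.\<close>

lemma (in prob_space) modulus_in_probability:
  fixes H :: "real \<Rightarrow> 'a \<Rightarrow> 'b::euclidean_space"
  assumes meas: "\<And>s. 0 \<le> s \<Longrightarrow> H s \<in> borel_measurable M"
    and cont: "AE \<omega> in M. continuous_on {0..} (\<lambda>s. H s \<omega>)"
    and pos: "0 < \<kappa>" "0 < \<eta>"
  obtains \<delta> where "0 < \<delta>" and "prob_le (\<lambda>\<omega>. \<not> modulus_le (\<lambda>s. H s \<omega>) T \<delta> \<kappa>) \<eta>"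
proof -
  define D where "D = \<rat> \<inter> {0..T}"
  define E where "E n = {\<omega>\<in>space M. \<exists>u\<in>D. \<exists>v\<in>D. \<bar>u - v\<bar> < 1 / real (Suc n) \<and> \<kappa> < norm (H u \<omega> - H v \<omega>)}" for n
  have D: "countable D" unfolding D_def using countable_rat by (rule countable_subset[rotated]) auto
  have E: "E n \<in> events" for n
  proof -
    have m: "{\<omega>\<in>space M. \<bar>u - v\<bar> < 1 / real (Suc n) \<and> \<kappa> < norm (H u \<omega> - H v \<omega>)} \<in> events" if "u \<in> D" "v \<in> D" for u v
    proof -
      have "H u \<in> borel_measurable M" "H v \<in> borel_measurable M" using that by (auto simp: D_def intro: meas)
      then show ?thesis by measurable
    qed
    have "E n = (\<Union>u\<in>D. \<Union>v\<in>D. {\<omega>\<in>space M. \<bar>u - v\<bar> < 1 / real (Suc n) \<and> \<kappa> < norm (H u \<omega> - H v \<omega>)})"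
      by (auto simp: E_def)
    then show ?thesis by (simp only:) (intro sets.countable_UN'' D m)
  qed
  have dec: "decseq E"
  proof (rule decseq_SucI)
    fix n
    have "1 / real (Suc (Suc n)) \<le> 1 / real (Suc n)" by (simp add: frac_le)
    then show "E (Suc n) \<subseteq> E n" unfolding E_def by (auto dest: less_le_trans)
  qed
  have "AE \<omega> in M. \<omega> \<notin> (\<Inter>n. E n)"
    using cont
  proof eventually_elim
    case (elim \<omega>)
    have "uniformly_continuous_on {0..T} (\<lambda>s. H s \<omega>)"
      using elim by (intro compact_uniformly_continuous continuous_on_subset[OF elim]) auto
    then obtain d where d: "0 < d" "\<And>u v. u \<in> {0..T} \<Longrightarrow> v \<in> {0..T} \<Longrightarrow> dist v u < d \<Longrightarrow> dist (H v \<omega>) (H u \<omega>) < \<kappa>"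
      using pos(1) unfolding uniformly_continuous_on_def by metis
    obtain n where n: "1 / real (Suc n) < d" using d(1) nat_approx_posE by blast
    have "\<omega> \<notin> E n"
    proof
      assume "\<omega> \<in> E n"
      then obtain u v where "u \<in> {0..T}" "v \<in> {0..T}" "\<bar>u - v\<bar> < 1 / real (Suc n)" "\<kappa> < norm (H u \<omega> - H v \<omega>)"
        by (auto simp: E_def D_def)
      with d(2)[of v u] n show False by (auto simp: dist_norm)
    qed
    then show ?case by auto
  qed
  then have "prob (\<Inter>n. E n) = 0"
    by (subst prob_eq_0) (use E in auto)
  then have "(\<lambda>n. prob (E n)) \<longlonglongrightarrow> 0"
    using finite_Lim_measure_decseq[of E] E dec by auto
  then have "eventually (\<lambda>n. prob (E n) < \<eta>) sequentially" using pos(2) by (rule order_tendstoD)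
  then obtain n where n: "prob (E n) < \<eta>" by (auto simp: eventually_sequentially)
  have "prob_le (\<lambda>\<omega>. \<omega> \<in> E n) \<eta>" using E n by (intro prob_leI[of "E n"]) auto
  moreover have "prob_le (\<lambda>\<omega>. \<not> continuous_on {0..} (\<lambda>s. H s \<omega>)) 0" using cont by (intro prob_le_AE) simp
  ultimately have *: "prob_le (\<lambda>\<omega>. \<omega> \<in> E n \<or> \<not> continuous_on {0..} (\<lambda>s. H s \<omega>)) (\<eta> + 0)" by (rule prob_le_disj)
  show thesis
  proof (rule that)
    show "prob_le (\<lambda>\<omega>. \<not> modulus_le (\<lambda>s. H s \<omega>) T (1 / real (Suc n)) \<kappa>) \<eta>"
    proof (rule prob_le_mono[OF *])
      fix \<omega> assume w: "\<omega> \<in> space M" "\<not> modulus_le (\<lambda>s. H s \<omega>) T (1 / real (Suc n)) \<kappa>"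
      show "\<omega> \<in> E n \<or> \<not> continuous_on {0..} (\<lambda>s. H s \<omega>)"
      proof (rule disjCI, rule ccontr)
        assume c: "\<not> \<not> continuous_on {0..} (\<lambda>s. H s \<omega>)" and "\<omega> \<notin> E n"
        then have "norm (H u \<omega> - H v \<omega>) \<le> \<kappa>"
          if "u \<in> \<rat>" "v \<in> \<rat>" "u \<in> {0..T}" "v \<in> {0..T}" "\<bar>u - v\<bar> < 1 / real (Suc n)" for u v
          using w(1) that by (force simp: E_def D_def not_less)
        then have "modulus_le (\<lambda>s. H s \<omega>) T (1 / real (Suc n)) \<kappa>"
          using c by (intro modulus_le_rational) auto
        then show False using w(2) by simp
      qed
    qed simp
  qed simp
qed

section \<open>Finite partitions and common refinements\<close>

locale strict_partition =
  fixes p :: "nat \<Rightarrow> real" and L :: nat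
  assumes strict: "k < L \<Longrightarrow> p k < p (Suc k)"
begin

lemma less: "i < j \<Longrightarrow> j \<le> L \<Longrightarrow> p i < p j"
proof (induction j rule: less_induct)
  case (less j)
  then obtain k where j: "j = Suc k" by (cases j) auto
  show ?case
  proof (cases "i = k")
    case False
    then have "p i < p k" using less j by auto
    also have "p k < p j" using strict[of k] less.prems j by simp
    finally show ?thesis .
  qed (use strict less j in auto)
qed

lemma less_iff: "i \<le> L \<Longrightarrow> j \<le> L \<Longrightarrow> p i < p j \<longleftrightarrow> i < j"
  using less[of i j] less[of j i] by (cases i j rule: linorder_cases) auto

lemma le_iff: "i \<le> L \<Longrightarrow> j \<le> L \<Longrightarrow> p i \<le> p j \<longleftrightarrow> i \<le> j"
  using less_iff[of j i] by (simp add: not_less[symmetric])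

lemma cell: 
  assumes "p 0 < s" "s \<le> p L"
  obtains k where "k < L" "p k < s" "s \<le> p (Suc k)"
proof -
  define k where "k = (LEAST k. s \<le> p k)"
  have k: "s \<le> p k" unfolding k_def using assms(2) by (rule LeastI)
  have "k \<le> L" unfolding k_def using assms(2) by (rule Least_le)
  moreover have "k \<noteq> 0" using k assms(1) by (metis not_less)
  then obtain j where j: "k = Suc j" using not0_implies_Suc by blast
  moreover have "\<not> s \<le> p j" using not_less_Least[of j "\<lambda>k. s \<le> p k"] j by (simp add: k_def)
  ultimately show thesis using k by (intro that[of j]) auto
qed

lemma simple_value_cell:
  assumes "k < L" "p k < s" "s \<le> p (Suc k)"
  shows "simple_value L p \<xi> s \<omega> = \<xi> k \<omega>"
proof -
  have "indicator {p i<..p (Suc i)} s = (if i = k then 1 else 0 :: real)" if i: "i < L" for i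
  proof (cases i k rule: linorder_cases)
    case less
    then have "p (Suc i) \<le> p k" using assms(1) by (subst le_iff) auto
    then show ?thesis using less assms by (auto simp: indicator_def)
  next
    case greater
    then have "p (Suc k) \<le> p i" using i by (subst le_iff) auto
    then show ?thesis using greater assms by (auto simp: indicator_def)
  qed (use assms in \<open>auto simp: indicator_def\<close>)
  then have "simple_value L p \<xi> s \<omega> = (\<Sum>i<L. (if i = k then 1 else 0) *\<^sub>R \<xi> i \<omega>)"
    unfolding simple_value_def by (intro sum.cong) auto
  also have "\<dots> = (\<Sum>i<L. if i = k then \<xi> i \<omega> else 0)" by (intro sum.cong) auto
  also have "\<dots> = \<xi> k \<omega>" using assms(1) by simp
  finally show ?thesis .
qed

lemma sum_indicator:
  assumes "n \<le> L"
  shows "(\<Sum>k<n. indicator {p k<..p (Suc k)} s) = (indicator {p 0<..p n} s :: ennreal)"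
  using assms
proof (induction n)
  case (Suc n)
  have "p 0 \<le> p n" "p n < p (Suc n)" using Suc.prems by (auto simp: le_iff less)
  then show ?case using Suc by (auto simp: indicator_def)
qed simp

text \<open>To be read as: \<open>p\<close> refines \<open>\<tau>\<close>. The coarse times may
  repeat, because \<open>simple_process\<close> only asks for weakly increasing times.\<close>

definition refines :: "nat \<Rightarrow> (nat \<Rightarrow> real) \<Rightarrow> bool" where
  "refines N \<tau> \<longleftrightarrow> (\<forall>i\<le>N. \<tau> i \<in> p ` {..L}) \<and> (\<forall>i<N. \<tau> i \<le> \<tau> (Suc i))"

lemma refinesD: "refines N \<tau> \<Longrightarrow> i \<le> N \<Longrightarrow> \<exists>j\<le>L. \<tau> i = p j"
  by (auto simp: refines_def image_iff Bex_def)

text \<open>No coarse time lies strictly inside a fine cell, and coarse and fine cells are all open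
  on the left and closed on the right. The right endpoint therefore represents its fine
  cell.\<close>

lemma refine_value:
  assumes refines: "refines N \<tau>" and k: "k < L" "p k < s" "s \<le> p (Suc k)"
  shows "simple_value N \<tau> \<xi> s \<omega> = simple_value N \<tau> \<xi> (p (Suc k)) \<omega>"
proof -
  have *: "\<tau> i < s \<longleftrightarrow> \<tau> i < p (Suc k)" "s \<le> \<tau> i \<longleftrightarrow> p (Suc k) \<le> \<tau> i" if i: "i \<le> N" for i
  proof -
    obtain j where j: "j \<le> L" "\<tau> i = p j" using refinesD[OF refines, of i] i by auto
    have "p j < p (Suc k) \<longleftrightarrow> p j \<le> p k" using j k by (simp add: less_iff le_iff less_Suc_eq_le)
    then show "\<tau> i < s \<longleftrightarrow> \<tau> i < p (Suc k)" "s \<le> \<tau> i \<longleftrightarrow> p (Suc k) \<le> \<tau> i"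
      using k j by auto
  qed
  then have "s \<in> {\<tau> i<..\<tau> (Suc i)} \<longleftrightarrow> p (Suc k) \<in> {\<tau> i<..\<tau> (Suc i)}" if "i < N" for i
    using *(1)[of i] *(2)[of "Suc i"] that by simp
  then show ?thesis unfolding simple_value_def by (intro sum.cong) (auto simp: indicator_def)
qed

text \<open>Inside one coarse cell the fine increments of the integrator telescope. This puts two
  simple integrals with different times on one common grid.\<close>

lemma refine_sum:
  assumes refines: "refines N \<tau>"
  shows "simple_integral_wrt w N \<tau> \<xi> \<omega>
    = (\<Sum>k<L. (w (p (Suc k)) \<omega> - w (p k) \<omega>) *\<^sub>R simple_value N \<tau> \<xi> (p (Suc k)) \<omega>)"
proof -
  have tele: "(\<Sum>k<L. (w (p (Suc k)) \<omega> - w (p k) \<omega>) * indicator {\<tau> i<..\<tau> (Suc i)} (p (Suc k)))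
      = w (\<tau> (Suc i)) \<omega> - w (\<tau> i) \<omega>" if i: "i < N" for i
  proof -
    obtain a where a: "a \<le> L" "\<tau> i = p a" using refinesD[OF refines, of i] i by auto
    obtain b where b: "b \<le> L" "\<tau> (Suc i) = p b" using refinesD[OF refines, of "Suc i"] i by auto
    have ab: "a \<le> b" using refines i a b by (auto simp: refines_def le_iff)
    have "(\<Sum>k<L. (w (p (Suc k)) \<omega> - w (p k) \<omega>) * indicator {\<tau> i<..\<tau> (Suc i)} (p (Suc k)))
        = (\<Sum>k\<in>{a..<b}. w (p (Suc k)) \<omega> - w (p k) \<omega>)"
    proof (rule sum.mono_neutral_cong_right)
      show "{a..<b} \<subseteq> {..<L}" using b by auto
      show "\<forall>k\<in>{..<L} - {a..<b}. (w (p (Suc k)) \<omega> - w (p k) \<omega>) * indicator {\<tau> i<..\<tau> (Suc i)} (p (Suc k)) = 0"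
        using a b by (auto simp: indicator_def less_iff le_iff)
      show "(w (p (Suc k)) \<omega> - w (p k) \<omega>) * indicator {\<tau> i<..\<tau> (Suc i)} (p (Suc k)) = w (p (Suc k)) \<omega> - w (p k) \<omega>"
        if "k \<in> {a..<b}" for k
        using that a b by (auto simp: indicator_def less_iff le_iff)
    qed simp
    also have "\<dots> = w (p b) \<omega> - w (p a) \<omega>" using ab by (rule sum_Suc_diff')
    finally show ?thesis using a b by simp
  qed
  have "(\<Sum>k<L. (w (p (Suc k)) \<omega> - w (p k) \<omega>) *\<^sub>R simple_value N \<tau> \<xi> (p (Suc k)) \<omega>)
      = (\<Sum>k<L. \<Sum>i<N. ((w (p (Suc k)) \<omega> - w (p k) \<omega>) * indicator {\<tau> i<..\<tau> (Suc i)} (p (Suc k))) *\<^sub>R \<xi> i \<omega>)"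
    by (simp only: simple_value_def scaleR_sum_right scaleR_scaleR)
  also have "\<dots> = (\<Sum>i<N. \<Sum>k<L. ((w (p (Suc k)) \<omega> - w (p k) \<omega>) * indicator {\<tau> i<..\<tau> (Suc i)} (p (Suc k))) *\<^sub>R \<xi> i \<omega>)"
    by (rule sum.swap)
  also have "\<dots> = (\<Sum>i<N. (w (\<tau> (Suc i)) \<omega> - w (\<tau> i) \<omega>) *\<^sub>R \<xi> i \<omega>)"
    by (intro sum.cong refl) (simp only: scaleR_sum_left[symmetric] tele lessThan_iff)
  finally show ?thesis by (simp add: simple_integral_wrt_def)
qed

end

lemma finite_strict_partition:
  assumes "finite S" "S \<noteq> {}"
  obtains p L where "strict_partition p L" "p ` {..L} = S"
proof -
  define l where "l = sorted_list_of_set S"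
  have l: "set l = S" "sorted_wrt (<) l" using assms by (simp_all add: l_def)
  then have ne: "l \<noteq> []" using assms by auto
  have "strict_partition ((!) l) (length l - 1)"
    using l(2) ne by unfold_locales (auto simp: sorted_wrt_iff_nth_less)
  moreover have "(!) l ` {..length l - 1} = S"
  proof -
    have "{..length l - 1} = {..<length l}" using ne by (cases l) auto
    then show ?thesis using l(1) nth_image[of "length l" l] by (simp add: lessThan_atLeast0)
  qed
  ultimately show thesis by (rule that)
qed

section \<open>From the Ito integral to left Riemann sums\<close>

context brownian_filtration
begin

text \<open>The notion \<open>has_ito_integral\<close> read over one probability space:
  \<open>P\<close> will itself be a completion, so no second completion enters.\<close>

definition ito_approximable :: "real \<Rightarrow> (real \<Rightarrow> 'w \<Rightarrow> real ^ 'n) \<Rightarrow> ('w \<Rightarrow> real ^ 'n) \<Rightarrow> bool" where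
  "ito_approximable t H I \<longleftrightarrow> (\<exists>N \<tau> \<xi>.
      (\<forall>n. simple_process P F t (N n) (\<tau> n) (\<xi> n)) \<and>
      vanishes_in_probability P (\<lambda>n \<omega>. \<integral>\<^sup>+s\<in>{0..t}.
        ennreal ((norm (simple_value (N n) (\<tau> n) (\<xi> n) s \<omega> - H s \<omega>))\<^sup>2) \<partial>lborel) \<and>
      vanishes_in_probability P (\<lambda>n \<omega>. ennreal (norm (simple_integral_wrt W (N n) (\<tau> n) (\<xi> n) \<omega> - I \<omega>))))"

text \<open>Convergence in probability along all sufficiently fine equidistant grids, phrased by
  outer probability so that no measurability of \<open>I\<close> has to be derived.\<close>

definition left_sum_limit :: "real \<Rightarrow> (real \<Rightarrow> 'w \<Rightarrow> real ^ 'n) \<Rightarrow> ('w \<Rightarrow> real ^ 'n) \<Rightarrow> bool" where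
  "left_sum_limit t H I \<longleftrightarrow> (\<forall>e>0. \<forall>\<eta>>0. \<exists>m0>0. \<forall>m\<ge>m0. prob_le (\<lambda>\<omega>. e <
      norm (stoch_sum (\<lambda>j. real j * (t / real m)) (\<lambda>j. H (real j * (t / real m))) m \<omega> - I \<omega>)) \<eta>)"

text \<open>On a common refinement both a good simple approximant and the left sum are simple
  integrals. Their integrands are both close to H in mean square over time, the first by
  approximation and the second by the modulus of continuity. Lenglart's inequality turns small
  quadratic variation of the difference into a small difference of the integrals.\<close>

lemma ito_approximable_left_sum_limit:
  fixes H :: "real \<Rightarrow> 'w \<Rightarrow> real ^ 'n"
  assumes t: "0 < t" and H: "\<And>s. 0 \<le> s \<Longrightarrow> H s \<in> borel_measurable (F s)"
    and cont: "AE \<omega> in P. continuous_on {0..} (\<lambda>s. H s \<omega>)"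
    and I: "ito_approximable t H I"
  shows "left_sum_limit t H I"
  unfolding left_sum_limit_def
proof (intro allI impI)
  fix e \<eta> :: real assume e: "0 < e" and \<eta>: "0 < \<eta>"
  obtain N \<tau> \<xi> where simple: "\<forall>n. simple_process P F t (N n) (\<tau> n) (\<xi> n)"
    and v1: "vanishes_in_probability P (\<lambda>n \<omega>. \<integral>\<^sup>+s\<in>{0..t}.
        ennreal ((norm (simple_value (N n) (\<tau> n) (\<xi> n) s \<omega> - H s \<omega>))\<^sup>2) \<partial>lborel)"
    and v2: "vanishes_in_probability P (\<lambda>n \<omega>.
        ennreal (norm (simple_integral_wrt W (N n) (\<tau> n) (\<xi> n) \<omega> - I \<omega>)))"
    using I unfolding ito_approximable_def by blast
  \<comment> \<open>The quadratic variation will be at most 4 d: 2 d from the approximant and 2 d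
    from the modulus, where \<open>\<kappa>\<^sup>2 * t = d\<close>. At level e / 2 Lenglart then
    costs 16 d / e^2 = \<eta> / 4 besides the exceptional events.\<close>
  define d where "d = e\<^sup>2 * \<eta> / 64"
  have d: "0 < d" using e \<eta> by (simp add: d_def)
  define \<kappa> where "\<kappa> = sqrt (d / t)"
  have \<kappa>: "0 < \<kappa>" "\<kappa>\<^sup>2 * t = d" using d t by (auto simp: \<kappa>_def)
  let ?Y = "\<lambda>n \<omega>. \<integral>\<^sup>+s\<in>{0..t}. ennreal ((norm (simple_value (N n) (\<tau> n) (\<xi> n) s \<omega> - H s \<omega>))\<^sup>2) \<partial>lborel"
  have \<eta>4: "0 < \<eta> / 4" using \<eta> by simp
  have "eventually (\<lambda>n. prob_le (\<lambda>\<omega>. ennreal d < ?Y n \<omega>) (\<eta> / 4)) sequentially"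
  proof (rule prob_le_tendsto_0[OF _ \<eta>4])
    have m: "?Y n \<in> borel_measurable P" for n using v1 unfolding vanishes_in_probability_def by blast
    show "(\<lambda>n. emeasure P {\<omega> \<in> space P. ennreal d < ?Y n \<omega>}) \<longlonglongrightarrow> 0"
      using v1 d unfolding vanishes_in_probability_def by simp
    show "{\<omega> \<in> space P. ennreal d < ?Y n \<omega>} \<in> events" for n using m[of n] by measurable
  qed
  moreover have "eventually (\<lambda>n. prob_le (\<lambda>\<omega>. ennreal (e / 2) <
      ennreal (norm (simple_integral_wrt W (N n) (\<tau> n) (\<xi> n) \<omega> - I \<omega>))) (\<eta> / 4)) sequentially"
    (is "eventually (\<lambda>n. prob_le (\<lambda>\<omega>. _ < ?Z n \<omega>) _) _")
  proof (rule prob_le_tendsto_0[OF _ \<eta>4])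
    have m: "?Z n \<in> borel_measurable P" for n using v2 unfolding vanishes_in_probability_def by blast
    show "(\<lambda>n. emeasure P {\<omega> \<in> space P. ennreal (e / 2) < ?Z n \<omega>}) \<longlonglongrightarrow> 0"
      using v2 e unfolding vanishes_in_probability_def by simp
    show "{\<omega> \<in> space P. ennreal (e / 2) < ?Z n \<omega>} \<in> events" for n using m[of n] by measurable
  qed
  ultimately have "eventually (\<lambda>n. prob_le (\<lambda>\<omega>. ennreal d < ?Y n \<omega>) (\<eta> / 4) \<and>
      prob_le (\<lambda>\<omega>. ennreal (e / 2) < ?Z n \<omega>) (\<eta> / 4)) sequentially"
    by (rule eventually_conj)
  then obtain n where nY: "prob_le (\<lambda>\<omega>. ennreal d < ?Y n \<omega>) (\<eta> / 4)"
    and nZ: "prob_le (\<lambda>\<omega>. ennreal (e / 2) < ?Z n \<omega>) (\<eta> / 4)"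
    by (auto simp: eventually_sequentially)
  obtain \<delta> where \<delta>: "0 < \<delta>" "prob_le (\<lambda>\<omega>. \<not> modulus_le (\<lambda>s. H s \<omega>) t \<delta> \<kappa>) (\<eta> / 4)"
    using modulus_in_probability[OF F_measurable[OF _ H] cont \<kappa>(1) \<eta>4] by blast
  obtain m0 :: nat where m0: "t / \<delta> < real m0" using reals_Archimedean2 by blast
  have m0_pos: "0 < m0" using m0 t \<delta>(1) by (cases m0) (auto simp: divide_less_0_iff)
  note simple_n = simple[rule_format, of n, unfolded simple_process_def]
  have \<tau>_mono: "\<tau> n i \<le> \<tau> n (Suc i)" if "i < N n" for i using simple_n that by blast
  have \<tau>_le: "\<tau> n i \<le> \<tau> n j" if "i \<le> j" "j \<le> N n" for i j
    using that
  proof (induction j rule: dec_induct)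
    case (step j)
    then show ?case using \<tau>_mono[of j] by simp
  qed simp
  have \<tau>_range: "0 \<le> \<tau> n i" "\<tau> n i \<le> t" if "i \<le> N n" for i
    using \<tau>_le[of 0 i] \<tau>_le[of i "N n"] that simple_n by auto
  have "prob_le (\<lambda>\<omega>. e < norm (stoch_sum (\<lambda>j. real j * (t / real m))
      (\<lambda>j. H (real j * (t / real m))) m \<omega> - I \<omega>)) \<eta>" if mm: "m0 \<le> m" for m
  proof -
    define \<mu> where "\<mu> = t / real m"
    define \<sigma> where "\<sigma> j = real j * \<mu>" for j
    have m: "0 < m" using m0_pos mm by simp
    have "t / \<delta> < real m" using m0 mm by (meson less_le_trans of_nat_mono)
    then have mesh: "\<mu> < \<delta>" using \<delta>(1) m by (simp add: field_simps \<mu>_def)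
    have tm: "0 < \<mu>" using t m by (simp add: \<mu>_def)
    interpret G: strict_partition \<sigma> m
      by unfold_locales (use tm in \<open>simp add: \<sigma>_def algebra_simps\<close>)
    have \<sigma>0: "\<sigma> 0 = 0" and \<sigma>m: "\<sigma> m = t" using m by (auto simp: \<sigma>_def \<mu>_def)
    have \<sigma>_range: "0 \<le> \<sigma> j" "\<sigma> j \<le> t" if "j \<le> m" for j
      using G.le_iff[of 0 j] G.le_iff[of j m] that \<sigma>0 \<sigma>m by auto
    define S where "S = \<tau> n ` {..N n} \<union> \<sigma> ` {..m}"
    obtain p L where "strict_partition p L" and p: "p ` {..L} = S"
      using finite_strict_partition[of S] by (auto simp: S_def)
    then interpret Q: strict_partition p L by simp
    have p_range: "0 \<le> p k" "p k \<le> t" if "k \<le> L" for k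
    proof -
      have "p k \<in> S" using p that by auto
      then show "0 \<le> p k" "p k \<le> t" using \<tau>_range \<sigma>_range by (auto simp: S_def)
    qed
    have p0: "p 0 = 0"
    proof -
      have "0 \<in> p ` {..L}" using p \<sigma>0 by (force simp: S_def)
      then obtain k where "k \<le> L" "p k = 0" by auto
      then show ?thesis using Q.le_iff[of 0 k] p_range[of 0] by simp
    qed
    have r\<tau>: "Q.refines (N n) (\<tau> n)" using p \<tau>_mono by (auto simp: Q.refines_def S_def)
    have r\<sigma>: "Q.refines m \<sigma>" using p G.strict by (auto simp: Q.refines_def S_def less_imp_le)
    let ?a = "simple_value (N n) (\<tau> n) (\<xi> n)" and ?b = "simple_value m \<sigma> (\<lambda>j. H (\<sigma> j))"
    define \<zeta> where "\<zeta> k \<omega> = ?a (p (Suc k)) \<omega> - ?b (p (Suc k)) \<omega>" for k \<omega>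
    have sum_a: "stoch_sum p (\<lambda>k. ?a (p (Suc k))) L \<omega> = simple_integral_wrt W (N n) (\<tau> n) (\<xi> n) \<omega>" for \<omega>
      unfolding stoch_sum_def by (rule Q.refine_sum[symmetric, OF r\<tau>])
    have sum_b: "stoch_sum p (\<lambda>k. ?b (p (Suc k))) L \<omega> = stoch_sum \<sigma> (\<lambda>j. H (\<sigma> j)) m \<omega>" for \<omega>
      unfolding stoch_sum_def Q.refine_sum[symmetric, OF r\<sigma>] simple_integral_wrt_def ..
    have sum_\<zeta>: "stoch_sum p \<zeta> L \<omega> = simple_integral_wrt W (N n) (\<tau> n) (\<xi> n) \<omega> - stoch_sum \<sigma> (\<lambda>j. H (\<sigma> j)) m \<omega>" for \<omega>
      unfolding \<zeta>_def[abs_def] stoch_sum_diff sum_a sum_b ..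
    \<comment> \<open>Reading a value at the right endpoint does not look ahead: a summand that is
      nonzero there has \<open>\<rho> i < p (Suc k)\<close>, hence \<open>\<rho> i \<le> p k\<close>
      because \<open>\<rho> i\<close> is a grid point.\<close>
    have value_meas: "simple_value N' \<rho> \<theta> (p (Suc k)) \<in> borel_measurable (F (p k))"
      if k: "k < L" and \<theta>: "\<And>i. i < N' \<Longrightarrow> \<theta> i \<in> borel_measurable (F (\<rho> i))"
        and \<rho>: "\<And>i. i \<le> N' \<Longrightarrow> 0 \<le> \<rho> i" "Q.refines N' \<rho>"
      for k N' \<rho> and \<theta> :: "nat \<Rightarrow> 'w \<Rightarrow> real ^ 'n"
    proof -
      have "(\<lambda>\<omega>. indicator {\<rho> i<..\<rho> (Suc i)} (p (Suc k)) *\<^sub>R \<theta> i \<omega>) \<in> borel_measurable (F (p k))" if i: "i < N'" for i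
      proof (cases "\<rho> i < p (Suc k)")
        case True
        obtain j where j: "j \<le> L" "\<rho> i = p j" using Q.refinesD[OF \<rho>(2), of i] i by auto
        then have "\<rho> i \<le> p k" using True k by (simp add: Q.less_iff Q.le_iff)
        then have "\<theta> i \<in> borel_measurable (F (p k))"
          using \<theta>[OF i] \<rho>(1)[of i] i by (intro F_measurable_mono[of "\<rho> i" "p k"]) auto
        then show ?thesis by simp
      qed simp
      then show ?thesis unfolding simple_value_def[abs_def] by (intro borel_measurable_sum) auto
    qed
    have \<zeta>_meas: "\<zeta> k \<in> borel_measurable (F (p k))" if "k < L" for k
    proof -
      have "?a (p (Suc k)) \<in> borel_measurable (F (p k))"
        by (rule value_meas[OF that _ _ r\<tau>]) (use simple_n \<tau>_range in auto)
      moreover have "?b (p (Suc k)) \<in> borel_measurable (F (p k))"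
        by (rule value_meas[OF that _ _ r\<sigma>]) (use H[OF \<sigma>_range(1)] \<sigma>_range in auto)
      ultimately show ?thesis unfolding \<zeta>_def by (intro borel_measurable_diff)
    qed
    have bound: "(\<Sum>k<L. (p (Suc k) - p k) * (norm (\<zeta> k \<omega>))\<^sup>2) \<le> 4 * d"
      if c: "continuous_on {0..} (\<lambda>s. H s \<omega>)" and mod: "modulus_le (\<lambda>s. H s \<omega>) t \<delta> \<kappa>" and Y: "?Y n \<omega> \<le> ennreal d" for \<omega>
    proof -
      \<comment> \<open>The path is continuous only on nonnegative times; cutting it off makes
        \<open>f\<close> Borel measurable on the whole line without changing it on [0,t].\<close>
      define f where "f s = (norm (?a s \<omega> - indicator {0..t} s *\<^sub>R H s \<omega>))\<^sup>2" for s
      have "(\<lambda>s. indicator {0..t} s *\<^sub>R H s \<omega>) \<in> borel_measurable borel"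
        by (intro borel_measurable_continuous_on_indicator continuous_on_subset[OF c]) auto
      moreover have "(\<lambda>s. ?a s \<omega>) \<in> borel_measurable borel"
        unfolding simple_value_def by measurable
      ultimately have fm: "f \<in> borel_measurable borel" unfolding f_def by measurable
      define g where "g s = ennreal (2 * f s + 2 * \<kappa>\<^sup>2)" for s
      have gm: "g \<in> borel_measurable borel" using fm unfolding g_def by measurable
      have f: "f s = (norm (?a s \<omega> - H s \<omega>))\<^sup>2" if "s \<in> {0..t}" for s using that by (simp add: f_def)
      have cellb: "(norm (\<zeta> k \<omega>))\<^sup>2 \<le> 2 * f s + 2 * \<kappa>\<^sup>2" if k: "k < L" "p k < s" "s \<le> p (Suc k)" for k s
      proof -
        have s: "0 < s" "s \<le> t" using k p_range[of k] p_range[of "Suc k"] by auto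
        obtain j where j: "j < m" "\<sigma> j < s" "s \<le> \<sigma> (Suc j)"
          using G.cell[of s] s \<sigma>0 \<sigma>m by auto
        have "?b s \<omega> = H (\<sigma> j) \<omega>" by (rule G.simple_value_cell[OF j])
        moreover have "norm (H (\<sigma> j) \<omega> - H s \<omega>) \<le> \<kappa>"
        proof (rule modulus_leD[OF mod])
          have "s - \<sigma> j \<le> \<mu>" using j(3) by (simp add: \<sigma>_def distrib_right)
          then show "\<bar>\<sigma> j - s\<bar> < \<delta>" using j mesh by simp
        qed (use s \<sigma>_range[of j] j in auto)
        ultimately have b: "norm (?b s \<omega> - H s \<omega>) \<le> \<kappa>" by simp
        have "\<zeta> k \<omega> = ?a s \<omega> - ?b s \<omega>"
          unfolding \<zeta>_def 
          by (simp only: Q.refine_value[OF r\<tau> k, of "\<xi> n"] Q.refine_value[OF r\<sigma> k, of "\<lambda>j. H (\<sigma> j)"])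
        also have "\<dots> = (?a s \<omega> - H s \<omega>) - (?b s \<omega> - H s \<omega>)" by simp
        finally have "norm (\<zeta> k \<omega>) \<le> norm (?a s \<omega> - H s \<omega>) + norm (?b s \<omega> - H s \<omega>)"
          by (metis norm_triangle_ineq4)
        also have "\<dots> \<le> norm (?a s \<omega> - H s \<omega>) + \<kappa>" using b by simp
        finally have "(norm (\<zeta> k \<omega>))\<^sup>2 \<le> (norm (?a s \<omega> - H s \<omega>) + \<kappa>)\<^sup>2" by (intro power_mono) auto
        also have "\<dots> \<le> 2 * (norm (?a s \<omega> - H s \<omega>))\<^sup>2 + 2 * \<kappa>\<^sup>2"
          by (rule square_add_le)
        finally show ?thesis using s by (simp add: f)
      qed
      \<comment> \<open>The sum is the integral of a step function, and \<open>cellb\<close> bounds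
        the value of a cell by \<open>g s\<close> at every point s of it; so the sum is controlled
        by the integral that is small in probability.\<close>
      have "ennreal (\<Sum>k<L. (p (Suc k) - p k) * (norm (\<zeta> k \<omega>))\<^sup>2)
          = (\<Sum>k<L. ennreal ((norm (\<zeta> k \<omega>))\<^sup>2) * emeasure lborel {p k<..p (Suc k)})"
      proof (subst sum_ennreal[symmetric])
        fix k assume "k \<in> {..<L}"
        then have "p k < p (Suc k)" using Q.strict[of k] by simp
        then show "0 \<le> (p (Suc k) - p k) * (norm (\<zeta> k \<omega>))\<^sup>2" by simp
      next
        show "(\<Sum>k<L. ennreal ((p (Suc k) - p k) * (norm (\<zeta> k \<omega>))\<^sup>2))
          = (\<Sum>k<L. ennreal ((norm (\<zeta> k \<omega>))\<^sup>2) * emeasure lborel {p k<..p (Suc k)})"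
        proof (rule sum.cong[OF refl])
          fix k assume "k \<in> {..<L}"
          then have "p k < p (Suc k)" using Q.strict[of k] by simp
          then show "ennreal ((p (Suc k) - p k) * (norm (\<zeta> k \<omega>))\<^sup>2) = ennreal ((norm (\<zeta> k \<omega>))\<^sup>2) * emeasure lborel {p k<..p (Suc k)}"
            by (simp add: ennreal_mult'[symmetric] mult.commute)
        qed
      qed
      also have "\<dots> = (\<Sum>k<L. \<integral>\<^sup>+s. ennreal ((norm (\<zeta> k \<omega>))\<^sup>2) * indicator {p k<..p (Suc k)} s \<partial>lborel)"
        by (simp add: nn_integral_cmult_indicator)
      also have "\<dots> \<le> (\<Sum>k<L. \<integral>\<^sup>+s. g s * indicator {p k<..p (Suc k)} s \<partial>lborel)"
      proof (intro sum_mono nn_integral_mono)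
        fix k s assume "k \<in> {..<L}"
        then show "ennreal ((norm (\<zeta> k \<omega>))\<^sup>2) * indicator {p k<..p (Suc k)} s \<le> g s * indicator {p k<..p (Suc k)} s"
          using cellb[of k s] unfolding g_def by (auto simp: indicator_def intro!: ennreal_leI)
      qed
      also have "\<dots> = (\<integral>\<^sup>+s. (\<Sum>k<L. g s * indicator {p k<..p (Suc k)} s) \<partial>lborel)"
        using gm by (intro nn_integral_sum[symmetric] borel_measurable_times_ennreal borel_measurable_indicator) auto
      also have "\<dots> = (\<integral>\<^sup>+s. g s * indicator {p 0<..p L} s \<partial>lborel)"
        by (simp only: sum_distrib_left[symmetric] Q.sum_indicator[OF order_refl])
      also have "\<dots> \<le> (\<integral>\<^sup>+s. 2 * (ennreal ((norm (?a s \<omega> - H s \<omega>))\<^sup>2) * indicator {0..t} s) + ennreal (2 * \<kappa>\<^sup>2) * indicator {0..t} s \<partial>lborel)"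
      proof (rule nn_integral_mono)
        fix s
        show "g s * indicator {p 0<..p L} s \<le> 2 * (ennreal ((norm (?a s \<omega> - H s \<omega>))\<^sup>2) * indicator {0..t} s) + ennreal (2 * \<kappa>\<^sup>2) * indicator {0..t} s"
        proof (cases "s \<in> {p 0<..p L}")
          case True
          then have s: "s \<in> {0..t}" using p0 p_range[of L] by auto
          have "g s = 2 * ennreal (f s) + ennreal (2 * \<kappa>\<^sup>2)"
            by (simp add: g_def ennreal_plus ennreal_mult f_def)
          then show ?thesis using True s by (simp add: f)
        qed simp
      qed
      also have "\<dots> = (\<integral>\<^sup>+s. 2 * (ennreal (f s) * indicator {0..t} s) + ennreal (2 * \<kappa>\<^sup>2) * indicator {0..t} s \<partial>lborel)"
        by (intro nn_integral_cong) (simp add: f split: split_indicator)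
      also have "\<dots> = 2 * (\<integral>\<^sup>+s. ennreal (f s) * indicator {0..t} s \<partial>lborel) + ennreal (2 * \<kappa>\<^sup>2) * emeasure lborel {0..t}"
        using fm by (subst nn_integral_add) (auto simp: nn_integral_cmult nn_integral_cmult_indicator)
      also have "(\<integral>\<^sup>+s. ennreal (f s) * indicator {0..t} s \<partial>lborel) = ?Y n \<omega>"
        by (intro nn_integral_cong) (simp add: f split: split_indicator)
      also have "2 * ?Y n \<omega> + ennreal (2 * \<kappa>\<^sup>2) * emeasure lborel {0..t} \<le> 2 * ennreal d + ennreal (2 * \<kappa>\<^sup>2) * emeasure lborel {0..t}"
        using Y by (intro add_right_mono mult_left_mono) auto
      also have "\<dots> = ennreal (4 * d)"
      proof -
        have "ennreal (2 * \<kappa>\<^sup>2) * emeasure lborel {0..t} = ennreal (2 * d)"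
          using t \<kappa>(2) by (simp add: ennreal_mult'[symmetric] mult.assoc)
        moreover have "2 * ennreal d = ennreal (2 * d)" using d by (simp add: ennreal_mult)
        ultimately show ?thesis using d by (simp add: ennreal_plus[symmetric] del: ennreal_plus)
      qed
      finally show ?thesis using d by (subst (asm) ennreal_le_iff) auto
    qed
    have "prob_le (\<lambda>\<omega>. (\<not> modulus_le (\<lambda>s. H s \<omega>) t \<delta> \<kappa> \<or> ennreal d < ?Y n \<omega>) \<or> \<not> continuous_on {0..} (\<lambda>s. H s \<omega>)) (\<eta> / 4 + \<eta> / 4 + 0)"
      using cont by (intro prob_le_disj \<delta> nY prob_le_AE) simp
    then have "prob_le (\<lambda>\<omega>. 4 * d < (\<Sum>k<L. (p (Suc k) - p k) * (norm (\<zeta> k \<omega>))\<^sup>2)) (\<eta> / 2)"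
      by (rule prob_le_mono) (use bound in \<open>auto simp: not_less[symmetric]\<close>)
    then have "prob_le (\<lambda>\<omega>. \<exists>k\<le>L. e / 2 < norm (stoch_sum p \<zeta> k \<omega>)) (4 * d / (e / 2)\<^sup>2 + \<eta> / 2)"
      by (intro lenglart) (use p_range Q.strict \<zeta>_meas e d in auto)
    then have "prob_le (\<lambda>\<omega>. (\<exists>k\<le>L. e / 2 < norm (stoch_sum p \<zeta> k \<omega>)) \<or> ennreal (e / 2) < ?Z n \<omega>) ((4 * d / (e / 2)\<^sup>2 + \<eta> / 2) + \<eta> / 4)"
      using nZ by (rule prob_le_disj)
    then have "prob_le (\<lambda>\<omega>. e < norm (stoch_sum \<sigma> (\<lambda>j. H (\<sigma> j)) m \<omega> - I \<omega>)) \<eta>"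
    proof (rule prob_le_mono)
      show "(4 * d / (e / 2)\<^sup>2 + \<eta> / 2) + \<eta> / 4 \<le> \<eta>" using e by (simp add: d_def power_divide)
      fix \<omega> assume "e < norm (stoch_sum \<sigma> (\<lambda>j. H (\<sigma> j)) m \<omega> - I \<omega>)"
      also have "stoch_sum \<sigma> (\<lambda>j. H (\<sigma> j)) m \<omega> - I \<omega> = (simple_integral_wrt W (N n) (\<tau> n) (\<xi> n) \<omega> - I \<omega>) - stoch_sum p \<zeta> L \<omega>"
        by (simp add: sum_\<zeta>)
      also have "norm \<dots> \<le> norm (simple_integral_wrt W (N n) (\<tau> n) (\<xi> n) \<omega> - I \<omega>) + norm (stoch_sum p \<zeta> L \<omega>)"
        by (rule norm_triangle_ineq4)
      finally have "e / 2 < norm (stoch_sum p \<zeta> L \<omega>) \<or> e / 2 < norm (simple_integral_wrt W (N n) (\<tau> n) (\<xi> n) \<omega> - I \<omega>)"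
        by linarith
      then show "(\<exists>k\<le>L. e / 2 < norm (stoch_sum p \<zeta> k \<omega>)) \<or> ennreal (e / 2) < ?Z n \<omega>"
        using e by (auto simp: ennreal_less_iff)
    qed
    then show ?thesis unfolding \<sigma>_def \<mu>_def .
  qed
  then show "\<exists>m0>0. \<forall>m\<ge>m0. prob_le (\<lambda>\<omega>. e < norm (stoch_sum (\<lambda>j. real j * (t / real m))
      (\<lambda>j. H (real j * (t / real m))) m \<omega> - I \<omega>)) \<eta>" using m0_pos by blast
qed

end

section \<open>The Euler scheme\<close>

text \<open>The equation over an abstract filtration; \<open>T\<close> is the matrix called
  \<open>\<Theta>\<close> in the theorem.\<close>

locale pantograph = brownian_filtration P F W
  for P :: "'w measure" and F :: "real \<Rightarrow> 'w measure" and W :: "real \<Rightarrow> 'w \<Rightarrow> real" +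
  fixes q :: real and A B S T :: "real ^ 'n ^ 'n"
    and X0 :: "'w \<Rightarrow> real ^ 'n" and X :: "real \<Rightarrow> 'w \<Rightarrow> real ^ 'n"
  assumes q: "0 < q" "q < 1"
    and X0: "L2 0 X0"
    and X_adapted: "0 \<le> t \<Longrightarrow> X t \<in> borel_measurable (F t)"
    and X_continuous: "AE \<omega> in P. continuous_on {0..} (\<lambda>t. X t \<omega>)"
    and X_initial: "AE \<omega> in P. X 0 \<omega> = X0 \<omega>"
    and X_integral: "0 \<le> t \<Longrightarrow> \<exists>I. ito_approximable t (\<lambda>s \<omega>. S *v X s \<omega> + T *v X (q * s) \<omega>) I \<and>
        (AE \<omega> in P. X t \<omega> = X0 \<omega> + integral {0..t} (\<lambda>s. A *v X s \<omega> + B *v X (q * s) \<omega>) + I \<omega>)"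
begin

definition drift :: "real ^ 'n \<Rightarrow> real ^ 'n \<Rightarrow> real ^ 'n" where "drift x y = A *v x + B *v y"
definition noise :: "real ^ 'n \<Rightarrow> real ^ 'n \<Rightarrow> real ^ 'n" where "noise x y = S *v x + T *v y"

text \<open>The mean, over the Brownian increment, of the quadratic form after one step.\<close>
definition step_energy :: "real ^ 'n ^ 'n \<Rightarrow> real \<Rightarrow> real ^ 'n \<Rightarrow> real ^ 'n \<Rightarrow> real ^ 'n \<Rightarrow> real" where
  "step_energy C h z x y = (z + h *\<^sub>R drift x y) \<bullet> (C *v (z + h *\<^sub>R drift x y)) + h * (noise x y \<bullet> (C *v noise x y))"

text \<open>By linearity one number serves as growth and as Lipschitz constant of both coefficients;
  the summand 1 allows division by it.\<close>

definition lip :: real where "lip = opnorm A + opnorm B + opnorm S + opnorm T + 1"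

lemma lip_pos: "0 < lip"
  unfolding lip_def using opnorm_ge0[of A] opnorm_ge0[of B] opnorm_ge0[of S] opnorm_ge0[of T] by linarith

lemma norm_matrix_pair:
  assumes "opnorm D + opnorm E \<le> lip"
  shows "norm (D *v x + E *v y) \<le> lip * max (norm x) (norm y)"
proof -
  let ?m = "max (norm x) (norm y)"
  have "norm (D *v x + E *v y) \<le> opnorm D * norm x + opnorm E * norm y"
    by (intro order_trans[OF norm_triangle_ineq] add_mono opnorm_bound)
  also have "\<dots> \<le> opnorm D * ?m + opnorm E * ?m"
    by (intro add_mono mult_left_mono opnorm_ge0) auto
  also have "\<dots> = (opnorm D + opnorm E) * ?m" by (simp add: distrib_right)
  also have "\<dots> \<le> lip * ?m" using assms by (intro mult_right_mono) (auto simp: max_def)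
  finally show ?thesis .
qed

lemma drift_bound: "norm (drift x y) \<le> lip * max (norm x) (norm y)"
  unfolding drift_def using opnorm_ge0[of S] opnorm_ge0[of T] by (intro norm_matrix_pair) (simp add: lip_def)

lemma noise_bound: "norm (noise x y) \<le> lip * max (norm x) (norm y)"
  unfolding noise_def using opnorm_ge0[of A] opnorm_ge0[of B] by (intro norm_matrix_pair) (simp add: lip_def)

lemma drift_diff: "drift x y - drift x' y' = drift (x - x') (y - y')"
  and noise_diff: "noise x y - noise x' y' = noise (x - x') (y - y')"
  by (simp_all add: drift_def noise_def matrix_vector_mult_diff_distrib)

lemma coefficients_diff_bound:
  assumes "norm (x - x') \<le> \<kappa>" "norm (y - y') \<le> \<kappa>"
  shows "norm (drift x y - drift x' y') \<le> lip * \<kappa>" "norm (noise x y - noise x' y') \<le> lip * \<kappa>"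
proof -
  have "lip * max (norm (x - x')) (norm (y - y')) \<le> lip * \<kappa>"
    using assms lip_pos by (intro mult_left_mono) auto
  then show "norm (drift x y - drift x' y') \<le> lip * \<kappa>" "norm (noise x y - noise x' y') \<le> lip * \<kappa>"
    unfolding drift_diff noise_diff using drift_bound noise_bound order_trans by blast+
qed

lemma coefficient_square_bound:
  assumes "norm z \<le> lip * max (norm x) (norm y)"
  shows "(norm z)\<^sup>2 \<le> lip\<^sup>2 * ((norm x)\<^sup>2 + (norm y)\<^sup>2)"
proof -
  have "(norm z)\<^sup>2 \<le> (lip * max (norm x) (norm y))\<^sup>2" using assms by (intro power_mono) auto
  also have "\<dots> \<le> lip\<^sup>2 * ((norm x)\<^sup>2 + (norm y)\<^sup>2)"
    unfolding power_mult_distrib by (intro mult_left_mono) (auto simp: max_def)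
  finally show ?thesis .
qed

lemma coefficients_measurable:
  assumes "U \<in> borel_measurable N" "V \<in> borel_measurable N"
  shows "(\<lambda>\<omega>. drift (U \<omega>) (V \<omega>)) \<in> borel_measurable N" "(\<lambda>\<omega>. noise (U \<omega>) (V \<omega>)) \<in> borel_measurable N"
  unfolding drift_def noise_def by (intro borel_measurable_add matrix_measurable assms)+

lemma coefficients_L2:
  assumes "0 \<le> s" "L2 s U" "L2 s V"
  shows "L2 s (\<lambda>\<omega>. drift (U \<omega>) (V \<omega>))" "L2 s (\<lambda>\<omega>. noise (U \<omega>) (V \<omega>))"
  unfolding drift_def noise_def using assms by (auto intro!: L2_add L2_matrix)

text \<open>The perturbation \<open>\<eta>\<close> is added to the state only where the coefficients are evaluated; the
  Euler scheme is the case \<open>\<eta> = 0\<close>.\<close>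
function scheme :: "real \<Rightarrow> ('w \<Rightarrow> real ^ 'n) \<Rightarrow> (nat \<Rightarrow> 'w \<Rightarrow> real ^ 'n) \<Rightarrow> nat \<Rightarrow> 'w \<Rightarrow> real ^ 'n" where
  "scheme h z \<eta> 0 \<omega> = z \<omega>"
| "scheme h z \<eta> (Suc k) \<omega> = scheme h z \<eta> k \<omega>
    + h *\<^sub>R drift (scheme h z \<eta> k \<omega> + \<eta> k \<omega>) (scheme h z \<eta> (delay q k) \<omega> + \<eta> (delay q k) \<omega>)
    + (W (real (Suc k) * h) \<omega> - W (real k * h) \<omega>) *\<^sub>R
      noise (scheme h z \<eta> k \<omega> + \<eta> k \<omega>) (scheme h z \<eta> (delay q k) \<omega> + \<eta> (delay q k) \<omega>)"
  by pat_completeness auto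
termination
  by (relation "Wellfounded.measure (\<lambda>(h, z, \<eta>, k, \<omega>). k)") (auto simp: delay_le less_Suc_eq_le)

declare scheme.simps(2) [simp del]

abbreviation euler :: "real \<Rightarrow> nat \<Rightarrow> 'w \<Rightarrow> real ^ 'n" where
  "euler h \<equiv> scheme h X0 (\<lambda>_ _. 0)"

lemma grid_mono: "0 < h \<Longrightarrow> i \<le> j \<Longrightarrow> real i * h \<le> real j * h"
  by (intro mult_right_mono) auto

context
  fixes h :: real and z :: "'w \<Rightarrow> real ^ 'n" and \<eta> :: "nat \<Rightarrow> 'w \<Rightarrow> real ^ 'n"
  assumes h: "0 < h" and z: "L2 0 z" and \<eta>: "\<And>k. L2 (real k * h) (\<eta> k)"
begin

lemma scheme_L2: "L2 (real k * h) (scheme h z \<eta> k)"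
proof (induction k rule: less_induct)
  case (less k)
  show ?case
  proof (cases k)
    case 0
    then show ?thesis using z by (simp add: scheme.simps(1)[abs_def])
  next
    case (Suc j)
    define u where "u \<omega> = scheme h z \<eta> j \<omega> + \<eta> j \<omega>" for \<omega>
    define v where "v \<omega> = scheme h z \<eta> (delay q j) \<omega> + \<eta> (delay q j) \<omega>" for \<omega>
    have j0: "0 \<le> real j * h" and jj: "real j * h \<le> real (Suc j) * h" using h by (auto intro: mult_right_mono)
    have d: "0 \<le> real (delay q j) * h" "real (delay q j) * h \<le> real j * h"
      using h delay_le[of q j] by (auto intro: mult_right_mono)
    have u: "L2 (real j * h) u" unfolding u_def using less Suc \<eta>[of j] j0 by (intro L2_add) auto
    have "L2 (real (delay q j) * h) v" unfolding v_def
      using less Suc \<eta>[of "delay q j"] d delay_le[of q j] by (intro L2_add less.IH) auto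
    then have v: "L2 (real j * h) v" using d by (intro L2_mono[of "real (delay q j) * h" "real j * h"])
    have "L2 (real j * h) (\<lambda>\<omega>. scheme h z \<eta> j \<omega> + h *\<^sub>R drift (u \<omega>) (v \<omega>))"
      using less Suc j0 u v by (intro L2_add L2_scaleR[where c = "\<bar>h\<bar>"] coefficients_L2) auto
    from quad_step(1)[OF j0 jj this coefficients_L2(2)[OF j0 u v]]
    show ?thesis unfolding Suc scheme.simps(2)[abs_def] u_def v_def .
  qed
qed

lemma scheme_delay_L2: "L2 (real k * h) (scheme h z \<eta> (delay q k))"
  using h delay_le[of q k] by (intro L2_mono[OF _ _ scheme_L2]) (auto intro: mult_right_mono)

lemma delay_L2: "L2 (real k * h) (\<eta> (delay q k))"
  using h delay_le[of q k] by (intro L2_mono[OF _ _ \<eta>]) (auto intro: mult_right_mono)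

text \<open>Averaging out the increment leaves the integral of a function of the present and delayed
  states and perturbations alone, so that pointwise inequalities for \<open>step_energy\<close> can
  be integrated.\<close>

lemma scheme_step:
  fixes C :: "real ^ 'n ^ 'n" and k :: nat
  defines "e \<equiv> \<lambda>\<omega>. step_energy C h (scheme h z \<eta> k \<omega>) (scheme h z \<eta> k \<omega> + \<eta> k \<omega>)
      (scheme h z \<eta> (delay q k) \<omega> + \<eta> (delay q k) \<omega>)"
  shows "(\<integral>\<omega>. scheme h z \<eta> (Suc k) \<omega> \<bullet> (C *v scheme h z \<eta> (Suc k) \<omega>) \<partial>P) = (\<integral>\<omega>. e \<omega> \<partial>P)"
    and "integrable P e"
proof -
  define u where "u \<omega> = scheme h z \<eta> k \<omega> + \<eta> k \<omega>" for \<omega>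
  define v where "v \<omega> = scheme h z \<eta> (delay q k) \<omega> + \<eta> (delay q k) \<omega>" for \<omega>
  define x where "x \<omega> = scheme h z \<eta> k \<omega> + h *\<^sub>R drift (u \<omega>) (v \<omega>)" for \<omega>
  define y where "y \<omega> = noise (u \<omega>) (v \<omega>)" for \<omega>
  have k: "0 \<le> real k * h" "real k * h \<le> real (Suc k) * h" using h by (auto intro: mult_right_mono)
  have u: "L2 (real k * h) u" unfolding u_def by (intro L2_add k scheme_L2 \<eta>)
  have v: "L2 (real k * h) v" unfolding v_def by (intro L2_add k scheme_delay_L2 delay_L2)
  have x: "L2 (real k * h) x" unfolding x_def
    by (intro L2_add k scheme_L2 L2_scaleR[where c = "\<bar>h\<bar>"] coefficients_L2 u v) auto
  have y: "L2 (real k * h) y" unfolding y_def by (intro coefficients_L2 k u v)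
  have xy: "integrable P (\<lambda>\<omega>. x \<omega> \<bullet> (C *v x \<omega>))" "integrable P (\<lambda>\<omega>. y \<omega> \<bullet> (C *v y \<omega>))"
    by (intro L2_integrable_inner[OF k(1)] L2_matrix x y k(1))+
  have "(\<integral>\<omega>. scheme h z \<eta> (Suc k) \<omega> \<bullet> (C *v scheme h z \<eta> (Suc k) \<omega>) \<partial>P)
      = (\<integral>\<omega>. (x \<omega> + (W (real (Suc k) * h) \<omega> - W (real k * h) \<omega>) *\<^sub>R y \<omega>) \<bullet>
          (C *v (x \<omega> + (W (real (Suc k) * h) \<omega> - W (real k * h) \<omega>) *\<^sub>R y \<omega>)) \<partial>P)"
    by (simp add: scheme.simps(2) x_def y_def u_def v_def)
  also have "\<dots> = (\<integral>\<omega>. x \<omega> \<bullet> (C *v x \<omega>) \<partial>P) + h * (\<integral>\<omega>. y \<omega> \<bullet> (C *v y \<omega>) \<partial>P)"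
    using quad_step(2)[OF k x y, of C] by (simp add: distrib_right)
  also have "\<dots> = (\<integral>\<omega>. x \<omega> \<bullet> (C *v x \<omega>) + h * (y \<omega> \<bullet> (C *v y \<omega>)) \<partial>P)" using xy by simp
  finally show "(\<integral>\<omega>. scheme h z \<eta> (Suc k) \<omega> \<bullet> (C *v scheme h z \<eta> (Suc k) \<omega>) \<partial>P) = (\<integral>\<omega>. e \<omega> \<partial>P)"
    by (simp add: x_def y_def u_def v_def e_def step_energy_def)
  show "integrable P e"
    using xy by (simp add: x_def y_def u_def v_def e_def[abs_def] step_energy_def)
qed

end

text \<open>A discrete Gronwall estimate: started at zero, the scheme is driven only by
  perturbations of size \<kappa>, so its second moment is of order \<open>\<kappa>\<^sup>2\<close>
  on bounded time intervals, uniformly in the step size.\<close>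

lemma scheme_perturbation_bound:
  assumes h: "0 < h" "h \<le> 1" and \<eta>: "\<And>k. \<eta> k \<in> borel_measurable (F (real k * h))"
    and \<kappa>: "\<And>k \<omega>. norm (\<eta> k \<omega>) \<le> \<kappa>" "0 \<le> \<kappa>"
  shows "(\<integral>\<omega>. (norm (scheme h (\<lambda>_. 0) \<eta> k \<omega>))\<^sup>2 \<partial>P) \<le> \<kappa>\<^sup>2 * exp (2 * (1 + 12 * lip\<^sup>2) * (real k * h))"
proof -
  let ?Z = "scheme h (\<lambda>_. 0) \<eta>"
  \<comment> \<open>The energy gains h times 3 Q plus the squared norm of z: one Q comes from the
    cross term with the drift, one from the squared drift since h \<le> 1, one from the noise. Here
    3 Q contributes 6 \<open>lip\<^sup>2\<close> for each state and 12
    \<open>lip\<^sup>2 * \<kappa>\<^sup>2\<close> for the perturbations.\<close>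
  define b where "b = 1 + 12 * lip\<^sup>2"
  have b: "0 \<le> b" by (simp add: b_def)
  have sq: "(norm (\<eta> k \<omega>))\<^sup>2 \<le> \<kappa>\<^sup>2" for k \<omega> using \<kappa>(1) by (intro power_mono) auto
  have \<eta>L: "L2 (real k * h) (\<eta> k)" for k
    using h \<eta> sq by (intro L2_dominated[where g = "\<lambda>_. \<kappa>\<^sup>2"]) auto
  note ZL = scheme_L2[OF h(1) L2_zero \<eta>L]
  define w where "w k = (\<integral>\<omega>. (norm (?Z k \<omega>))\<^sup>2 \<partial>P)" for k
  have step: "w (Suc k) \<le> (1 + b * h) * w k + b * h * w (delay q k) + 2 * b * h * \<kappa>\<^sup>2" for k
  proof -
    let ?d = "delay q k"
    have pt: "(norm (z + h *\<^sub>R drift u v))\<^sup>2 + h * (norm (noise u v))\<^sup>2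
        \<le> (1 + b * h) * (norm z)\<^sup>2 + b * h * (norm z')\<^sup>2 + 2 * b * h * \<kappa>\<^sup>2"
      if u: "u = z + e" "(norm e)\<^sup>2 \<le> \<kappa>\<^sup>2" and v: "v = z' + e'" "(norm e')\<^sup>2 \<le> \<kappa>\<^sup>2" for z z' u v e e' :: "real ^ 'n"
    proof -
      define Q where "Q = lip\<^sup>2 * ((norm u)\<^sup>2 + (norm v)\<^sup>2)"
      have D: "(norm (drift u v))\<^sup>2 \<le> Q" and N: "(norm (noise u v))\<^sup>2 \<le> Q"
        unfolding Q_def by (intro coefficient_square_bound drift_bound noise_bound)+
      have "(norm u)\<^sup>2 + (norm v)\<^sup>2 \<le> 2 * (norm z)\<^sup>2 + 2 * (norm z')\<^sup>2 + 4 * \<kappa>\<^sup>2"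
        using norm_add_square_le[of z e] norm_add_square_le[of z' e'] u v by simp
      then have "Q \<le> lip\<^sup>2 * (2 * (norm z)\<^sup>2 + 2 * (norm z')\<^sup>2 + 4 * \<kappa>\<^sup>2)"
        unfolding Q_def by (intro mult_left_mono) auto
      moreover have "0 \<le> lip\<^sup>2 * (norm z)\<^sup>2" "0 \<le> lip\<^sup>2 * (norm z')\<^sup>2" "0 \<le> lip\<^sup>2 * \<kappa>\<^sup>2"
        "0 \<le> (norm z')\<^sup>2" "0 \<le> \<kappa>\<^sup>2" by simp_all
      ultimately have Q: "3 * Q + (norm z)\<^sup>2 \<le> b * (norm z)\<^sup>2 + b * (norm z')\<^sup>2 + 2 * b * \<kappa>\<^sup>2"
        unfolding b_def distrib_left distrib_right by linarith
      have "(norm (z + h *\<^sub>R drift u v))\<^sup>2 = (norm z)\<^sup>2 + h * (2 * (z \<bullet> drift u v)) + h * (h * (norm (drift u v))\<^sup>2)"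
        unfolding power2_norm_eq_inner by (simp add: inner_add_left inner_add_right inner_commute algebra_simps)
      also have "\<dots> \<le> (norm z)\<^sup>2 + h * ((norm z)\<^sup>2 + Q) + h * Q"
      proof -
        have "2 * (z \<bullet> drift u v) \<le> (norm z)\<^sup>2 + (norm (drift u v))\<^sup>2"
          using norm_cauchy_schwarz[of z "drift u v"] sum_squares_bound[of "norm z" "norm (drift u v)"] by linarith
        moreover have "h * (norm (drift u v))\<^sup>2 \<le> 1 * Q" using D h by (intro mult_mono) auto
        ultimately show ?thesis using D h by (intro add_mono mult_left_mono) auto
      qed
      finally have "(norm (z + h *\<^sub>R drift u v))\<^sup>2 + h * (norm (noise u v))\<^sup>2 \<le> (norm z)\<^sup>2 + h * (3 * Q + (norm z)\<^sup>2)"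
        using mult_left_mono[OF N less_imp_le[OF h(1)]] by (simp add: algebra_simps)
      also have "\<dots> \<le> (norm z)\<^sup>2 + h * (b * (norm z)\<^sup>2 + b * (norm z')\<^sup>2 + 2 * b * \<kappa>\<^sup>2)"
        using Q h by (intro add_left_mono mult_left_mono) auto
      finally show ?thesis by (simp add: algebra_simps)
    qed
    have int: "integrable P (\<lambda>\<omega>. (norm (?Z k \<omega>))\<^sup>2)" "integrable P (\<lambda>\<omega>. (norm (?Z ?d \<omega>))\<^sup>2)"
      using ZL by (auto simp: L2_def)
    have "w (Suc k) \<le> (\<integral>\<omega>. (1 + b * h) * (norm (?Z k \<omega>))\<^sup>2 + b * h * (norm (?Z ?d \<omega>))\<^sup>2 + 2 * b * h * \<kappa>\<^sup>2 \<partial>P)"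
      unfolding w_def power2_norm_eq_inner[of "?Z (Suc k) _"]
        scheme_step(1)[OF h(1) L2_zero \<eta>L, of k "mat 1", unfolded matrix_vector_mul_lid[of "?Z (Suc k) _"]]
    proof (rule integral_mono[OF scheme_step(2)[OF h(1) L2_zero \<eta>L]])
      show "integrable P (\<lambda>\<omega>. (1 + b * h) * (norm (?Z k \<omega>))\<^sup>2 + b * h * (norm (?Z ?d \<omega>))\<^sup>2 + 2 * b * h * \<kappa>\<^sup>2)"
        using int by simp
      show "step_energy (mat 1) h (?Z k \<omega>) (?Z k \<omega> + \<eta> k \<omega>) (?Z ?d \<omega> + \<eta> ?d \<omega>)
         \<le> (1 + b * h) * (norm (?Z k \<omega>))\<^sup>2 + b * h * (norm (?Z ?d \<omega>))\<^sup>2 + 2 * b * h * \<kappa>\<^sup>2" for \<omega>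
        using pt[OF refl sq refl sq] unfolding step_energy_def matrix_vector_mul_lid power2_norm_eq_inner .
    qed
    also have "\<dots> = (1 + b * h) * w k + b * h * w ?d + 2 * b * h * \<kappa>\<^sup>2"
      using int by (simp add: w_def prob_space)
    finally show ?thesis .
  qed
  \<comment> \<open>Adding \<open>\<kappa>\<^sup>2\<close> makes the recursion homogeneous, because
    the two coefficients times \<open>\<kappa>\<^sup>2\<close> produce exactly the forcing term 2 b
    h \<open>\<kappa>\<^sup>2\<close>.\<close>
  have "w k + \<kappa>\<^sup>2 \<le> \<kappa>\<^sup>2 * (1 + 2 * b * h) ^ k"
  proof (rule delay_comparison[where a = "1 + b * h" and b = "b * h" and q = q and n = k
        and v = "\<lambda>k. w k + \<kappa>\<^sup>2" and w = "\<lambda>k. \<kappa>\<^sup>2 * (1 + 2 * b * h) ^ k"])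
    show "w (Suc k) + \<kappa>\<^sup>2 \<le> (1 + b * h) * (w k + \<kappa>\<^sup>2) + b * h * (w (delay q k) + \<kappa>\<^sup>2)" for k
      using step[of k] by (simp add: algebra_simps)
    fix k
    have bh: "0 \<le> b * h" using b h by simp
    have "b * h * (1 + 2 * b * h) ^ delay q k \<le> b * h * (1 + 2 * b * h) ^ k"
      using bh by (intro mult_left_mono power_increasing delay_le) auto
    then have "(1 + b * h) * (1 + 2 * b * h) ^ k + b * h * (1 + 2 * b * h) ^ delay q k \<le> (1 + 2 * b * h) ^ Suc k"
      by (simp add: algebra_simps)
    from mult_left_mono[OF this, of "\<kappa>\<^sup>2"]
    show "(1 + b * h) * (\<kappa>\<^sup>2 * (1 + 2 * b * h) ^ k) + b * h * (\<kappa>\<^sup>2 * (1 + 2 * b * h) ^ delay q k) \<le> \<kappa>\<^sup>2 * (1 + 2 * b * h) ^ Suc k"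
      by (simp add: algebra_simps)
  qed (use b h in \<open>auto simp: w_def\<close>)
  also have "\<dots> \<le> \<kappa>\<^sup>2 * exp (2 * b * h) ^ k"
    using b h exp_ge_add_one_self[of "2 * b * h"] by (intro mult_left_mono power_mono) auto
  also have "exp (2 * b * h) ^ k = exp (2 * b * (real k * h))"
    by (simp add: exp_of_nat_mult[symmetric] mult_ac)
  finally show ?thesis unfolding w_def b_def by (smt (verit) zero_le_power2)
qed

text \<open>The accumulated defect that remains when the solution is inserted into the Euler
  recursion.\<close>

definition residual :: "real \<Rightarrow> nat \<Rightarrow> 'w \<Rightarrow> real ^ 'n" where
  "residual h k \<omega> = X (real k * h) \<omega> - X0 \<omega>
    - (\<Sum>i<k. h *\<^sub>R drift (X (real i * h) \<omega>) (X (real (delay q i) * h) \<omega>))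
    - stoch_sum (\<lambda>i. real i * h) (\<lambda>i \<omega>. noise (X (real i * h) \<omega>) (X (real (delay q i) * h) \<omega>)) k \<omega>"

lemma X_grid_measurable:
  assumes "0 < h" "i \<le> k"
  shows "X (real i * h) \<in> borel_measurable (F (real k * h))"
  using assms by (intro F_measurable_mono[OF _ _ X_adapted] grid_mono) auto

lemma residual_measurable:
  assumes h: "0 < h"
  shows "residual h k \<in> borel_measurable (F (real k * h))"
proof -
  have d: "X (real (delay q i) * h) \<in> borel_measurable (F (real k * h))" if "i \<le> k" for i k
    using delay_le[of q i] that by (intro X_grid_measurable h) auto
  have "X0 \<in> borel_measurable (F (real k * h))"
    by (rule F_measurable_mono[of 0]) (use X0 h in \<open>auto simp: L2_def\<close>)
  moreover have "stoch_sum (\<lambda>i. real i * h) (\<lambda>i \<omega>. noise (X (real i * h) \<omega>) (X (real (delay q i) * h) \<omega>)) k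
      \<in> borel_measurable (F (real k * h))"
  proof (rule stoch_sum_measurable[where K = k])
    show "(\<lambda>\<omega>. noise (X (real i * h) \<omega>) (X (real (delay q i) * h) \<omega>)) \<in> borel_measurable (F (real i * h))" for i
      by (intro coefficients_measurable X_grid_measurable d h order_refl)
  qed (use h in \<open>auto intro: mult_right_mono\<close>)
  ultimately show ?thesis
    unfolding residual_def
    by (intro borel_measurable_diff borel_measurable_sum borel_measurable_scaleR borel_measurable_const
        X_grid_measurable coefficients_measurable d h) auto
qed

text \<open>Subtracting the residual from X leaves a process that obeys the Euler recursion with
  coefficients still evaluated at X. By linearity its difference from the Euler scheme is the scheme
  started at 0 and perturbed by the residual. As long as the residual stays below \<kappa>,
  truncation does not change it.\<close>

lemma solution_decomposition:
  fixes h \<kappa> :: real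
  defines "\<eta> \<equiv> \<lambda>k \<omega>. if \<forall>j\<in>{..k}. norm (residual h j \<omega>) \<le> \<kappa> then residual h k \<omega> else 0"
  assumes small: "\<And>j. j \<le> K \<Longrightarrow> norm (residual h j \<omega>) \<le> \<kappa>"
    and init: "X 0 \<omega> = X0 \<omega>" and k: "k \<le> K"
  shows "X (real k * h) \<omega> = euler h k \<omega> + scheme h (\<lambda>_. 0) \<eta> k \<omega> + residual h k \<omega>"
  using k
proof (induction k rule: less_induct)
  case (less k)
  show ?case
  proof (cases k)
    case 0
    then show ?thesis using init by (simp add: residual_def)
  next
    case (Suc j)
    let ?f = "scheme h (\<lambda>_. 0) \<eta>"
    have r: "\<eta> i \<omega> = residual h i \<omega>" if "i \<le> j" for i
    proof -
      have "\<forall>j\<in>{..i}. norm (residual h j \<omega>) \<le> \<kappa>"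
        using that less.prems Suc by (intro ballI small) auto
      then show ?thesis by (simp add: \<eta>_def)
    qed
    have u: "?f i \<omega> + \<eta> i \<omega> = X (real i * h) \<omega> - euler h i \<omega>" if "i \<le> j" for i
      using less.IH[of i] r[OF that] that less.prems Suc by simp
    note uj = u[OF order_refl] u[OF delay_le]
    have "X (real (Suc j) * h) \<omega> - residual h (Suc j) \<omega> = X (real j * h) \<omega> - residual h j \<omega>
       + h *\<^sub>R drift (X (real j * h) \<omega>) (X (real (delay q j) * h) \<omega>)
       + (W (real (Suc j) * h) \<omega> - W (real j * h) \<omega>) *\<^sub>R noise (X (real j * h) \<omega>) (X (real (delay q j) * h) \<omega>)"
      by (simp add: residual_def)
    also have "X (real j * h) \<omega> - residual h j \<omega> = euler h j \<omega> + ?f j \<omega>"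
      using less.IH[of j] less.prems Suc by simp
    finally show ?thesis
      unfolding Suc scheme.simps(2) uj drift_diff[symmetric] noise_diff[symmetric]
      by (simp add: algebra_simps)
  qed
qed

end

section \<open>Convergence of the Euler scheme\<close>

context pantograph
begin

abbreviation G :: "real \<Rightarrow> 'w \<Rightarrow> real ^ 'n" where
  "G s \<omega> \<equiv> drift (X s \<omega>) (X (q * s) \<omega>)"
abbreviation H :: "real \<Rightarrow> 'w \<Rightarrow> real ^ 'n" where
  "H s \<omega> \<equiv> noise (X s \<omega>) (X (q * s) \<omega>)"

lemma delayed_continuous:
  assumes "continuous_on {0..} (\<lambda>t. X t \<omega>)"
  shows "continuous_on {0..} (\<lambda>s. X (q * s) \<omega>)"
proof (rule continuous_on_compose2[OF assms])
  show "(\<lambda>s. q * s) ` {0..} \<subseteq> {0..}" using q by auto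
qed (intro continuous_intros)

lemma coefficients_continuous:
  assumes "continuous_on {0..} (\<lambda>t. X t \<omega>)"
  shows "continuous_on {0..} (\<lambda>s. G s \<omega>)" "continuous_on {0..} (\<lambda>s. H s \<omega>)"
  unfolding drift_def noise_def using assms delayed_continuous[OF assms]
  by (intro continuous_on_add linear_continuous_on_compose[of _ _ "\<lambda>x. _ *v x"]; simp)+

lemma delayed_adapted: "0 \<le> s \<Longrightarrow> X (q * s) \<in> borel_measurable (F s)"
  using q by (intro F_measurable_mono[OF _ _ X_adapted]) (auto simp: mult_left_le_one_le)

text \<open>The delayed time q s differs from its grid time by at most 2 h: one h for the rounding
  of the index and q h for freezing s at the start of its cell. Hence the condition h < \<delta> /
  2.\<close>

lemma frozen_bound:
  assumes mod: "modulus_le (\<lambda>t. X t \<omega>) Tm \<delta> \<kappa>" and h: "0 < h" "h < \<delta> / 2"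
    and s: "real i * h \<le> s" "s \<le> real (Suc i) * h" "s \<le> Tm"
  shows "norm (G s \<omega> - drift (X (real i * h) \<omega>) (X (real (delay q i) * h) \<omega>)) \<le> lip * \<kappa>"
    and "norm (H s \<omega> - noise (X (real i * h) \<omega>) (X (real (delay q i) * h) \<omega>)) \<le> lip * \<kappa>"
proof -
  have ih: "0 \<le> real i * h" using h by simp
  have dh: "0 \<le> real (delay q i) * h" using h by simp
  have s0: "0 \<le> s" using ih s(1) by linarith
  have 1: "norm (X s \<omega> - X (real i * h) \<omega>) \<le> \<kappa>"
  proof (rule modulus_leD[OF mod])
    show "\<bar>s - real i * h\<bar> < \<delta>" using s h by (simp add: distrib_right)
  qed (use s ih s0 in auto)
  have "real (delay q i) * h \<le> q * real i * h" "(q * real i) * h \<le> (real (delay q i) + 1) * h"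
    using delay_bounds[OF q, of i] h by (auto intro!: mult_right_mono)
  moreover have "q * (real i * h) \<le> q * s" "q * s \<le> q * (real (Suc i) * h)"
    using s q by (auto intro!: mult_left_mono)
  moreover have "q * h \<le> h" using q h by (simp add: mult_left_le_one_le)
  ultimately have dist: "0 \<le> q * s - real (delay q i) * h" "q * s - real (delay q i) * h \<le> 2 * h"
    by (auto simp: algebra_simps)
  have qs: "0 \<le> q * s" "q * s \<le> s" using q s0 by (auto simp: mult_left_le_one_le)
  have 2: "norm (X (q * s) \<omega> - X (real (delay q i) * h) \<omega>) \<le> \<kappa>"
  proof (rule modulus_leD[OF mod])
    show "\<bar>q * s - real (delay q i) * h\<bar> < \<delta>" using dist h by linarith
  qed (use qs dist dh s in linarith)+
  show "norm (G s \<omega> - drift (X (real i * h) \<omega>) (X (real (delay q i) * h) \<omega>)) \<le> lip * \<kappa>"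
    "norm (H s \<omega> - noise (X (real i * h) \<omega>) (X (real (delay q i) * h) \<omega>)) \<le> lip * \<kappa>"
    using coefficients_diff_bound[OF 1 2] by auto
qed

lemma drift_sum_error:
  assumes cont: "continuous_on {0..} (\<lambda>t. X t \<omega>)"
    and mod: "modulus_le (\<lambda>t. X t \<omega>) Tm \<delta> \<kappa>" and h: "0 < h" "h < \<delta> / 2"
    and k: "real k * h \<le> Tm"
  shows "norm (integral {0..real k * h} (\<lambda>s. G s \<omega>)
      - (\<Sum>i<k. h *\<^sub>R drift (X (real i * h) \<omega>) (X (real (delay q i) * h) \<omega>))) \<le> real k * h * (lip * \<kappa>)"
  using k
proof (induction k)
  case (Suc k)
  let ?D = "\<lambda>i. drift (X (real i * h) \<omega>) (X (real (delay q i) * h) \<omega>)"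
  define a where "a = real k * h"
  define b where "b = real (Suc k) * h"
  have ab: "0 \<le> a" "a \<le> b" "b - a = h" using h by (auto simp: a_def b_def algebra_simps)
  have int: "(\<lambda>s. G s \<omega>) integrable_on {0..b}"
    by (intro integrable_continuous_real continuous_on_subset[OF coefficients_continuous(1)[OF cont]]) auto
  then have int': "(\<lambda>s. G s \<omega>) integrable_on {a..b}"
    by (rule integrable_on_subinterval) (use ab in auto)
  have split: "integral {0..b} (\<lambda>s. G s \<omega>) = integral {0..a} (\<lambda>s. G s \<omega>) + integral {a..b} (\<lambda>s. G s \<omega>)"
    using Henstock_Kurzweil_Integration.integral_combine[OF ab(1,2) int] by simp
  have last: "norm (integral {a..b} (\<lambda>s. G s \<omega>) - h *\<^sub>R ?D k) \<le> lip * \<kappa> * (b - a)"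
  proof -
    have "integral {a..b} (\<lambda>s. G s \<omega>) - h *\<^sub>R ?D k = integral {a..b} (\<lambda>s. G s \<omega> - ?D k)"
      using int' ab by (subst Henstock_Kurzweil_Integration.integral_diff) auto
    also have "norm \<dots> \<le> lip * \<kappa> * (b - a)"
    proof (rule integral_bound)
      show "continuous_on {a..b} (\<lambda>s. G s \<omega> - ?D k)"
        using ab by (intro continuous_intros continuous_on_subset[OF coefficients_continuous(1)[OF cont]]) auto
      show "norm (G s \<omega> - ?D k) \<le> lip * \<kappa>" if "s \<in> {a..b}" for s
        using that Suc.prems by (intro frozen_bound[OF mod h]) (auto simp: a_def b_def)
    qed (use ab in simp)
    finally show ?thesis .
  qed
  have "integral {0..b} (\<lambda>s. G s \<omega>) - (\<Sum>i<Suc k. h *\<^sub>R ?D i)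
      = (integral {0..a} (\<lambda>s. G s \<omega>) - (\<Sum>i<k. h *\<^sub>R ?D i)) + (integral {a..b} (\<lambda>s. G s \<omega>) - h *\<^sub>R ?D k)"
    by (simp add: split)
  also have "norm \<dots> \<le> real k * h * (lip * \<kappa>) + lip * \<kappa> * (b - a)"
    using Suc h last unfolding a_def[symmetric]
    by (intro order_trans[OF norm_triangle_ineq] add_mono) (auto simp: a_def algebra_simps)
  also have "\<dots> = real (Suc k) * h * (lip * \<kappa>)" using ab(3) by (simp add: algebra_simps)
  finally show ?case by (simp add: b_def)
qed simp

text \<open>Fixes one version of the noise integral for every grid time. Only countably many times
  occur, so their exceptional null sets can be united.\<close>

lemma solution_integral:
  assumes h: "0 < h"
  obtains I where
    "\<And>k. AE \<omega> in P. X (real k * h) \<omega> = X0 \<omega> + integral {0..real k * h} (\<lambda>s. G s \<omega>) + I k \<omega>"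
    "\<And>k. 0 < real k * h \<Longrightarrow> left_sum_limit (real k * h) H (I k)"
proof -
  have "\<forall>k. \<exists>I. ito_approximable (real k * h) H I \<and>
      (AE \<omega> in P. X (real k * h) \<omega> = X0 \<omega> + integral {0..real k * h} (\<lambda>s. G s \<omega>) + I \<omega>)"
  proof
    fix k
    have "0 \<le> real k * h" using h by simp
    from X_integral[OF this] show "\<exists>I. ito_approximable (real k * h) H I \<and>
      (AE \<omega> in P. X (real k * h) \<omega> = X0 \<omega> + integral {0..real k * h} (\<lambda>s. G s \<omega>) + I \<omega>)"
      unfolding drift_def noise_def .
  qed
  from choice[OF this] obtain I where I: "\<And>k. ito_approximable (real k * h) H (I k)"
    "\<And>k. AE \<omega> in P. X (real k * h) \<omega> = X0 \<omega> + integral {0..real k * h} (\<lambda>s. G s \<omega>) + I k \<omega>" by blast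
  have Hm: "H s \<in> borel_measurable (F s)" if "0 \<le> s" for s
    by (intro coefficients_measurable X_adapted delayed_adapted that)
  have Hc: "AE \<omega> in P. continuous_on {0..} (\<lambda>s. H s \<omega>)"
    using X_continuous by eventually_elim (auto intro: coefficients_continuous(2))
  show thesis
    by (rule that[OF I(2) ito_approximable_left_sum_limit[OF _ Hm Hc I(1)]])
qed

text \<open>An integrand that is constant on blocks of m fine cells telescopes to the coarse sum.
  This lets the Euler noise sum be compared with a fine left Riemann sum on one grid.\<close>

lemma stoch_sum_coarse:
  fixes \<zeta> :: "nat \<Rightarrow> 'w \<Rightarrow> real ^ 'n"
  assumes m: "0 < m"
  shows "stoch_sum (\<lambda>j. real j * (h / real m)) (\<lambda>j. \<zeta> (j div m)) (k * m) \<omega> = stoch_sum (\<lambda>i. real i * h) \<zeta> k \<omega>"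
proof (induction k)
  case (Suc k)
  let ?w = "\<lambda>j. W (real j * (h / real m)) \<omega>"
  have tele: "(\<Sum>j\<in>{k * m..<k * m + m}. (?w (Suc j) - ?w j) *\<^sub>R \<zeta> (j div m) \<omega>)
      = (W (real (Suc k) * h) \<omega> - W (real k * h) \<omega>) *\<^sub>R \<zeta> k \<omega>"
  proof -
    have "j div m = k" if "j \<in> {k * m..<k * m + m}" for j
      using that m by (intro div_nat_eqI) (auto simp: mult.commute)
    then have "(\<Sum>j\<in>{k * m..<k * m + m}. (?w (Suc j) - ?w j) *\<^sub>R \<zeta> (j div m) \<omega>)
        = (\<Sum>j\<in>{k * m..<k * m + m}. ?w (Suc j) - ?w j) *\<^sub>R \<zeta> k \<omega>"
      by (simp add: scaleR_sum_left)
    also have "(\<Sum>j\<in>{k * m..<k * m + m}. ?w (Suc j) - ?w j) = ?w (k * m + m) - ?w (k * m)"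
      by (rule sum_Suc_diff') simp
    also have "real (k * m + m) * (h / real m) = real (Suc k) * h" using m by (simp add: field_simps)
    also have "real (k * m) * (h / real m) = real k * h" using m by simp
    finally show ?thesis .
  qed
  have "(\<Sum>j<Suc k * m. f j) = (\<Sum>j<k * m. f j) + (\<Sum>j\<in>{k * m..<k * m + m}. f j)" for f :: "nat \<Rightarrow> real ^ 'n"
    using sum.atLeastLessThan_concat[of 0 "k * m" "k * m + m" f] by (simp add: lessThan_atLeast0 add.commute)
  then have "stoch_sum (\<lambda>j. real j * (h / real m)) (\<lambda>j. \<zeta> (j div m)) (Suc k * m) \<omega>
     = stoch_sum (\<lambda>j. real j * (h / real m)) (\<lambda>j. \<zeta> (j div m)) (k * m) \<omega>
      + (\<Sum>j\<in>{k * m..<k * m + m}. (?w (Suc j) - ?w j) *\<^sub>R \<zeta> (j div m) \<omega>)"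
    unfolding stoch_sum_def .
  then show ?case by (simp only: tele Suc stoch_sum_simps(2))
qed simp

text \<open>The residual splits into the Riemann error of the drift, the error of a fine left sum
  against the integral, and the difference of fine and coarse noise sums. The modulus of continuity
  controls the first; the second is made small at the finitely many grid times by refining; Lenglart
  on the fine grid controls the third uniformly. The fine grid may depend on h and K, but
  \<open>h0\<close> depends only on the modulus.\<close>

lemma residual_small:
  assumes e: "0 < e" and \<eta>: "0 < \<eta>" and Tm: "0 \<le> Tm"
  obtains h0 where "0 < h0" and "\<And>h K. 0 < h \<Longrightarrow> h < h0 \<Longrightarrow> real K * h \<le> Tm \<Longrightarrow>
    prob_le (\<lambda>\<omega>. \<exists>k\<le>K. e < norm (residual h k \<omega>)) \<eta>"
proof -
  \<comment> \<open>Lenglart at level e / 4 costs 16 d / e^2 = \<eta> / 4.\<close>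
  define d where "d = e\<^sup>2 * \<eta> / 64"
  have d: "0 < d" using e \<eta> by (simp add: d_def)
  \<comment> \<open>The first entry keeps the drift error below e / 4, the second the quadratic
    variation below \<open>d\<close>; Tm + 1 avoids division by zero.\<close>
  define \<kappa> where "\<kappa> = min (e / (4 * lip * (Tm + 1))) (sqrt (d / (Tm + 1)) / lip)"
  have \<kappa>: "0 < \<kappa>" using e Tm lip_pos d by (simp add: \<kappa>_def)
  have \<kappa>1: "Tm * (lip * \<kappa>) \<le> e / 4"
  proof -
    have "\<kappa> \<le> e / (4 * lip * (Tm + 1))" by (simp add: \<kappa>_def)
    then have "\<kappa> * (4 * lip * (Tm + 1)) \<le> e" using lip_pos Tm by (subst (asm) pos_le_divide_eq) auto
    then have "(Tm + 1) * (lip * \<kappa>) \<le> e / 4" by (simp add: algebra_simps)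
    moreover have "Tm * (lip * \<kappa>) \<le> (Tm + 1) * (lip * \<kappa>)" using lip_pos \<kappa> by (intro mult_right_mono) auto
    ultimately show ?thesis by linarith
  qed
  have \<kappa>2: "Tm * (lip * \<kappa>)\<^sup>2 \<le> d"
  proof -
    have "\<kappa> \<le> sqrt (d / (Tm + 1)) / lip" by (simp add: \<kappa>_def)
    then have "lip * \<kappa> \<le> sqrt (d / (Tm + 1))" using lip_pos by (simp add: field_simps)
    then have "(lip * \<kappa>)\<^sup>2 \<le> (sqrt (d / (Tm + 1)))\<^sup>2" using lip_pos \<kappa> by (intro power_mono) auto
    then have "(lip * \<kappa>)\<^sup>2 \<le> d / (Tm + 1)" using d Tm by simp
    then have "(Tm + 1) * (lip * \<kappa>)\<^sup>2 \<le> d" using Tm by (simp add: field_simps)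
    moreover have "Tm * (lip * \<kappa>)\<^sup>2 \<le> (Tm + 1) * (lip * \<kappa>)\<^sup>2" by (intro mult_right_mono) auto
    ultimately show ?thesis by linarith
  qed
  have \<eta>4: "0 < \<eta> / 4" using \<eta> by simp
  obtain \<delta> where \<delta>: "0 < \<delta>" "prob_le (\<lambda>\<omega>. \<not> modulus_le (\<lambda>s. X s \<omega>) Tm \<delta> \<kappa>) (\<eta> / 4)"
    using modulus_in_probability[OF F_measurable[OF _ X_adapted] X_continuous \<kappa> \<eta>4] by blast
  show thesis
  proof (rule that[of "\<delta> / 2"])
    fix h K assume h: "0 < h" "h < \<delta> / 2" and K: "real K * h \<le> Tm"
    obtain I where eq: "\<And>k. AE \<omega> in P. X (real k * h) \<omega> = X0 \<omega> + integral {0..real k * h} (\<lambda>s. G s \<omega>) + I k \<omega>"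
      and approx: "\<And>k. 0 < real k * h \<Longrightarrow> left_sum_limit (real k * h) H (I k)"
      using solution_integral[OF h(1)] by blast
    \<comment> \<open>The left-sum limit speaks of one end time at a time, so its error probability
      is shared among the K + 1 grid times.\<close>
    let ?\<eta>' = "\<eta> / 4 / real (Suc K)"
    have \<eta>': "0 < ?\<eta>'" using \<eta> by simp
    have "\<forall>k. \<exists>m0::nat. 0 < k \<longrightarrow> (\<forall>m\<ge>m0. prob_le (\<lambda>\<omega>. e / 4 <
      norm (stoch_sum (\<lambda>j. real j * (real k * h / real m)) (\<lambda>j. H (real j * (real k * h / real m))) m \<omega> - I k \<omega>)) ?\<eta>')"
    proof
      fix k :: nat
      show "\<exists>m0::nat. 0 < k \<longrightarrow> (\<forall>m\<ge>m0. prob_le (\<lambda>\<omega>. e / 4 <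
      norm (stoch_sum (\<lambda>j. real j * (real k * h / real m)) (\<lambda>j. H (real j * (real k * h / real m))) m \<omega> - I k \<omega>)) ?\<eta>')"
      proof (cases "0 < k")
        case True
        then have kh: "0 < real k * h" and e4: "0 < e / 4" using h e by simp_all
        from approx[OF kh] e4 \<eta>' show ?thesis unfolding left_sum_limit_def by blast
      qed simp
    qed
    from choice[OF this] obtain m0 :: "nat \<Rightarrow> nat" where m0: "\<And>k m. 0 < k \<Longrightarrow> m0 k \<le> m \<Longrightarrow> prob_le (\<lambda>\<omega>. e / 4 <
      norm (stoch_sum (\<lambda>j. real j * (real k * h / real m)) (\<lambda>j. H (real j * (real k * h / real m))) m \<omega> - I k \<omega>)) ?\<eta>'"
      by blast
    \<comment> \<open>One subdivision number for all grid times: at time k h the left sum uses k m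
      cells, so its mesh is h / m for every k, and k m is at least \<open>m0 k\<close> when k >
      0.\<close>
    define m where "m = Suc (\<Sum>k\<le>K. m0 k)"
    have m: "0 < m" by (simp add: m_def)
    have m0m: "m0 k \<le> m" if "k \<le> K" for k
      using that member_le_sum[of k "{..K}" m0] by (simp add: m_def)
    define \<mu> where "\<mu> = h / real m"
    define \<rho> where "\<rho> j = real j * \<mu>" for j
    have hm: "0 < \<mu>" using h m by (simp add: \<mu>_def)
    let ?fine = "\<lambda>k. stoch_sum \<rho> (\<lambda>j. H (\<rho> j)) (k * m)"
    let ?N = "\<lambda>i \<omega>. noise (X (real i * h) \<omega>) (X (real (delay q i) * h) \<omega>)"
    let ?coarse = "stoch_sum (\<lambda>i. real i * h) ?N"
    \<comment> \<open>Left sums are set up for positive end times. At k = 0 the residual is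
      \<open>X 0\<close> - \<open>X0\<close> and vanishes almost surely.\<close>
    have fine: "prob_le (\<lambda>\<omega>. 0 < k \<and> e / 4 < norm (?fine k \<omega> - I k \<omega>)) ?\<eta>'" if k: "k < Suc K" for k
    proof (cases "k = 0")
      case False
      have "m0 k \<le> k * m" using m0m[of k] k False by (metis less_Suc_eq_le mult_le_mono1 mult_1 One_nat_def Suc_leI neq0_conv order_trans)
      from m0[OF _ this] False have "prob_le (\<lambda>\<omega>. e / 4 <
        norm (stoch_sum (\<lambda>j. real j * (real k * h / real (k * m))) (\<lambda>j. H (real j * (real k * h / real (k * m)))) (k * m) \<omega> - I k \<omega>)) ?\<eta>'"
        by simp
      moreover have "real k * h / real (k * m) = h / real m" using False by simp
      ultimately show ?thesis using False unfolding \<rho>_def \<mu>_def by simp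
    qed (use \<eta>' in \<open>auto intro: prob_leI[of "{}"]\<close>)
    have fine_all: "prob_le (\<lambda>\<omega>. \<exists>k<Suc K. 0 < k \<and> e / 4 < norm (?fine k \<omega> - I k \<omega>)) (\<eta> / 4)"
    proof -
      have "prob_le (\<lambda>\<omega>. \<exists>k<Suc K. 0 < k \<and> e / 4 < norm (?fine k \<omega> - I k \<omega>)) (real (Suc K) * ?\<eta>')"
        by (rule prob_le_finite[OF _ less_imp_le[OF \<eta>']]) (rule fine)
      moreover have "real (Suc K) * ?\<eta>' = \<eta> / 4" by (simp del: of_nat_Suc)
      ultimately show ?thesis by (simp only:)
    qed
    define \<zeta> where "\<zeta> j \<omega> = H (\<rho> j) \<omega> - ?N (j div m) \<omega>" for j \<omega>
    have \<rho>0: "0 \<le> \<rho> j" for j unfolding \<rho>_def using hm by (intro mult_nonneg_nonneg) auto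
    have am: "real (a * m) * \<mu> = real a * h" for a using m by (simp add: \<mu>_def)
    have cell: "real (j div m) * h \<le> \<rho> j" "\<rho> j \<le> real (Suc (j div m)) * h" for j
    proof -
      have "real (j div m * m) \<le> real j" "real j \<le> real (Suc (j div m) * m)"
        using m by (simp_all only: of_nat_le_iff) (auto simp: dividend_less_div_times less_imp_le add.commute)
      then have "real (j div m * m) * \<mu> \<le> \<rho> j" "\<rho> j \<le> real (Suc (j div m) * m) * \<mu>"
        unfolding \<rho>_def using hm by (auto intro!: mult_right_mono)
      then show "real (j div m) * h \<le> \<rho> j" "\<rho> j \<le> real (Suc (j div m)) * h" by (simp_all only: am)
    qed
    have \<zeta>m: "\<zeta> j \<in> borel_measurable (F (\<rho> j))" for j
    proof -
      let ?i = "j div m"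
      have "X (real ?i * h) \<in> borel_measurable (F (\<rho> j))"
        using cell(1)[of j] h by (intro F_measurable_mono[OF _ _ X_adapted]) auto
      moreover have "real (delay q ?i) * h \<le> \<rho> j"
        using grid_mono[OF h(1) delay_le[of q ?i]] cell(1)[of j] by linarith
      then have "X (real (delay q ?i) * h) \<in> borel_measurable (F (\<rho> j))"
        using h by (intro F_measurable_mono[OF _ _ X_adapted]) auto
      ultimately show ?thesis unfolding \<zeta>_def
        by (intro borel_measurable_diff coefficients_measurable X_adapted delayed_adapted \<rho>0)
    qed
    have \<zeta>b: "(\<Sum>j<K * m. (\<rho> (Suc j) - \<rho> j) * (norm (\<zeta> j \<omega>))\<^sup>2) \<le> d" if mod: "modulus_le (\<lambda>s. X s \<omega>) Tm \<delta> \<kappa>" for \<omega>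
    proof -
      have "(\<Sum>j<K * m. (\<rho> (Suc j) - \<rho> j) * (norm (\<zeta> j \<omega>))\<^sup>2) \<le> (\<Sum>j<K * m. \<mu> * (lip * \<kappa>)\<^sup>2)"
      proof (rule sum_mono)
        fix j assume j: "j \<in> {..<K * m}"
        have "real j \<le> real (K * m)" using j by (simp only: of_nat_le_iff lessThan_iff less_imp_le)
        then have "real j * \<mu> \<le> real (K * m) * \<mu>" using hm by (intro mult_right_mono) auto
        then have "\<rho> j \<le> Tm" using K unfolding am by (simp add: \<rho>_def)
        then have "norm (\<zeta> j \<omega>) \<le> lip * \<kappa>" unfolding \<zeta>_def by (intro frozen_bound[OF mod h] cell)
        moreover have "\<rho> (Suc j) - \<rho> j = \<mu>" by (simp add: \<rho>_def algebra_simps)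
        ultimately show "(\<rho> (Suc j) - \<rho> j) * (norm (\<zeta> j \<omega>))\<^sup>2 \<le> \<mu> * (lip * \<kappa>)\<^sup>2"
          using hm by (simp only:) (intro mult_left_mono power_mono; simp)
      qed
      also have "\<dots> = real K * h * (lip * \<kappa>)\<^sup>2" using am[of 1] by (simp add: mult.assoc[symmetric])
      also have "\<dots> \<le> Tm * (lip * \<kappa>)\<^sup>2" using K by (intro mult_right_mono) auto
      also have "\<dots> \<le> d" by (rule \<kappa>2)
      finally show ?thesis .
    qed
    have "prob_le (\<lambda>\<omega>. \<exists>j\<le>K * m. e / 4 < norm (stoch_sum \<rho> \<zeta> j \<omega>)) (d / (e / 4)\<^sup>2 + \<eta> / 4)"
    proof (rule lenglart)
      show "\<rho> j < \<rho> (Suc j)" for j using hm by (simp add: \<rho>_def distrib_right)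
      show "prob_le (\<lambda>\<omega>. d < (\<Sum>k<K * m. (\<rho> (Suc k) - \<rho> k) * (norm (\<zeta> k \<omega>))\<^sup>2)) (\<eta> / 4)"
        by (rule prob_le_mono[OF \<delta>(2) order_refl]) (use \<zeta>b in \<open>auto simp: not_less[symmetric]\<close>)
    qed (use \<rho>0 \<zeta>m e d in auto)
    moreover have "d / (e / 4)\<^sup>2 + \<eta> / 4 = \<eta> / 2" using e by (simp add: d_def power_divide)
    ultimately have coarse: "prob_le (\<lambda>\<omega>. \<exists>j\<le>K * m. e / 4 < norm (stoch_sum \<rho> \<zeta> j \<omega>)) (\<eta> / 2)" by simp
    have sum_\<zeta>: "stoch_sum \<rho> \<zeta> (k * m) \<omega> = ?fine k \<omega> - ?coarse k \<omega>" for k \<omega>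
      unfolding \<zeta>_def[abs_def] stoch_sum_diff
      using stoch_sum_coarse[OF m, of h ?N k \<omega>] by (simp only: \<rho>_def[abs_def] \<mu>_def)
    have ae: "AE \<omega> in P. continuous_on {0..} (\<lambda>t. X t \<omega>) \<and> X 0 \<omega> = X0 \<omega> \<and>
      (\<forall>k. X (real k * h) \<omega> = X0 \<omega> + integral {0..real k * h} (\<lambda>s. G s \<omega>) + I k \<omega>)"
    proof -
      have "AE \<omega> in P. \<forall>k. X (real k * h) \<omega> = X0 \<omega> + integral {0..real k * h} (\<lambda>s. G s \<omega>) + I k \<omega>"
        using eq by (simp add: AE_all_countable)
      with X_continuous X_initial show ?thesis by eventually_elim simp
    qed
    \<comment> \<open>Off this event the three parts of the residual are each at most e / 4; the
      exceptional probabilities add up to \<eta>.\<close>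
    define bad where "bad \<omega> \<longleftrightarrow> ((\<not> modulus_le (\<lambda>s. X s \<omega>) Tm \<delta> \<kappa> \<or> (\<exists>k<Suc K. 0 < k \<and> e / 4 < norm (?fine k \<omega> - I k \<omega>)))
        \<or> (\<exists>j\<le>K * m. e / 4 < norm (stoch_sum \<rho> \<zeta> j \<omega>))) \<or>
        \<not> (continuous_on {0..} (\<lambda>t. X t \<omega>) \<and> X 0 \<omega> = X0 \<omega> \<and>
          (\<forall>k. X (real k * h) \<omega> = X0 \<omega> + integral {0..real k * h} (\<lambda>s. G s \<omega>) + I k \<omega>))" for \<omega>
    have "prob_le bad (\<eta> / 4 + \<eta> / 4 + \<eta> / 2 + 0)"
      unfolding bad_def using ae by (intro prob_le_disj \<delta>(2) fine_all coarse prob_le_AE) simp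
    then show "prob_le (\<lambda>\<omega>. \<exists>k\<le>K. e < norm (residual h k \<omega>)) \<eta>"
    proof (rule prob_le_mono)
      fix \<omega> assume "\<exists>k\<le>K. e < norm (residual h k \<omega>)"
      then obtain k where k: "k \<le> K" "e < norm (residual h k \<omega>)" by blast
      show "bad \<omega>"
      proof (rule ccontr)
        assume neg: "\<not> bad \<omega>"
        then have mod: "modulus_le (\<lambda>s. X s \<omega>) Tm \<delta> \<kappa>" and cont: "continuous_on {0..} (\<lambda>t. X t \<omega>)"
          and init: "X 0 \<omega> = X0 \<omega>"
          and eqk: "X (real k * h) \<omega> = X0 \<omega> + integral {0..real k * h} (\<lambda>s. G s \<omega>) + I k \<omega>"
          and f: "0 < k \<Longrightarrow> norm (?fine k \<omega> - I k \<omega>) \<le> e / 4"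
          using k(1) by (auto simp: bad_def not_less less_Suc_eq_le)
        have "k * m \<le> K * m" using k(1) by simp
        then have z: "norm (stoch_sum \<rho> \<zeta> (k * m) \<omega>) \<le> e / 4" using neg by (auto simp: bad_def not_less)
        show False
        proof (cases "k = 0")
          case True
          then show False using k(2) init e by (simp add: residual_def)
        next
          case False
          have kT: "real k * h \<le> Tm" using grid_mono[OF h(1) k(1)] K by linarith
          let ?J = "integral {0..real k * h} (\<lambda>s. G s \<omega>) - (\<Sum>i<k. h *\<^sub>R drift (X (real i * h) \<omega>) (X (real (delay q i) * h) \<omega>))"
          have "norm ?J \<le> real k * h * (lip * \<kappa>)" by (rule drift_sum_error[OF cont mod h kT])
          also have "\<dots> \<le> Tm * (lip * \<kappa>)" using kT lip_pos \<kappa> by (intro mult_right_mono) auto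
          finally have J: "norm ?J \<le> e / 4" using \<kappa>1 by linarith
          have "residual h k \<omega> = ?J - (?fine k \<omega> - I k \<omega>) + stoch_sum \<rho> \<zeta> (k * m) \<omega>"
            unfolding residual_def eqk sum_\<zeta> by simp
          then have "norm (residual h k \<omega>) \<le> norm ?J + norm (?fine k \<omega> - I k \<omega>) + norm (stoch_sum \<rho> \<zeta> (k * m) \<omega>)"
            using norm_triangle_ineq[of "?J - (?fine k \<omega> - I k \<omega>)" "stoch_sum \<rho> \<zeta> (k * m) \<omega>"]
              norm_triangle_ineq4[of ?J "?fine k \<omega> - I k \<omega>"] by simp
          then show False using J f False z k(2) e by simp
        qed
      qed
    qed (use \<eta> in simp)
  qed (use \<delta> in simp)
qed

text \<open>The difference is a scheme with perturbation truncated at \<kappa> plus the residual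
  itself. The first is small by its second moment and Chebyshev, the second by
  \<open>residual_small\<close>.\<close>

lemma euler_converges:
  assumes e: "0 < e" and \<eta>: "0 < \<eta>" and Tm: "0 \<le> Tm"
  obtains h0 where "0 < h0" and "\<And>h k. 0 < h \<Longrightarrow> h < h0 \<Longrightarrow> real k * h \<le> Tm \<Longrightarrow>
    prob_le (\<lambda>\<omega>. e < norm (X (real k * h) \<omega> - euler h k \<omega>)) \<eta>"
proof -
  define c where "c = exp (2 * (1 + 12 * lip\<^sup>2) * Tm)"
  have c: "0 < c" by (simp add: c_def)
  \<comment> \<open>The first entry bounds the residual itself; the second makes the second moment
    \<open>\<kappa>\<^sup>2 * c\<close> small enough for Chebyshev at level e / 2 to give \<eta> /
    2.\<close>
  define \<kappa> where "\<kappa> = min (e / 2) (e / 2 * sqrt (\<eta> / (2 * c)))"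
  have \<kappa>: "0 < \<kappa>" "\<kappa> \<le> e / 2" using e \<eta> c by (auto simp: \<kappa>_def)
  have "\<kappa>\<^sup>2 \<le> (e / 2 * sqrt (\<eta> / (2 * c)))\<^sup>2" using \<kappa> by (intro power_mono) (auto simp: \<kappa>_def)
  also have "\<dots> = (e / 2)\<^sup>2 * (\<eta> / (2 * c))" unfolding power_mult_distrib using \<eta> c by simp
  finally have \<kappa>2: "\<kappa>\<^sup>2 * c \<le> (e / 2)\<^sup>2 * (\<eta> / 2)" using c by (simp add: field_simps)
  have \<eta>2: "0 < \<eta> / 2" using \<eta> by simp
  obtain h0 where h0: "0 < h0" and res: "\<And>h K. 0 < h \<Longrightarrow> h < h0 \<Longrightarrow> real K * h \<le> Tm \<Longrightarrow>
    prob_le (\<lambda>\<omega>. \<exists>k\<le>K. \<kappa> < norm (residual h k \<omega>)) (\<eta> / 2)"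
    using residual_small[OF \<kappa>(1) \<eta>2 Tm] by blast
  show thesis
  proof (rule that[of "min h0 1"])
    fix h k assume h: "0 < h" "h < min h0 1" and k: "real k * h \<le> Tm"
    define \<eta>' where "\<eta>' k \<omega> = (if \<forall>j\<in>{..k}. norm (residual h j \<omega>) \<le> \<kappa> then residual h k \<omega> else 0)" for k \<omega>
    have m: "residual h j \<in> borel_measurable (F (real k * h))" if "j \<le> k" for j k
      using h that by (intro F_measurable_mono[OF _ _ residual_measurable] grid_mono) auto
    have \<eta>'m: "\<eta>' k \<in> borel_measurable (F (real k * h))" for k
    proof -
      have "Measurable.pred (F (real k * h)) (\<lambda>\<omega>. \<forall>j\<in>{..k}. norm (residual h j \<omega>) \<le> \<kappa>)"
        by (intro pred_intros_finite)
          (auto simp: pred_def intro!: borel_measurable_le measurable_compose[OF m borel_measurable_norm])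
      then show ?thesis unfolding \<eta>'_def
        by (intro measurable_If m order_refl) (auto simp: pred_def)
    qed
    have \<eta>'b: "norm (\<eta>' k \<omega>) \<le> \<kappa>" for k \<omega> using \<kappa>(1) by (auto simp: \<eta>'_def)
    let ?f = "scheme h (\<lambda>_. 0) \<eta>' k"
    have "(\<integral>\<omega>. (norm (?f \<omega>))\<^sup>2 \<partial>P) \<le> \<kappa>\<^sup>2 * exp (2 * (1 + 12 * lip\<^sup>2) * (real k * h))"
      using h by (intro scheme_perturbation_bound \<eta>'m \<eta>'b less_imp_le[OF \<kappa>(1)]) auto
    also have "\<dots> \<le> \<kappa>\<^sup>2 * c"
      unfolding c_def using k by (intro mult_left_mono) (auto intro!: mult_left_mono)
    finally have second: "(\<integral>\<omega>. (norm (?f \<omega>))\<^sup>2 \<partial>P) \<le> (e / 2)\<^sup>2 * (\<eta> / 2)" using \<kappa>2 by linarith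
    have L: "L2 (real k * h) ?f"
    proof (rule scheme_L2[OF h(1) L2_zero])
      show "L2 (real i * h) (\<eta>' i)" for i
        using h \<eta>'m[of i] \<eta>'b power_mono[OF \<eta>'b norm_ge_zero, of i _ 2]
        by (intro L2_dominated[where g = "\<lambda>_. \<kappa>\<^sup>2"]) auto
    qed
    have fm: "?f \<in> borel_measurable P" by (rule F_measurable[of "real k * h"]) (use L h in \<open>auto simp: L2_def\<close>)
    have "prob_le (\<lambda>\<omega>. e / 2 < norm (?f \<omega>)) ((e / 2)\<^sup>2 * (\<eta> / 2) / (e / 2)\<^sup>2)"
      using fm L second e by (intro prob_le_second_moment) (auto simp: L2_def)
    then have f: "prob_le (\<lambda>\<omega>. e / 2 < norm (?f \<omega>)) (\<eta> / 2)" using e by simp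
    have "prob_le (\<lambda>\<omega>. \<exists>j\<le>k. \<kappa> < norm (residual h j \<omega>)) (\<eta> / 2)" using h k by (intro res) auto
    moreover have "prob_le (\<lambda>\<omega>. X 0 \<omega> \<noteq> X0 \<omega>) 0" using X_initial by (intro prob_le_AE) simp
    ultimately have "prob_le (\<lambda>\<omega>. (e / 2 < norm (?f \<omega>) \<or> (\<exists>j\<le>k. \<kappa> < norm (residual h j \<omega>))) \<or> X 0 \<omega> \<noteq> X0 \<omega>) (\<eta> / 2 + \<eta> / 2 + 0)"
      using f by (intro prob_le_disj)
    then show "prob_le (\<lambda>\<omega>. e < norm (X (real k * h) \<omega> - euler h k \<omega>)) \<eta>"
    proof (rule prob_le_mono)
      fix \<omega> assume gt: "e < norm (X (real k * h) \<omega> - euler h k \<omega>)"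
      show "(e / 2 < norm (?f \<omega>) \<or> (\<exists>j\<le>k. \<kappa> < norm (residual h j \<omega>))) \<or> X 0 \<omega> \<noteq> X0 \<omega>"
      proof (rule ccontr)
        assume neg: "\<not> ?thesis"
        then have small: "\<And>j. j \<le> k \<Longrightarrow> norm (residual h j \<omega>) \<le> \<kappa>" and init: "X 0 \<omega> = X0 \<omega>" and fs: "norm (?f \<omega>) \<le> e / 2"
          by (auto simp: not_less)
        have "X (real k * h) \<omega> = euler h k \<omega> + ?f \<omega> + residual h k \<omega>"
          unfolding \<eta>'_def[abs_def] by (rule solution_decomposition[OF small init order_refl])
        then have "norm (X (real k * h) \<omega> - euler h k \<omega>) \<le> norm (?f \<omega>) + norm (residual h k \<omega>)"
          by (simp add: norm_triangle_ineq)
        then show False using gt fs small[of k] \<kappa>(2) by simp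
      qed
    qed simp
  qed (use h0 in simp)
qed

end

section \<open>Mean-square and pathwise estimates\<close>

text \<open>Holds for exponents of either sign. It serves to replace all times of a unit block by
  one, at the price of a constant.\<close>

lemma powr_half_double:
  fixes x y \<alpha> :: real
  assumes "0 < x" "x \<le> 2 * y" "y \<le> 2 * x"
  shows "x powr \<alpha> \<le> 2 powr \<bar>\<alpha>\<bar> * y powr \<alpha>"
proof (cases "0 \<le> \<alpha>")
  case True
  then have "x powr \<alpha> \<le> (2 * y) powr \<alpha>" using assms by (intro powr_mono2) auto
  then show ?thesis using True assms by (simp add: powr_mult)
next
  case False
  then have "x powr \<alpha> \<le> (y / 2) powr \<alpha>" using assms by (intro powr_mono2') auto
  also have "\<dots> = 2 powr \<bar>\<alpha>\<bar> * y powr \<alpha>"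
    using False assms by (simp add: powr_divide powr_minus_divide[of 2 "\<alpha>"] powr_minus divide_simps)
  finally show ?thesis .
qed

text \<open>In the application \<open>l\<close> and \<open>u\<close> are the extreme eigenvalues of
  C, and \<open>a\<close> and \<open>b\<close> already contain the slack of
  \<open>lyapunov_step\<close>.\<close>

locale pantograph_lyapunov = pantograph P F W q A B S T X0 X
  for P :: "'w measure" and F :: "real \<Rightarrow> 'w measure" and W :: "real \<Rightarrow> 'w \<Rightarrow> real"
    and q :: real and A B S T :: "real ^ 'n ^ 'n"
    and X0 :: "'w \<Rightarrow> real ^ 'n" and X :: "real \<Rightarrow> 'w \<Rightarrow> real ^ 'n" +
  fixes C :: "real ^ 'n ^ 'n" and l u a b \<alpha> K h1 h2 :: real and \<phi> :: "real \<Rightarrow> real"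
  assumes form: "\<And>x. l * (norm x)\<^sup>2 \<le> x \<bullet> (C *v x)" "\<And>x. x \<bullet> (C *v x) \<le> u * (norm x)\<^sup>2"
    and l: "0 < l" and u: "0 < u" and b: "0 \<le> b" and h1: "0 < h1"
    and step: "\<And>h x y. 0 < h \<Longrightarrow> h < h1 \<Longrightarrow>
      (x + h *\<^sub>R (A *v x + B *v y)) \<bullet> (C *v (x + h *\<^sub>R (A *v x + B *v y)))
        + h * ((S *v x + T *v y) \<bullet> (C *v (S *v x + T *v y)))
      \<le> (1 + a * h) * (x \<bullet> (C *v x)) + b * h * (y \<bullet> (C *v y))"
    and super: "supersolution q a b \<alpha> \<phi> K h2"
begin

definition h0 :: real where "h0 = min h1 h2"
definition initial_ms :: real where "initial_ms = (\<integral>\<omega>. (norm (X0 \<omega>))\<^sup>2 \<partial>P)"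
definition ms_const :: real where "ms_const = u / l * K"

lemma h0_pos: "0 < h0"
  using h1 super by (simp add: h0_def supersolution_def)

lemma initial_ms_nonneg: "0 \<le> initial_ms"
  by (simp add: initial_ms_def)

lemma ms_const_pos: "0 < ms_const"
  using l u super by (simp add: ms_const_def supersolution_def)

lemma \<phi>_bounds:
  "0 \<le> t \<Longrightarrow> 0 < \<phi> t" "0 \<le> t \<Longrightarrow> \<phi> t \<le> K * (1 + t) powr \<alpha>"
  "0 < h \<Longrightarrow> h < h0 \<Longrightarrow> \<phi> (real (delay q k) * h) \<le> K * (1 + real k * h) powr \<alpha>"
  using super by (auto simp: supersolution_def h0_def)

lemma euler_L2: "0 < h \<Longrightarrow> L2 (real k * h) (euler h k)"
  by (rule scheme_L2) (auto intro: X0)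

lemma euler_form_integrable: "0 < h \<Longrightarrow> integrable P (\<lambda>\<omega>. euler h k \<omega> \<bullet> (C *v euler h k \<omega>))"
  using euler_L2[of h k] by (intro L2_integrable_inner[of "real k * h"] L2_matrix) auto

text \<open>The Lyapunov step, integrated, is the delayed recursion, and the supersolution starts at
  1; so it needs only the factor that dominates the initial energy.\<close>

lemma euler_energy:
  assumes h: "0 < h" "h < h0"
  shows "(\<integral>\<omega>. euler h k \<omega> \<bullet> (C *v euler h k \<omega>) \<partial>P) \<le> u * initial_ms * \<phi> (real k * h)"
proof -
  define v where "v k = (\<integral>\<omega>. euler h k \<omega> \<bullet> (C *v euler h k \<omega>) \<partial>P)" for k
  have "v k \<le> u * initial_ms * \<phi> (real k * h)"
  proof (rule delay_comparison[where a = "1 + a * h" and b = "b * h" and q = q and n = k and v = v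
        and w = "\<lambda>k. u * initial_ms * \<phi> (real k * h)"])
    show "0 \<le> 1 + a * h" using super h by (auto simp: supersolution_def h0_def)
    show "0 \<le> b * h" using b h by simp
    show "v (Suc k) \<le> (1 + a * h) * v k + b * h * v (delay q k)" for k
    proof -
      note i = euler_form_integrable[OF h(1)]
      have "v (Suc k) \<le> (\<integral>\<omega>. (1 + a * h) * (euler h k \<omega> \<bullet> (C *v euler h k \<omega>))
          + b * h * (euler h (delay q k) \<omega> \<bullet> (C *v euler h (delay q k) \<omega>)) \<partial>P)"
        unfolding v_def scheme_step(1)[OF h(1) X0 L2_zero]
      proof (rule integral_mono[OF scheme_step(2)[OF h(1) X0 L2_zero]])
        show "step_energy C h (euler h k \<omega>) (euler h k \<omega> + 0) (euler h (delay q k) \<omega> + 0)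
           \<le> (1 + a * h) * (euler h k \<omega> \<bullet> (C *v euler h k \<omega>))
            + b * h * (euler h (delay q k) \<omega> \<bullet> (C *v euler h (delay q k) \<omega>))" for \<omega>
          using step[of h "euler h k \<omega>" "euler h (delay q k) \<omega>"] h
          by (simp add: step_energy_def drift_def noise_def h0_def)
      qed (use i in simp)
      also have "\<dots> = (1 + a * h) * v k + b * h * v (delay q k)" using i by (simp add: v_def)
      finally show ?thesis .
    qed
    show "(1 + a * h) * (u * initial_ms * \<phi> (real k * h)) + b * h * (u * initial_ms * \<phi> (real (delay q k) * h))
        \<le> u * initial_ms * \<phi> (real (Suc k) * h)" for k
    proof -
      have "(1 + a * h) * \<phi> (real k * h) + b * h * \<phi> (real (delay q k) * h) \<le> \<phi> (real (Suc k) * h)"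
        using super h unfolding supersolution_def h0_def by simp
      from mult_left_mono[OF this, of "u * initial_ms"] show ?thesis
        using u initial_ms_nonneg by (simp add: algebra_simps)
    qed
    have "v 0 \<le> (\<integral>\<omega>. u * (norm (X0 \<omega>))\<^sup>2 \<partial>P)"
      unfolding v_def using X0 euler_form_integrable[OF h(1), of 0] form(2)
      by (intro integral_mono) (auto simp: L2_def)
    then show "v 0 \<le> u * initial_ms * \<phi> (real 0 * h)" using super by (simp add: initial_ms_def supersolution_def)
  qed simp
  then show ?thesis by (simp add: v_def)
qed

lemma euler_norm_energy:
  assumes h: "0 < h"
  shows "l * (\<integral>\<omega>. (norm (euler h k \<omega>))\<^sup>2 \<partial>P) \<le> (\<integral>\<omega>. euler h k \<omega> \<bullet> (C *v euler h k \<omega>) \<partial>P)"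
proof -
  have "(\<integral>\<omega>. l * (norm (euler h k \<omega>))\<^sup>2 \<partial>P) \<le> (\<integral>\<omega>. euler h k \<omega> \<bullet> (C *v euler h k \<omega>) \<partial>P)"
    using euler_L2[OF h, of k] euler_form_integrable[OF h, of k] form(1)
    by (intro integral_mono) (auto simp: L2_def)
  then show ?thesis by simp
qed

lemma euler_mean_square:
  assumes h: "0 < h" "h < h0"
  shows "(\<integral>\<omega>. (norm (euler h k \<omega>))\<^sup>2 \<partial>P) \<le> ms_const * initial_ms * (1 + real k * h) powr \<alpha>"
    and "(\<integral>\<omega>. (norm (euler h (delay q k) \<omega>))\<^sup>2 \<partial>P) \<le> ms_const * initial_ms * (1 + real k * h) powr \<alpha>"
proof -
  have *: "(\<integral>\<omega>. (norm (euler h j \<omega>))\<^sup>2 \<partial>P) \<le> ms_const * initial_ms * (1 + real k * h) powr \<alpha>"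
    if "\<phi> (real j * h) \<le> K * (1 + real k * h) powr \<alpha>" for j
  proof -
    have "l * (\<integral>\<omega>. (norm (euler h j \<omega>))\<^sup>2 \<partial>P) \<le> u * initial_ms * \<phi> (real j * h)"
      using euler_norm_energy[OF h(1), of j] euler_energy[OF h, of j] by linarith
    also have "\<dots> \<le> u * initial_ms * (K * (1 + real k * h) powr \<alpha>)"
      using that u initial_ms_nonneg by (intro mult_left_mono) auto
    finally show ?thesis using l by (simp add: ms_const_def field_simps)
  qed
  show "(\<integral>\<omega>. (norm (euler h k \<omega>))\<^sup>2 \<partial>P) \<le> ms_const * initial_ms * (1 + real k * h) powr \<alpha>"
    "(\<integral>\<omega>. (norm (euler h (delay q k) \<omega>))\<^sup>2 \<partial>P) \<le> ms_const * initial_ms * (1 + real k * h) powr \<alpha>"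
    using h by (intro * \<phi>_bounds; simp)+
qed

text \<open>Fatou's lemma asks for almost sure convergence. Step sizes are chosen that make t an
  exact grid time and for which deviations above 2^-n have outer probability at most 2^-n, so
  Borel-Cantelli applies.\<close>

lemma mean_square_bound:
  assumes t: "0 \<le> t"
  shows "(\<integral>\<^sup>+\<omega>. ennreal ((norm (X t \<omega>))\<^sup>2) \<partial>P) \<le> ennreal (ms_const * initial_ms * (1 + t) powr \<alpha>)"
proof -
  have "\<exists>h k. 0 < h \<and> h < h0 \<and> real k * h = t \<and>
      prob_le (\<lambda>\<omega>. (1 / 2) ^ n < norm (X t \<omega> - euler h k \<omega>)) ((1 / 2) ^ n)" for n :: nat
  proof -
    obtain h3 where h3: "0 < h3" and conv: "\<And>h k. 0 < h \<Longrightarrow> h < h3 \<Longrightarrow> real k * h \<le> t \<Longrightarrow>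
      prob_le (\<lambda>\<omega>. (1 / 2) ^ n < norm (X (real k * h) \<omega> - euler h k \<omega>)) ((1 / 2) ^ n)"
      using euler_converges[of "(1 / 2) ^ n" "(1 / 2) ^ n" t] t by auto
    define hm where "hm = min h0 h3"
    have hm: "0 < hm" "hm \<le> h0" "hm \<le> h3" using h0_pos h3 by (auto simp: hm_def)
    obtain h k where hk: "0 < h" "h < hm" "real k * h = t"
    proof (cases "t = 0")
      case True
      then show thesis using hm that[of "hm / 2" 0] by simp
    next
      case False
      obtain k :: nat where k: "t / hm < real k" using reals_Archimedean2 by blast
      have "0 < t / hm" using hm t False by simp
      then have k0: "0 < real k" using k by linarith
      have "t < real k * hm" using k hm by (simp add: pos_divide_less_eq)
      then have "t / real k < hm" using k0 by (simp add: pos_divide_less_eq mult.commute)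
      then show thesis using k0 t False by (intro that[of "t / real k" k]) auto
    qed
    then show ?thesis using conv[of h k] hm by (intro exI[of _ h] exI[of _ k]) auto
  qed
  then have "\<forall>n. \<exists>p. 0 < fst p \<and> fst p < h0 \<and> real (snd p) * fst p = t \<and>
      prob_le (\<lambda>\<omega>. (1 / 2) ^ n < norm (X t \<omega> - euler (fst p) (snd p) \<omega>)) ((1 / 2) ^ n)"
    by (simp add: split_paired_Ex)
  from choice[OF this] obtain p where p: "\<And>n. 0 < fst (p n) \<and> fst (p n) < h0 \<and> real (snd (p n)) * fst (p n) = t \<and>
      prob_le (\<lambda>\<omega>. (1 / 2) ^ n < norm (X t \<omega> - euler (fst (p n)) (snd (p n)) \<omega>)) ((1 / 2) ^ n)"
    by blast
  define h where "h n = fst (p n)" for n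
  define k where "k n = snd (p n)" for n
  have hk: "\<And>n. 0 < h n" "\<And>n. h n < h0" "\<And>n. real (k n) * h n = t"
    and close: "\<And>n. prob_le (\<lambda>\<omega>. (1 / 2) ^ n < norm (X t \<omega> - euler (h n) (k n) \<omega>)) ((1 / 2) ^ n)"
    using p by (simp_all add: h_def k_def)
  let ?Y = "\<lambda>n. euler (h n) (k n)"
  have Ym: "?Y n \<in> borel_measurable P" for n
    by (rule F_measurable[of "real (k n) * h n"])
      (use euler_L2[OF hk(1)[of n], of "k n"] hk(1)[of n] in \<open>auto simp: L2_def\<close>)
  have "AE \<omega> in P. eventually (\<lambda>n. \<not> (1 / 2) ^ n < norm (X t \<omega> - ?Y n \<omega>)) sequentially"
    by (rule prob_le_borel_cantelli[OF close]) (rule summable_geometric, simp)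
  then have lim: "AE \<omega> in P. (\<lambda>n. ?Y n \<omega>) \<longlonglongrightarrow> X t \<omega>"
  proof eventually_elim
    case (elim \<omega>)
    have "(\<lambda>n. ?Y n \<omega> - X t \<omega>) \<longlonglongrightarrow> 0"
    proof (rule Lim_null_comparison)
      show "eventually (\<lambda>n. norm (?Y n \<omega> - X t \<omega>) \<le> (1 / 2) ^ n) sequentially"
        using elim by eventually_elim (simp add: norm_minus_commute)
      show "(\<lambda>n. (1 / 2) ^ n :: real) \<longlonglongrightarrow> 0" by (rule LIMSEQ_realpow_zero) auto
    qed
    then show ?case by (rule LIM_zero_cancel)
  qed
  have "(\<integral>\<^sup>+\<omega>. ennreal ((norm (X t \<omega>))\<^sup>2) \<partial>P) = (\<integral>\<^sup>+\<omega>. liminf (\<lambda>n. ennreal ((norm (?Y n \<omega>))\<^sup>2)) \<partial>P)"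
  proof (rule nn_integral_cong_AE)
    show "AE \<omega> in P. ennreal ((norm (X t \<omega>))\<^sup>2) = liminf (\<lambda>n. ennreal ((norm (?Y n \<omega>))\<^sup>2))"
      using lim
    proof eventually_elim
      case (elim \<omega>)
      have "(\<lambda>n. ennreal ((norm (?Y n \<omega>))\<^sup>2)) \<longlonglongrightarrow> ennreal ((norm (X t \<omega>))\<^sup>2)"
        by (intro tendsto_ennrealI tendsto_power tendsto_norm elim)
      then show ?case by (intro lim_imp_Liminf[symmetric]) simp
    qed
  qed
  also have "\<dots> \<le> liminf (\<lambda>n. \<integral>\<^sup>+\<omega>. ennreal ((norm (?Y n \<omega>))\<^sup>2) \<partial>P)"
    using Ym by (intro nn_integral_liminf) auto
  also have "\<dots> \<le> limsup (\<lambda>n. \<integral>\<^sup>+\<omega>. ennreal ((norm (?Y n \<omega>))\<^sup>2) \<partial>P)"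
    by (intro Liminf_le_Limsup) simp
  also have "\<dots> \<le> ennreal (ms_const * initial_ms * (1 + t) powr \<alpha>)"
  proof (intro Limsup_bounded always_eventually allI)
    fix n
    have "integrable P (\<lambda>\<omega>. (norm (?Y n \<omega>))\<^sup>2)" using euler_L2[OF hk(1)[of n], of "k n"] by (simp add: L2_def)
    then have "(\<integral>\<^sup>+\<omega>. ennreal ((norm (?Y n \<omega>))\<^sup>2) \<partial>P) = ennreal (\<integral>\<omega>. (norm (?Y n \<omega>))\<^sup>2 \<partial>P)"
      by (intro nn_integral_eq_integral) auto
    also have "\<dots> \<le> ennreal (ms_const * initial_ms * (1 + t) powr \<alpha>)"
      using euler_mean_square(1)[OF hk(1,2), of n "k n"] hk(3)[of n] by (intro ennreal_leI) simp
    finally show "(\<integral>\<^sup>+\<omega>. ennreal ((norm (?Y n \<omega>))\<^sup>2) \<partial>P) \<le> ennreal (ms_const * initial_ms * (1 + t) powr \<alpha>)" .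
  qed
  finally show ?thesis .
qed

text \<open>A bound valid throughout the block [n, n+1]; the factor with 2 pays for replacing the
  time in the power by n.\<close>

definition block_ms :: "nat \<Rightarrow> real" where
  "block_ms n = ms_const * initial_ms * (2 powr \<bar>\<alpha>\<bar> * (1 + real n) powr \<alpha>)"

lemma euler_block_mean_square:
  assumes h: "0 < h" "h < h0" and k: "real n \<le> real k * h" "real k * h \<le> real n + 1"
  shows "(\<integral>\<omega>. (norm (euler h k \<omega>))\<^sup>2 \<partial>P) \<le> block_ms n" "(\<integral>\<omega>. (norm (euler h (delay q k) \<omega>))\<^sup>2 \<partial>P) \<le> block_ms n"
proof -
  have "(1 + real k * h) powr \<alpha> \<le> 2 powr \<bar>\<alpha>\<bar> * (1 + real n) powr \<alpha>"
    using k h by (intro powr_half_double) (auto intro: add_pos_nonneg)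
  then have "ms_const * initial_ms * (1 + real k * h) powr \<alpha> \<le> block_ms n"
    unfolding block_ms_def using ms_const_pos initial_ms_nonneg by (intro mult_left_mono) auto
  then show "(\<integral>\<omega>. (norm (euler h k \<omega>))\<^sup>2 \<partial>P) \<le> block_ms n" "(\<integral>\<omega>. (norm (euler h (delay q k) \<omega>))\<^sup>2 \<partial>P) \<le> block_ms n"
    using euler_mean_square[OF h, of k] by linarith+
qed

text \<open>The 1 stands for the starting value of a block, and drift and noise contribute 2
  \<open>lip\<^sup>2\<close> each.\<close>

definition block_const :: real where "block_const = 1 + 4 * lip\<^sup>2"

text \<open>On a block the scheme is its starting value plus a drift sum plus a stochastic sum; to
  exceed 3 r one of them must exceed r. Chebyshev handles the first two and Kolmogorov's inequality
  the third.\<close>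

lemma euler_block_maximal:
  assumes h: "0 < h" "h < h0" and k0: "real k0 * h = real n" and Kh: "real K' * h = 1" and r: "0 < r"
  shows "prob_le (\<lambda>\<omega>. \<exists>k\<le>K'. 3 * r < norm (euler h (k0 + k) \<omega>)) (block_const * block_ms n / r\<^sup>2)"
proof -
  let ?Y = "euler h"
  let ?D = "\<lambda>i \<omega>. drift (?Y (k0 + i) \<omega>) (?Y (delay q (k0 + i)) \<omega>)"
  let ?N = "\<lambda>i \<omega>. noise (?Y (k0 + i) \<omega>) (?Y (delay q (k0 + i)) \<omega>)"
  define p where "p i = real (k0 + i) * h" for i
  have p0: "0 \<le> p i" and pS: "p (Suc i) - p i = h" for i using h by (auto simp: p_def algebra_simps)
  have Yd: "L2 (p i) (?Y (delay q (k0 + i)))" for i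
    unfolding p_def by (rule scheme_delay_L2[OF h(1) X0 L2_zero])
  have Y: "L2 (p i) (?Y (k0 + i))" for i unfolding p_def by (rule euler_L2[OF h(1)])
  have DL: "L2 (p i) (?D i)" and NL: "L2 (p i) (?N i)" for i
    by (intro coefficients_L2 p0 Y Yd)+
  have ms: "(\<integral>\<omega>. (norm (?Y (k0 + i) \<omega>))\<^sup>2 \<partial>P) \<le> block_ms n" "(\<integral>\<omega>. (norm (?Y (delay q (k0 + i)) \<omega>))\<^sup>2 \<partial>P) \<le> block_ms n"
    if "i \<le> K'" for i
  proof -
    have "real i * h \<le> real K' * h" using that h by (intro mult_right_mono) auto
    then have "real n \<le> real (k0 + i) * h" "real (k0 + i) * h \<le> real n + 1"
      using k0 Kh h by (auto simp: distrib_right)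
    then show "(\<integral>\<omega>. (norm (?Y (k0 + i) \<omega>))\<^sup>2 \<partial>P) \<le> block_ms n" "(\<integral>\<omega>. (norm (?Y (delay q (k0 + i)) \<omega>))\<^sup>2 \<partial>P) \<le> block_ms n"
      using euler_block_mean_square[OF h, of n "k0 + i"] by blast+
  qed
  have coeff: "(\<integral>\<omega>. (norm (Z \<omega>))\<^sup>2 \<partial>P) \<le> 2 * lip\<^sup>2 * block_ms n"
    if Z: "L2 (p i) Z" and le: "\<And>\<omega>. norm (Z \<omega>) \<le> lip * max (norm (?Y (k0 + i) \<omega>)) (norm (?Y (delay q (k0 + i)) \<omega>))"
      and i: "i < K'" for i Z
  proof -
    have "(\<integral>\<omega>. (norm (Z \<omega>))\<^sup>2 \<partial>P) \<le> (\<integral>\<omega>. lip\<^sup>2 * ((norm (?Y (k0 + i) \<omega>))\<^sup>2 + (norm (?Y (delay q (k0 + i)) \<omega>))\<^sup>2) \<partial>P)"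
      using Z Y[of i] Yd[of i] by (intro integral_mono coefficient_square_bound le) (auto simp: L2_def)
    also have "\<dots> = lip\<^sup>2 * ((\<integral>\<omega>. (norm (?Y (k0 + i) \<omega>))\<^sup>2 \<partial>P) + (\<integral>\<omega>. (norm (?Y (delay q (k0 + i)) \<omega>))\<^sup>2 \<partial>P))"
      using Y[of i] Yd[of i] by (simp add: L2_def)
    also have "\<dots> \<le> lip\<^sup>2 * (block_ms n + block_ms n)" using ms[of i] i by (intro mult_left_mono add_mono) auto
    finally show ?thesis by simp
  qed
  have D2: "(\<integral>\<omega>. (norm (?D i \<omega>))\<^sup>2 \<partial>P) \<le> 2 * lip\<^sup>2 * block_ms n" if "i < K'" for i
    by (rule coeff[OF DL drift_bound that])
  have N2: "(\<integral>\<omega>. (norm (?N i \<omega>))\<^sup>2 \<partial>P) \<le> 2 * lip\<^sup>2 * block_ms n" if "i < K'" for i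
    by (rule coeff[OF NL noise_bound that])
  have decomp: "?Y (k0 + k) \<omega> = ?Y k0 \<omega> + (\<Sum>i<k. h *\<^sub>R ?D i \<omega>) + stoch_sum p ?N k \<omega>" for k \<omega>
    by (induction k) (simp_all add: scheme.simps(2) p_def algebra_simps)
  have start: "prob_le (\<lambda>\<omega>. r < norm (?Y k0 \<omega>)) (block_ms n / r\<^sup>2)"
  proof (rule prob_le_second_moment[OF _ _ _ r])
    have "?Y k0 \<in> borel_measurable P" by (rule F_measurable[OF p0[of 0]]) (use Y[of 0] in \<open>simp add: L2_def\<close>)
    then show "(\<lambda>\<omega>. norm (?Y k0 \<omega>)) \<in> borel_measurable P" by measurable
  qed (use Y[of 0] ms(1)[of 0] in \<open>auto simp: L2_def\<close>)
  define f where "f \<omega> = (\<Sum>i<K'. h * norm (?D i \<omega>))" for \<omega>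
  \<comment> \<open>Cauchy-Schwarz, with total block length K' h = 1.\<close>
  have f2: "(f \<omega>)\<^sup>2 \<le> (\<Sum>i<K'. h * (norm (?D i \<omega>))\<^sup>2)" for \<omega>
  proof -
    have "(f \<omega>)\<^sup>2 \<le> (\<Sum>i<K'. (h * norm (?D i \<omega>))\<^sup>2) * real K'"
      unfolding f_def using sum_squared_le_sum_of_squares[of "\<lambda>i. h * norm (?D i \<omega>)" "{..<K'}"] by simp
    also have "(\<Sum>i<K'. (h * norm (?D i \<omega>))\<^sup>2) = h * (\<Sum>i<K'. h * (norm (?D i \<omega>))\<^sup>2)"
      by (simp add: power_mult_distrib power2_eq_square[of h] sum_distrib_left mult.assoc)
    also have "\<dots> * real K' = (\<Sum>i<K'. h * (norm (?D i \<omega>))\<^sup>2) * (real K' * h)" by (simp only: mult_ac)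
    finally show ?thesis by (simp add: Kh)
  qed
  have fm: "f \<in> borel_measurable P"
  proof -
    have "?D i \<in> borel_measurable P" for i by (rule F_measurable[OF p0[of i]]) (use DL[of i] in \<open>simp add: L2_def\<close>)
    then show ?thesis unfolding f_def by measurable
  qed
  have Di: "integrable P (\<lambda>\<omega>. \<Sum>i<K'. h * (norm (?D i \<omega>))\<^sup>2)"
    using DL by (auto simp: L2_def)
  have drift: "prob_le (\<lambda>\<omega>. r < f \<omega>) (2 * lip\<^sup>2 * block_ms n / r\<^sup>2)"
  proof (rule prob_le_second_moment[OF fm _ _ r])
    show fi: "integrable P (\<lambda>\<omega>. (f \<omega>)\<^sup>2)"
      by (rule Bochner_Integration.integrable_bound[OF Di]) (use fm f2 in \<open>auto intro!: AE_I2 order_trans[OF f2 abs_ge_self]\<close>)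
    have "(\<integral>\<omega>. (f \<omega>)\<^sup>2 \<partial>P) \<le> (\<integral>\<omega>. (\<Sum>i<K'. h * (norm (?D i \<omega>))\<^sup>2) \<partial>P)"
      by (intro integral_mono fi Di f2)
    also have "\<dots> = (\<Sum>i<K'. h * (\<integral>\<omega>. (norm (?D i \<omega>))\<^sup>2 \<partial>P))"
      using DL by (subst Bochner_Integration.integral_sum) (auto simp: L2_def)
    also have "\<dots> \<le> (\<Sum>i<K'. h * (2 * lip\<^sup>2 * block_ms n))"
      using h by (intro sum_mono mult_left_mono D2) auto
    also have "\<dots> = (real K' * h) * (2 * lip\<^sup>2 * block_ms n)" by simp
    finally show "(\<integral>\<omega>. (f \<omega>)\<^sup>2 \<partial>P) \<le> 2 * lip\<^sup>2 * block_ms n" by (simp add: Kh)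
  qed
  have "(\<Sum>i<K'. (p (Suc i) - p i) * (\<integral>\<omega>. (norm (?N i \<omega>))\<^sup>2 \<partial>P)) \<le> (\<Sum>i<K'. h * (2 * lip\<^sup>2 * block_ms n))"
    unfolding pS using h by (intro sum_mono mult_left_mono N2) auto
  also have "\<dots> = (real K' * h) * (2 * lip\<^sup>2 * block_ms n)" by simp
  finally have Nsum: "(\<Sum>i<K'. (p (Suc i) - p i) * (\<integral>\<omega>. (norm (?N i \<omega>))\<^sup>2 \<partial>P)) / r\<^sup>2 \<le> 2 * lip\<^sup>2 * block_ms n / r\<^sup>2"
    by (intro divide_right_mono) (simp_all add: Kh)
  have "prob_le (\<lambda>\<omega>. \<exists>k\<le>K'. r < norm (stoch_sum p ?N k \<omega>))
      ((\<Sum>i<K'. (p (Suc i) - p i) * (\<integral>\<omega>. (norm (?N i \<omega>))\<^sup>2 \<partial>P)) / r\<^sup>2)"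
  proof (rule maximal_inequality)
    show "p i \<le> p (Suc i)" for i using pS[of i] h by linarith
  qed (use p0 NL r in simp_all)
  then have noise: "prob_le (\<lambda>\<omega>. \<exists>k\<le>K'. r < norm (stoch_sum p ?N k \<omega>)) (2 * lip\<^sup>2 * block_ms n / r\<^sup>2)"
    by (rule prob_le_mono) (rule Nsum)
  show ?thesis
  proof (rule prob_le_mono[OF prob_le_disj[OF prob_le_disj[OF start drift] noise]])
    show "block_ms n / r\<^sup>2 + 2 * lip\<^sup>2 * block_ms n / r\<^sup>2 + 2 * lip\<^sup>2 * block_ms n / r\<^sup>2 \<le> block_const * block_ms n / r\<^sup>2"
      by (simp add: block_const_def add_divide_distrib[symmetric] algebra_simps)
    fix \<omega> assume "\<exists>k\<le>K'. 3 * r < norm (?Y (k0 + k) \<omega>)"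
    then obtain k where k: "k \<le> K'" "3 * r < norm (?Y (k0 + k) \<omega>)" by blast
    have "norm (\<Sum>i<k. h *\<^sub>R ?D i \<omega>) \<le> (\<Sum>i<k. h * norm (?D i \<omega>))"
      using h by (intro order_trans[OF norm_sum]) simp
    also have "\<dots> \<le> f \<omega>" unfolding f_def using k h by (intro sum_mono2) auto
    finally have "norm (?Y (k0 + k) \<omega>) \<le> norm (?Y k0 \<omega>) + f \<omega> + norm (stoch_sum p ?N k \<omega>)"
      using norm_triangle_ineq[of "?Y k0 \<omega> + (\<Sum>i<k. h *\<^sub>R ?D i \<omega>)" "stoch_sum p ?N k \<omega>"]
        norm_triangle_ineq[of "?Y k0 \<omega>" "\<Sum>i<k. h *\<^sub>R ?D i \<omega>"] unfolding decomp[of k] by linarith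
    then have "r < norm (?Y k0 \<omega>) \<or> r < f \<omega> \<or> r < norm (stoch_sum p ?N k \<omega>)" using k(2) by linarith
    then show "(r < norm (?Y k0 \<omega>) \<or> r < f \<omega>) \<or> (\<exists>k\<le>K'. r < norm (stoch_sum p ?N k \<omega>))"
      using k(1) by blast
  qed
qed

text \<open>On a fixed dyadic grid of the block, X is close to an Euler scheme at finitely many
  points, which costs the fourth r. The bound does not depend on the grid, so it survives the
  increasing union over all dyadic grids, and path continuity extends it to all times.\<close>

lemma block_maximal:
  assumes r: "0 < r"
  shows "prob_le (\<lambda>\<omega>. \<exists>t\<in>{real n..real n + 1}. 4 * r < norm (X t \<omega>)) (block_const * block_ms n / r\<^sup>2)"
proof -
  define g where "g m j = real n + real j / 2 ^ m" for m j :: nat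
  define E where "E m = {\<omega>\<in>space P. \<exists>j\<le>2 ^ m. 4 * r < norm (X (g m j) \<omega>)}" for m :: nat
  have g0: "0 \<le> g m j" for m j by (simp add: g_def)
  have Em: "E m \<in> events" for m
  proof -
    have "X (g m j) \<in> borel_measurable P" for j
      by (rule F_measurable[OF g0[of m j] X_adapted[OF g0]])
    then have "{\<omega>\<in>space P. 4 * r < norm (X (g m j) \<omega>)} \<in> events" for j by measurable
    then have "(\<Union>j\<in>{..2 ^ m}. {\<omega>\<in>space P. 4 * r < norm (X (g m j) \<omega>)}) \<in> events" by (intro sets.finite_UN) auto
    also have "(\<Union>j\<in>{..2 ^ m}. {\<omega>\<in>space P. 4 * r < norm (X (g m j) \<omega>)}) = E m" by (auto simp: E_def)
    finally show ?thesis .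
  qed
  have Ep: "prob (E m) \<le> block_const * block_ms n / r\<^sup>2" for m
  \<comment> \<open>The extra \<eta> is the probability that scheme and solution differ by more than
    r at some of the 2^m + 1 grid points.\<close>
  proof (rule field_le_epsilon)
    fix \<eta> :: real assume \<eta>: "0 < \<eta>"
    let ?\<eta>' = "\<eta> / real (Suc (2 ^ m))"
    have \<eta>': "0 < ?\<eta>'" using \<eta> by (simp del: of_nat_Suc)
    obtain h3 where h3: "0 < h3" and conv: "\<And>h k. 0 < h \<Longrightarrow> h < h3 \<Longrightarrow> real k * h \<le> real n + 1 \<Longrightarrow>
      prob_le (\<lambda>\<omega>. r < norm (X (real k * h) \<omega> - euler h k \<omega>)) ?\<eta>'"
      using euler_converges[OF r \<eta>', of "real n + 1"] by auto
    have "(\<lambda>N. (1 / 2) ^ N :: real) \<longlonglongrightarrow> 0" by (rule LIMSEQ_realpow_zero) auto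
    then have "eventually (\<lambda>N. (1 / 2) ^ N < min h0 h3) sequentially"
      using h0_pos h3 by (intro order_tendstoD) auto
    then have "eventually (\<lambda>N. (1 / 2) ^ N < min h0 h3 \<and> m \<le> N) sequentially"
      using eventually_ge_at_top[of m] by eventually_elim simp
    then obtain N where N: "(1 / 2 :: real) ^ N < min h0 h3" "m \<le> N"
      by (auto simp: eventually_sequentially)
    define h :: real where "h = (1 / 2) ^ N"
    have h: "0 < h" "h < h0" "h < h3" using N by (auto simp: h_def)
    define k0 :: nat where "k0 = n * 2 ^ N"
    \<comment> \<open>Number of Euler steps per cell of the m-th dyadic grid; thus every grid point
      is also an Euler time.\<close>
    define s :: nat where "s = 2 ^ (N - m)"
    have N_split: "(2::real) ^ N = 2 ^ m * 2 ^ (N - m)" using N(2) by (simp add: power_add[symmetric])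
    have grid: "real (k0 + j * s) * h = g m j" for j
      by (simp add: k0_def s_def h_def g_def N_split field_simps power_divide)
    have le: "j * s \<le> 2 ^ N" if "j \<le> 2 ^ m" for j
    proof -
      have "j * s \<le> 2 ^ m * 2 ^ (N - m)" unfolding s_def using that by (intro mult_right_mono) auto
      also have "\<dots> = 2 ^ N" using N(2) by (simp add: power_add[symmetric])
      finally show ?thesis .
    qed
    have "prob_le (\<lambda>\<omega>. \<exists>k\<le>2 ^ N. 3 * r < norm (euler h (k0 + k) \<omega>)) (block_const * block_ms n / r\<^sup>2)"
      by (rule euler_block_maximal[OF h(1,2) _ _ r]) (simp_all add: k0_def h_def power_divide)
    moreover have "prob_le (\<lambda>\<omega>. \<exists>j<Suc (2 ^ m). r < norm (X (g m j) \<omega> - euler h (k0 + j * s) \<omega>)) (real (Suc (2 ^ m)) * ?\<eta>')"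
    proof (rule prob_le_finite)
      fix j :: nat assume "j < Suc (2 ^ m)"
      then have "real j \<le> real (2 ^ m)" by (simp only: of_nat_le_iff)
      then have "g m j \<le> real n + 1" by (simp add: g_def)
      then show "prob_le (\<lambda>\<omega>. r < norm (X (g m j) \<omega> - euler h (k0 + j * s) \<omega>)) ?\<eta>'"
        using conv[of h "k0 + j * s"] h unfolding grid by simp
    qed (use \<eta>' in simp)
    ultimately have "prob_le (\<lambda>\<omega>. (\<exists>k\<le>2 ^ N. 3 * r < norm (euler h (k0 + k) \<omega>)) \<or>
        (\<exists>j<Suc (2 ^ m). r < norm (X (g m j) \<omega> - euler h (k0 + j * s) \<omega>))) (block_const * block_ms n / r\<^sup>2 + real (Suc (2 ^ m)) * ?\<eta>')"
      by (rule prob_le_disj)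
    then have "prob_le (\<lambda>\<omega>. \<exists>j\<le>2 ^ m. 4 * r < norm (X (g m j) \<omega>)) (block_const * block_ms n / r\<^sup>2 + \<eta>)"
    proof (rule prob_le_mono)
      fix \<omega> assume "\<exists>j\<le>2 ^ m. 4 * r < norm (X (g m j) \<omega>)"
      then obtain j where j: "j \<le> 2 ^ m" "4 * r < norm (X (g m j) \<omega>)" by blast
      have "norm (X (g m j) \<omega>) \<le> norm (X (g m j) \<omega> - euler h (k0 + j * s) \<omega>) + norm (euler h (k0 + j * s) \<omega>)"
        using norm_triangle_sub[of "X (g m j) \<omega>" "euler h (k0 + j * s) \<omega>"] by linarith
      then have "r < norm (X (g m j) \<omega> - euler h (k0 + j * s) \<omega>) \<or> 3 * r < norm (euler h (k0 + j * s) \<omega>)"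
        using j(2) by linarith
      then show "(\<exists>k\<le>2 ^ N. 3 * r < norm (euler h (k0 + k) \<omega>)) \<or>
        (\<exists>j<Suc (2 ^ m). r < norm (X (g m j) \<omega> - euler h (k0 + j * s) \<omega>))"
        using j(1) le[OF j(1)] by (auto simp: less_Suc_eq_le)
    qed (simp del: of_nat_Suc)
    from prob_leD[OF this Em[of m, unfolded E_def]]
    show "prob (E m) \<le> block_const * block_ms n / r\<^sup>2 + \<eta>" unfolding E_def .
  qed
  have "incseq E"
  proof (rule incseq_SucI)
    fix m
    have g2: "g m j = g (Suc m) (2 * j)" for j by (simp add: g_def)
    show "E m \<subseteq> E (Suc m)"
    proof
      fix \<omega> assume "\<omega> \<in> E m"
      then obtain j where "\<omega> \<in> space P" "j \<le> 2 ^ m" "4 * r < norm (X (g m j) \<omega>)" by (auto simp: E_def)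
      then have "\<omega> \<in> space P \<and> 2 * j \<le> 2 ^ Suc m \<and> 4 * r < norm (X (g (Suc m) (2 * j)) \<omega>)"
        using g2[of j] by simp
      then show "\<omega> \<in> E (Suc m)" unfolding E_def by blast
    qed
  qed
  then have "(\<lambda>m. prob (E m)) \<longlonglongrightarrow> prob (\<Union>m. E m)"
    using Em by (intro finite_Lim_measure_incseq) auto
  then have "prob (\<Union>m. E m) \<le> block_const * block_ms n / r\<^sup>2"
    by (rule LIMSEQ_le_const2) (use Ep in auto)
  then have "prob_le (\<lambda>\<omega>. \<omega> \<in> (\<Union>m. E m)) (block_const * block_ms n / r\<^sup>2)"
    by (intro prob_leI[of "\<Union>m. E m"]) (use Em in auto)
  moreover have "prob_le (\<lambda>\<omega>. \<not> continuous_on {0..} (\<lambda>t. X t \<omega>)) 0"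
    using X_continuous by (intro prob_le_AE) simp
  ultimately have "prob_le (\<lambda>\<omega>. \<omega> \<in> (\<Union>m. E m) \<or> \<not> continuous_on {0..} (\<lambda>t. X t \<omega>)) (block_const * block_ms n / r\<^sup>2 + 0)"
    by (rule prob_le_disj)
  then show ?thesis
  proof (rule prob_le_mono)
    fix \<omega> assume w: "\<omega> \<in> space P" and "\<exists>t\<in>{real n..real n + 1}. 4 * r < norm (X t \<omega>)"
    then obtain t where t: "real n \<le> t" "t \<le> real n + 1" "4 * r < norm (X t \<omega>)" by auto
    show "\<omega> \<in> (\<Union>m. E m) \<or> \<not> continuous_on {0..} (\<lambda>t. X t \<omega>)"
    \<comment> \<open>Exceeding 4 r is an open condition, so on a continuous path it already holds
      at a dyadic point just below t.\<close>
    proof (rule disjCI)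
      assume "\<not> \<not> continuous_on {0..} (\<lambda>t. X t \<omega>)"
      then have c: "continuous_on {0..} (\<lambda>t. X t \<omega>)" by simp
      define j where "j m = nat \<lfloor>(t - real n) * 2 ^ m\<rfloor>" for m :: nat
      have jr: "real (j m) = real_of_int \<lfloor>(t - real n) * 2 ^ m\<rfloor>" for m
        unfolding j_def using t by (subst of_nat_nat) auto
      have jle: "j m \<le> 2 ^ m" for m
      proof -
        have "real (j m) \<le> (t - real n) * 2 ^ m" unfolding jr by (rule of_int_floor_le)
        also have "\<dots> \<le> 1 * 2 ^ m" using t by (intro mult_right_mono) auto
        finally have "real (j m) \<le> real (2 ^ m)" by simp
        then show ?thesis by (simp only: of_nat_le_iff)
      qed
      have "filterlim (\<lambda>m. 2 ^ m :: real) at_top sequentially"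
      proof (rule filterlim_at_top_mono[OF filterlim_real_sequentially])
        have "real m \<le> 2 ^ m" for m using of_nat_mono[OF less_imp_le[OF less_exp[of m]], where 'a = real] by simp
        then show "eventually (\<lambda>m. real m \<le> 2 ^ m) sequentially" by simp
      qed
      from floor_grid_tendsto[OF this, of "t - real n"]
      have "(\<lambda>m. real n + real (j m) / 2 ^ m) \<longlonglongrightarrow> real n + (t - real n)"
        unfolding jr by (intro tendsto_add tendsto_const)
      then have "(\<lambda>m. g m (j m)) \<longlonglongrightarrow> t" by (simp add: g_def)
      then have "(\<lambda>m. X (g m (j m)) \<omega>) \<longlonglongrightarrow> X t \<omega>"
        using continuous_on_tendsto_compose[OF c, of "\<lambda>m. g m (j m)" t sequentially] t g0 by auto
      from tendsto_norm[OF this] have "eventually (\<lambda>m. 4 * r < norm (X (g m (j m)) \<omega>)) sequentially"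
        using t(3) by (rule order_tendstoD)
      then obtain m where "4 * r < norm (X (g m (j m)) \<omega>)" by (auto simp: eventually_sequentially)
      then have "\<omega> \<in> E m" using w jle[of m] by (auto simp: E_def)
      then show "\<omega> \<in> (\<Union>m. E m)" by blast
    qed
  qed simp
qed

text \<open>Up to a constant, the probability of exceeding n^\<beta> on the n-th block is n^\<alpha>
  / n^(2 \<beta>) = n^(\<alpha>-\<alpha>'-1). This is summable since \<alpha> < \<alpha>'; hence the
  exponent (\<alpha>' + 1) / 2.\<close>

lemma almost_sure_bound:
  assumes \<alpha>': "\<alpha> < \<alpha>'"
  shows "AE \<omega> in P. Limsup at_top (\<lambda>t. elog (norm (X t \<omega>)) / ereal (ln t)) \<le> ereal (1 / 2 * (\<alpha>' + 1))"
proof -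
  define \<beta> where "\<beta> = 1 / 2 * (\<alpha>' + 1)"
  \<comment> \<open>Cancels the factor lost when the power at the left end of the block is replaced
    by that at t, so the final bound is exactly t^\<beta>.\<close>
  define c where "c = 2 powr - \<bar>\<beta>\<bar>"
  have c: "0 < c" by (simp add: c_def)
  define r where "r n = c * real (Suc n) powr \<beta> / 4" for n
  have r: "0 < r n" for n using c by (simp add: r_def)
  \<comment> \<open>One factor \<open>2 powr \<bar>\<alpha>\<bar>\<close> comes from
    \<open>block_ms\<close>, the other from replacing n + 2 by n + 1; the 16 undoes the division by
    4 in \<open>r\<close>.\<close>
  define R where "R = block_const * ms_const * initial_ms * 2 powr \<bar>\<alpha>\<bar> * 2 powr \<bar>\<alpha>\<bar> * 16 / c\<^sup>2"
  have block_const: "0 \<le> block_const" by (simp add: block_const_def)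
  have "prob_le (\<lambda>\<omega>. \<exists>t\<in>{real (Suc n)..real (Suc n) + 1}. 4 * r n < norm (X t \<omega>)) (R * real (Suc n) powr (\<alpha> - \<alpha>' - 1))" for n
  proof (rule prob_le_mono[OF block_maximal[OF r]])
    have "(1 + real (Suc n)) powr \<alpha> \<le> 2 powr \<bar>\<alpha>\<bar> * real (Suc n) powr \<alpha>"
      by (intro powr_half_double) auto
    then have "block_ms (Suc n) \<le> ms_const * initial_ms * (2 powr \<bar>\<alpha>\<bar> * (2 powr \<bar>\<alpha>\<bar> * real (Suc n) powr \<alpha>))"
      unfolding block_ms_def using ms_const_pos initial_ms_nonneg by (intro mult_left_mono) auto
    then have "block_const * block_ms (Suc n) / (r n)\<^sup>2 \<le> block_const * (ms_const * initial_ms * (2 powr \<bar>\<alpha>\<bar> * (2 powr \<bar>\<alpha>\<bar> * real (Suc n) powr \<alpha>))) / (r n)\<^sup>2"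
      using block_const by (intro divide_right_mono mult_left_mono) auto
    also have "\<dots> = R * (real (Suc n) powr \<alpha> / (real (Suc n) powr \<beta>)\<^sup>2)"
      by (simp add: R_def r_def power_divide power_mult_distrib del: of_nat_Suc)
    also have "(real (Suc n) powr \<beta>)\<^sup>2 = real (Suc n) powr (\<alpha>' + 1)"
      by (simp add: power2_eq_square powr_add[symmetric] \<beta>_def del: of_nat_Suc)
    also have "real (Suc n) powr \<alpha> / real (Suc n) powr (\<alpha>' + 1) = real (Suc n) powr (\<alpha> - \<alpha>' - 1)"
      by (simp add: powr_diff[symmetric] algebra_simps del: of_nat_Suc)
    finally show "block_const * block_ms (Suc n) / (r n)\<^sup>2 \<le> R * real (Suc n) powr (\<alpha> - \<alpha>' - 1)" .
  qed
  moreover have "summable (\<lambda>n. R * real (Suc n) powr (\<alpha> - \<alpha>' - 1))"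
  proof -
    have "summable (\<lambda>n. real n powr (\<alpha> - \<alpha>' - 1))" using \<alpha>' by (simp add: summable_real_powr_iff)
    then have "summable (\<lambda>n. real (Suc n) powr (\<alpha> - \<alpha>' - 1))" by (subst summable_Suc_iff)
    then show ?thesis by (rule summable_mult)
  qed
  ultimately have "AE \<omega> in P. eventually (\<lambda>n. \<not> (\<exists>t\<in>{real (Suc n)..real (Suc n) + 1}. 4 * r n < norm (X t \<omega>))) sequentially"
    by (rule prob_le_borel_cantelli)
  then show ?thesis
  proof eventually_elim
    case (elim \<omega>)
    then obtain N where N': "\<And>n. N \<le> n \<Longrightarrow> \<not> (\<exists>t\<in>{real (Suc n)..real (Suc n) + 1}. 4 * r n < norm (X t \<omega>))"
      unfolding eventually_sequentially by blast
    have N: "norm (X t \<omega>) \<le> 4 * r n" if "N \<le> n" "t \<in> {real (Suc n)..real (Suc n) + 1}" for n t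
      using N'[OF that(1)] that(2) by (meson not_less)
    have "eventually (\<lambda>t. elog (norm (X t \<omega>)) / ereal (ln t) \<le> ereal \<beta>) at_top"
      using eventually_ge_at_top[of "real N + 2"]
    proof eventually_elim
      case (elim t)
      define n where "n = nat \<lfloor>t\<rfloor> - 1"
      have fl: "2 \<le> \<lfloor>t\<rfloor>" "int N + 2 \<le> \<lfloor>t\<rfloor>" using elim by (auto simp: le_floor_iff)
      have "int (Suc n) = \<lfloor>t\<rfloor>" using fl by (simp add: n_def)
      then have n: "real (Suc n) \<le> t" "t \<le> real (Suc n) + 1" "N \<le> n"
        using fl floor_correct[of t] by (auto simp: n_def) linarith+
      have t: "1 < t" using elim by simp
      have le: "norm (X t \<omega>) \<le> t powr \<beta>"
      proof -
        have "real (Suc n) powr \<beta> \<le> 2 powr \<bar>\<beta>\<bar> * t powr \<beta>"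
          using n t by (intro powr_half_double) auto
        then have "c * real (Suc n) powr \<beta> \<le> c * (2 powr \<bar>\<beta>\<bar> * t powr \<beta>)" using c by (intro mult_left_mono) auto
        also have "\<dots> = t powr \<beta>" by (simp add: c_def mult.assoc[symmetric] powr_add[symmetric])
        finally show ?thesis using N[OF n(3), of t] n by (simp add: r_def)
      qed
      have lt: "0 < ln t" using t by simp
      show ?case
      proof (cases "norm (X t \<omega>) = 0")
        case True
        then show ?thesis using lt by (simp add: elog_def)
      next
        case False
        then have "ln (norm (X t \<omega>)) \<le> ln (t powr \<beta>)" using le t by (subst ln_le_cancel_iff) auto
        also have "\<dots> = \<beta> * ln t" using t by (simp add: ln_powr)
        finally show ?thesis using False lt by (simp add: elog_def divide_le_eq)
      qed
    qed
    then show ?case unfolding \<beta>_def[symmetric] by (rule Limsup_bounded)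
  qed
qed

end

section \<open>The completed Brownian filtration\<close>

locale brownian_initial = prob_space M for M :: "'w measure" +
  fixes W :: "real \<Rightarrow> 'w \<Rightarrow> real" and X0 :: "'w \<Rightarrow> 'b::{second_countable_topology, t2_space}"
  assumes bm: "brownian_motion M W" and X0_measurable: "X0 \<in> borel_measurable M"
    and X0_indep: "indep_of_process M X0 W"
begin

abbreviation "P \<equiv> completion M"
abbreviation "F \<equiv> completed_filtration M X0 W"

lemma W_measurable: "0 \<le> t \<Longrightarrow> W t \<in> borel_measurable M"
  and W_0: "AE \<omega> in M. W 0 \<omega> = 0"
  and W_normal: "0 \<le> s \<Longrightarrow> s < t \<Longrightarrow>
    distributed M lborel (\<lambda>\<omega>. W t \<omega> - W s \<omega>) (\<lambda>x. ennreal (normal_density 0 (sqrt (t - s)) x))"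
  using bm by (simp_all add: brownian_motion_def)

lemma W_indep:
  assumes "0 \<le> \<tau> 0" "mono \<tau>"
  shows "indep_vars (\<lambda>_. borel) (\<lambda>i \<omega>. W (\<tau> (Suc i)) \<omega> - W (\<tau> i) \<omega>) {..<n}"
  using bm assms by (simp add: brownian_motion_def)

section \<open>Independence of increments from the raw past\<close>

definition cylinder :: "real set \<Rightarrow> (real \<Rightarrow> real set) \<Rightarrow> 'w set" where
  "cylinder J S = {\<omega>\<in>space M. \<forall>u\<in>J. W u \<omega> \<in> S u}"

definition increment_in :: "real \<Rightarrow> real \<Rightarrow> real set \<Rightarrow> 'w set" where
  "increment_in s t B = {\<omega>\<in>space M. W t \<omega> - W s \<omega> \<in> B}"

lemma cylinder_sets:
  assumes "finite J" "J \<subseteq> {0..}" "\<And>u. u \<in> J \<Longrightarrow> S u \<in> sets borel"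
  shows "cylinder J S \<in> events"
proof -
  have "{\<omega>\<in>space M. W u \<omega> \<in> S u} \<in> events" if "u \<in> J" for u
    using measurable_sets[OF W_measurable[of u] assms(3)[OF that]] that assms(2)
    by (auto simp: vimage_def Int_def conj_commute)
  then show ?thesis unfolding cylinder_def using assms(1) by (intro sets.sets_Collect_finite_All) auto
qed

lemma increment_in_sets:
  assumes "0 \<le> s" "s \<le> t" "B \<in> sets borel"
  shows "increment_in s t B \<in> events"
proof -
  have "(\<lambda>\<omega>. W t \<omega> - W s \<omega>) \<in> borel_measurable M" using assms by (intro borel_measurable_diff W_measurable) auto
  from measurable_sets[OF this assms(3)] show ?thesis
    by (simp add: increment_in_def vimage_def Int_def conj_commute)
qed

text \<open>Independence is given for increments, not for values. Since W starts at 0, values at the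
  times in J are partial sums of the increments up to s, and these are jointly independent of the
  increment from s to t.\<close>

lemma cylinder_increment_indep:
  assumes J: "finite J" "J \<subseteq> {0..s}" and S: "\<And>u. u \<in> J \<Longrightarrow> S u \<in> sets borel"
    and st: "0 \<le> s" "s \<le> t" and B: "B \<in> sets borel"
  shows "prob (cylinder J S \<inter> increment_in s t B) = prob (cylinder J S) * prob (increment_in s t B)"
proof -
  \<comment> \<open>Time 0 anchors the partial sums, and time s makes the next increment the one
    from s to t.\<close>
  define Z where "Z = insert 0 (insert s J)"
  have Z: "finite Z" "Z \<noteq> {}" "Z \<subseteq> {0..s}" using J st by (auto simp: Z_def)
  obtain p L where "strict_partition p L" and p: "p ` {..L} = Z"
    using finite_strict_partition[OF Z(1,2)] by blast
  then interpret Q: strict_partition p L by simp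
  have p_range: "0 \<le> p i" "p i \<le> s" if "i \<le> L" for i
  proof -
    have "p i \<in> Z" using that p by auto
    then show "0 \<le> p i" "p i \<le> s" using Z(3) by auto
  qed
  have p0: "p 0 = 0"
  proof -
    have "0 \<in> p ` {..L}" unfolding p by (simp add: Z_def)
    then obtain k where "k \<le> L" "p k = 0" by auto
    then show ?thesis using Q.le_iff[of 0 k] p_range[of 0] by simp
  qed
  have pL: "p L = s"
  proof -
    have "s \<in> p ` {..L}" unfolding p by (simp add: Z_def)
    then obtain k where "k \<le> L" "p k = s" by auto
    then show ?thesis using Q.le_iff[of k L] p_range[of L] by simp
  qed
  \<comment> \<open>\<open>W_indep\<close> expects an infinite monotone sequence of times; it is
    held constant at t after the partition.\<close>
  define \<tau> where "\<tau> i = (if i \<le> L then p i else t)" for i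
  have \<tau>_mono: "mono \<tau>"
  proof (rule monoI)
    fix i j :: nat assume "i \<le> j"
    then show "\<tau> i \<le> \<tau> j" using Q.le_iff[of i j] p_range[of i] st by (auto simp: \<tau>_def)
  qed
  define D where "D i \<omega> = W (\<tau> (Suc i)) \<omega> - W (\<tau> i) \<omega>" for i \<omega>
  have "indep_vars (\<lambda>_. borel) D {..<Suc L}"
    unfolding D_def[abs_def] by (rule W_indep[OF _ \<tau>_mono]) (simp add: \<tau>_def p0)
  then have ind: "indep_var (PiM {..<L} (\<lambda>_. borel)) (\<lambda>\<omega>. restrict (\<lambda>i. D i \<omega>) {..<L})
      (PiM {L} (\<lambda>_. borel)) (\<lambda>\<omega>. restrict (\<lambda>i. D i \<omega>) {L})"
    by (rule indep_var_restrict) auto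
  define Xa where "Xa = {x \<in> space (PiM {..<L} (\<lambda>_. borel :: real measure)). \<forall>k\<in>{k. k \<le> L \<and> p k \<in> J}. (\<Sum>i<k. x i) \<in> S (p k)}"
  define Xb where "Xb = {x \<in> space (PiM {L} (\<lambda>_. borel :: real measure)). x L \<in> B}"
  have Xa: "Xa \<in> sets (PiM {..<L} (\<lambda>_. borel))"
    unfolding Xa_def
  proof (rule sets.sets_Collect_finite_All)
    fix k assume k: "k \<in> {k. k \<le> L \<and> p k \<in> J}"
    have "(\<lambda>x. \<Sum>i<k. x i) \<in> borel_measurable (PiM {..<L} (\<lambda>_. borel :: real measure))"
      using k by (intro borel_measurable_sum measurable_component_singleton) auto
    from measurable_sets[OF this S[of "p k"]] k
    show "{x \<in> space (PiM {..<L} (\<lambda>_. borel :: real measure)). (\<Sum>i<k. x i) \<in> S (p k)} \<in> sets (PiM {..<L} (\<lambda>_. borel))"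
      by (simp add: vimage_def Int_def conj_commute)
  qed auto
  have Xb: "Xb \<in> sets (PiM {L} (\<lambda>_. borel))"
  proof -
    have "(\<lambda>x. x L) \<in> borel_measurable (PiM {L} (\<lambda>_. borel :: real measure))"
      by (intro measurable_component_singleton) auto
    from measurable_sets[OF this B] show ?thesis by (simp add: Xb_def vimage_def Int_def conj_commute)
  qed
  let ?A = "(\<lambda>\<omega>. restrict (\<lambda>i. D i \<omega>) {..<L}) -` Xa \<inter> space M"
  have b: "(\<lambda>\<omega>. restrict (\<lambda>i. D i \<omega>) {L}) -` Xb \<inter> space M = increment_in s t B"
    by (auto simp: Xb_def increment_in_def D_def \<tau>_def pL space_PiM)
  \<comment> \<open>Only almost everywhere, because W vanishes at time 0 only almost surely.\<close>
  have ae: "AE \<omega> in M. \<omega> \<in> ?A \<longleftrightarrow> \<omega> \<in> cylinder J S"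
    using W_0
  proof eventually_elim
    case (elim \<omega>)
    have sum: "(\<Sum>i<k. restrict (\<lambda>i. D i \<omega>) {..<L} i) = W (p k) \<omega>" if "k \<le> L" for k
    proof -
      have "(\<Sum>i<k. restrict (\<lambda>i. D i \<omega>) {..<L} i) = (\<Sum>i<k. W (p (Suc i)) \<omega> - W (p i) \<omega>)"
        using that by (intro sum.cong) (auto simp: D_def \<tau>_def)
      also have "\<dots> = W (p k) \<omega> - W (p 0) \<omega>" by (rule sum_lessThan_telescope)
      finally show ?thesis using elim p0 by simp
    qed
    have mem: "restrict (\<lambda>i. D i \<omega>) {..<L} \<in> Xa \<longleftrightarrow> (\<forall>k\<in>{k. k \<le> L \<and> p k \<in> J}. W (p k) \<omega> \<in> S (p k))"
      unfolding Xa_def using sum by (auto simp: space_PiM)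
    also have "\<dots> \<longleftrightarrow> (\<forall>u\<in>J. W u \<omega> \<in> S u)"
    proof -
      have "J \<subseteq> p ` {..L}" unfolding p by (auto simp: Z_def)
      then show ?thesis by (auto simp: subset_iff image_iff)
    qed
    finally show ?case by (auto simp: cylinder_def)
  qed
  have A: "?A \<in> events"
    using indep_var_rv1[OF ind] Xa by (rule measurable_sets)
  have cyl: "cylinder J S \<in> events" using J S by (intro cylinder_sets) auto
  have inc: "increment_in s t B \<in> events" using st B by (rule increment_in_sets)
  have "prob (?A \<inter> increment_in s t B) = prob ?A * prob (increment_in s t B)"
    using indep_varD[OF ind Xa Xb] unfolding b[symmetric]
    by (simp add: vimage_def Int_def mem_Times_iff conj_ac cong: conj_cong)
  moreover have "prob ?A = prob (cylinder J S)" using ae A cyl by (rule finite_measure_eq_AE)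
  moreover have "prob (?A \<inter> increment_in s t B) = prob (cylinder J S \<inter> increment_in s t B)"
    using A cyl inc by (intro finite_measure_eq_AE) (use ae in auto)
  ultimately show ?thesis by simp
qed

lemma initial_path_indep:
  assumes "U \<in> sets borel" "D \<in> sets (PiM {0..} (\<lambda>_. borel :: real measure))"
  shows "prob ((X0 -` U \<inter> space M) \<inter> ((\<lambda>\<omega>. \<lambda>s\<in>{0..}. W s \<omega>) -` D \<inter> space M))
    = prob (X0 -` U \<inter> space M) * prob ((\<lambda>\<omega>. \<lambda>s\<in>{0..}. W s \<omega>) -` D \<inter> space M)"
  using X0_indep unfolding indep_of_process_def
  by (rule indep_setD) (rule in_vimage_algebra[OF assms(1)], rule in_vimage_algebra[OF assms(2)])

text \<open>An intersection-stable generator of the sigma-algebra of \<open>X0\<close> and W up to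
  time s, chosen so that the uniqueness theorem for measures on such generators extends product
  formulas.\<close>

definition past :: "real \<Rightarrow> 'w set set" where
  "past s = {X0 -` U \<inter> cylinder J S | U J S. U \<in> sets borel \<and> finite J \<and> J \<subseteq> {0..s} \<and> (\<forall>u\<in>J. S u \<in> sets borel)}"

text \<open>Cylinder and increment are both events of the path, so independence of \<open>X0\<close>
  from the whole path splits off the initial condition; the remaining product formula is
  \<open>cylinder_increment_indep\<close>.\<close>

lemma past_increment_indep:
  assumes st: "0 \<le> s" "s \<le> t" and a: "a \<in> past s" and B: "B \<in> sets borel"
  shows "a \<in> events" "prob (a \<inter> increment_in s t B) = prob a * prob (increment_in s t B)"
proof -
  obtain U J S where a_eq: "a = X0 -` U \<inter> cylinder J S" and U: "U \<in> sets borel"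
    and J: "finite J" "J \<subseteq> {0..s}" and S: "\<And>u. u \<in> J \<Longrightarrow> S u \<in> sets borel"
    using a unfolding past_def by auto
  have U': "X0 -` U \<inter> space M \<in> events" using X0_measurable U by (rule measurable_sets)
  have cyl: "cylinder J S \<in> events" using J S by (intro cylinder_sets) auto
  have a_eq': "a = (X0 -` U \<inter> space M) \<inter> cylinder J S" by (auto simp: a_eq cylinder_def)
  show "a \<in> events" unfolding a_eq' using U' cyl by (rule sets.Int)
  define D1 where "D1 = {x \<in> space (PiM {0..} (\<lambda>_. borel :: real measure)). \<forall>u\<in>J. x u \<in> S u}"
  define D2 where "D2 = {x \<in> space (PiM {0..} (\<lambda>_. borel :: real measure)). x t - x s \<in> B}"
  have comp: "(\<lambda>x. x u) \<in> borel_measurable (PiM {0..} (\<lambda>_. borel :: real measure))" if "0 \<le> u" for u :: real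
    using that by (intro measurable_component_singleton) auto
  have D1: "D1 \<in> sets (PiM {0..} (\<lambda>_. borel))"
    unfolding D1_def
  proof (rule sets.sets_Collect_finite_All)
    fix u assume u: "u \<in> J"
    then have "0 \<le> u" using J by auto
    from measurable_sets[OF comp[OF this] S[OF u]]
    show "{x \<in> space (PiM {0..} (\<lambda>_. borel :: real measure)). x u \<in> S u} \<in> sets (PiM {0..} (\<lambda>_. borel))"
      by (simp add: vimage_def Int_def conj_commute)
  qed (use J in auto)
  have D2: "D2 \<in> sets (PiM {0..} (\<lambda>_. borel))"
  proof -
    have "(\<lambda>x. x t - x s) \<in> borel_measurable (PiM {0..} (\<lambda>_. borel :: real measure))"
      using st by (intro borel_measurable_diff comp) auto
    from measurable_sets[OF this B] show ?thesis by (simp add: D2_def vimage_def Int_def conj_commute)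
  qed
  have E1: "(\<lambda>\<omega>. \<lambda>s\<in>{0..}. W s \<omega>) -` D1 \<inter> space M = cylinder J S"
    using J by (auto simp: D1_def cylinder_def space_PiM)
  have E2: "(\<lambda>\<omega>. \<lambda>s\<in>{0..}. W s \<omega>) -` (D1 \<inter> D2) \<inter> space M = cylinder J S \<inter> increment_in s t B"
    using J st by (auto simp: D1_def D2_def cylinder_def increment_in_def space_PiM)
  have "prob (a \<inter> increment_in s t B) = prob ((X0 -` U \<inter> space M) \<inter> (cylinder J S \<inter> increment_in s t B))"
    unfolding a_eq' by (simp only: Int_assoc)
  also have "\<dots> = prob (X0 -` U \<inter> space M) * prob (cylinder J S \<inter> increment_in s t B)"
    using initial_path_indep[OF U sets.Int[OF D1 D2]] unfolding E2 .
  also have "\<dots> = (prob (X0 -` U \<inter> space M) * prob (cylinder J S)) * prob (increment_in s t B)"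
    by (subst cylinder_increment_indep[OF J S st B]) simp_all
  also have "prob (X0 -` U \<inter> space M) * prob (cylinder J S) = prob a"
    using initial_path_indep[OF U D1] unfolding E1 a_eq' ..
  finally show "prob (a \<inter> increment_in s t B) = prob a * prob (increment_in s t B)" .
qed

lemma past_Int_stable: "Int_stable (past s)"
proof (rule Int_stableI)
  fix a b assume "a \<in> past s" "b \<in> past s"
  then obtain U J S U' J' S' where
    a: "a = X0 -` U \<inter> cylinder J S" "U \<in> sets borel" "finite J" "J \<subseteq> {0..s}" "\<forall>u\<in>J. S u \<in> sets borel" and
    b: "b = X0 -` U' \<inter> cylinder J' S'" "U' \<in> sets borel" "finite J'" "J' \<subseteq> {0..s}" "\<forall>u\<in>J'. S' u \<in> sets borel"
    unfolding past_def by blast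
  define V where "V u = (if u \<in> J then S u else UNIV) \<inter> (if u \<in> J' then S' u else UNIV)" for u
  have "a \<inter> b = X0 -` (U \<inter> U') \<inter> cylinder (J \<union> J') V"
    unfolding a(1) b(1) by (auto simp: cylinder_def V_def)
  moreover have "V u \<in> sets borel" if "u \<in> J \<union> J'" for u
    using that a(5) b(5) by (auto simp: V_def)
  ultimately show "a \<inter> b \<in> past s"
    unfolding past_def using a b by (intro CollectI exI[of _ "U \<inter> U'"] exI[of _ "J \<union> J'"] exI[of _ V]) auto
qed

definition increments :: "real \<Rightarrow> real \<Rightarrow> 'w set set" where
  "increments s t = {increment_in s t B | B. B \<in> sets borel}"

lemma indep_past_increments:
  assumes st: "0 \<le> s" "s \<le> t"
  shows "indep_set (sigma_sets (space M) (past s)) (sigma_sets (space M) (increments s t))"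
proof (rule indep_set_sigma_sets)
  show "indep_set (past s) (increments s t)"
  proof (rule indep_setI)
    show "past s \<subseteq> events" using past_increment_indep(1)[OF st _ sets.empty_sets] by blast
    show "increments s t \<subseteq> events" using increment_in_sets[OF st] by (auto simp: increments_def)
    show "prob (a \<inter> b) = prob a * prob b" if "a \<in> past s" "b \<in> increments s t" for a b
      using that past_increment_indep(2)[OF st] by (auto simp: increments_def)
  qed
  show "Int_stable (increments s t)"
  proof (rule Int_stableI)
    fix a b assume "a \<in> increments s t" "b \<in> increments s t"
    then obtain B B' where ab: "a = increment_in s t B" "b = increment_in s t B'" "B \<in> sets borel" "B' \<in> sets borel"
      by (auto simp: increments_def)
    have "a \<inter> b = increment_in s t (B \<inter> B')" unfolding ab by (auto simp: increment_in_def)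
    then show "a \<inter> b \<in> increments s t" using ab(3,4) by (auto simp: increments_def)
  qed
qed (rule past_Int_stable)

section \<open>Passing to the completed sigma-algebras\<close>

definition gens :: "real \<Rightarrow> 'w set set" where
  "gens t = {X0 -` S \<inter> space M | S. S \<in> sets borel} \<union>
     {W s -` S \<inter> space M | s S. 0 \<le> s \<and> s \<le> t \<and> S \<in> sets borel} \<union> null_sets P"

lemma gens_sets: "gens t \<subseteq> sets P"
  unfolding gens_def using measurable_sets[OF X0_measurable] measurable_sets[OF W_measurable] by auto

lemma F_space: "space (F t) = space M" and F_sets: "sets (F t) = sigma_sets (space M) (gens t)"
proof -
  have "gens t \<subseteq> Pow (space M)" using gens_sets[of t] sets.sets_into_space[of _ P] by auto
  then show "space (F t) = space M" "sets (F t) = sigma_sets (space M) (gens t)"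
    unfolding completed_filtration_def gens_def[symmetric] by simp_all
qed

lemma F_subalgebra: "subalgebra P (F t)"
  unfolding subalgebra_def F_space F_sets
  using sets.sigma_sets_subset[OF gens_sets[of t]] by simp

lemma F_mono: "s \<le> t \<Longrightarrow> subalgebra (F t) (F s)"
  unfolding subalgebra_def F_space F_sets
  by (auto intro!: sigma_sets_mono' simp: gens_def) (blast intro: order_trans sigma_sets.Basic sigma_sets_mono'[THEN subsetD])+

lemma W_F_measurable: "0 \<le> t \<Longrightarrow> W t \<in> borel_measurable (F t)"
  by (rule measurableI) (auto simp: F_space F_sets gens_def intro!: sigma_sets.Basic)

text \<open>Null sets of the completion need not be events of M. Along the generation of the
  sigma-algebra every set keeps an almost everywhere equal partner in the raw past, to which the
  independence already shown applies.\<close>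

lemma F_modification:
  assumes "0 \<le> s" "A \<in> sigma_sets (space M) (gens s)"
  shows "\<exists>A'\<in>sigma_sets (space M) (past s). AE \<omega> in P. \<omega> \<in> A \<longleftrightarrow> \<omega> \<in> A'"
  using assms(2)
proof (induction rule: sigma_sets.induct)
  case (Basic a)
  consider (X0) U where "a = X0 -` U \<inter> space M" "U \<in> sets borel"
    | (W) u S where "a = W u -` S \<inter> space M" "0 \<le> u" "u \<le> s" "S \<in> sets borel"
    | (null) "a \<in> null_sets P"
    using Basic unfolding gens_def by blast
  then show ?case
  proof cases
    case X0
    have "a = X0 -` U \<inter> cylinder {} (\<lambda>_. UNIV)" using X0 by (simp add: cylinder_def)
    then have "a \<in> past s" unfolding past_def using X0(2)
      by (intro CollectI exI[of _ U] exI[of _ "{}"] exI[of _ "\<lambda>_. UNIV"]) auto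
    then show ?thesis by (intro bexI[of _ a] sigma_sets.Basic) auto
  next
    case W
    have "a = X0 -` UNIV \<inter> cylinder {u} (\<lambda>_. S)" using W by (auto simp: cylinder_def)
    then have "a \<in> past s" unfolding past_def using W(2-4)
      by (intro CollectI exI[of _ UNIV] exI[of _ "{u}"] exI[of _ "\<lambda>_. S"]) auto
    then show ?thesis by (intro bexI[of _ a] sigma_sets.Basic) auto
  next
    case null
    then show ?thesis using AE_not_in[OF null] by (intro bexI[of _ "{}"] sigma_sets.Empty) simp
  qed
next
  case Empty
  show ?case by (intro bexI[of _ "{}"] sigma_sets.Empty) simp
next
  case (Compl a)
  then obtain a' where a': "a' \<in> sigma_sets (space M) (past s)" "AE \<omega> in P. \<omega> \<in> a \<longleftrightarrow> \<omega> \<in> a'" by blast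
  from a'(2) have "AE \<omega> in P. \<omega> \<in> space M - a \<longleftrightarrow> \<omega> \<in> space M - a'" by eventually_elim auto
  then show ?case using sigma_sets.Compl[OF a'(1)] by blast
next
  case (Union a)
  then have "\<forall>i. \<exists>a'. a' \<in> sigma_sets (space M) (past s) \<and> (AE \<omega> in P. \<omega> \<in> a i \<longleftrightarrow> \<omega> \<in> a')" by blast
  from choice[OF this] obtain a' where a': "\<And>i. a' i \<in> sigma_sets (space M) (past s)"
    "\<And>i. AE \<omega> in P. \<omega> \<in> a i \<longleftrightarrow> \<omega> \<in> a' i" by blast
  have "AE \<omega> in P. \<forall>i. \<omega> \<in> a i \<longleftrightarrow> \<omega> \<in> a' i" unfolding AE_all_countable using a'(2) by blast
  then have "AE \<omega> in P. \<omega> \<in> (\<Union>i. a i) \<longleftrightarrow> \<omega> \<in> (\<Union>i. a' i)" by eventually_elim auto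
  moreover have "(\<Union>i. a' i) \<in> sigma_sets (space M) (past s)" using a'(1) by (rule sigma_sets.Union)
  ultimately show ?case by blast
qed

sublocale P: prob_space P
  by (rule prob_space_completion)

text \<open>A set of the completed past is exchanged for its partner in the raw past; this changes
  neither its probability nor that of an intersection.\<close>

lemma F_increment_indep_var:
  assumes st: "0 \<le> s" "s \<le> t" and Z: "Z \<in> borel_measurable (F s)"
  shows "P.indep_var borel Z borel (\<lambda>\<omega>. W t \<omega> - W s \<omega>)"
proof -
  let ?D = "\<lambda>\<omega>. W t \<omega> - W s \<omega>"
  have Dm: "?D \<in> borel_measurable M" using st by (intro borel_measurable_diff W_measurable) auto
  have ind: "indep_set (sigma_sets (space M) (past s)) (sigma_sets (space M) (increments s t))"
    by (rule indep_past_increments[OF st])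
  have inc_sets: "sigma_sets (space M) (increments s t) \<subseteq> events" by (rule indep_setD_ev2[OF ind])
  have "P.indep_set (sigma_sets (space M) (gens s)) (sigma_sets (space M) (increments s t))"
  proof (rule P.indep_setI)
    show gP: "sigma_sets (space M) (gens s) \<subseteq> P.events"
      using F_subalgebra[of s] by (simp add: subalgebra_def F_sets)
    show "sigma_sets (space M) (increments s t) \<subseteq> P.events" using inc_sets by auto
    fix a b assume a: "a \<in> sigma_sets (space M) (gens s)" and b: "b \<in> sigma_sets (space M) (increments s t)"
    obtain a' where a': "a' \<in> sigma_sets (space M) (past s)" and ae: "AE \<omega> in P. \<omega> \<in> a \<longleftrightarrow> \<omega> \<in> a'"
      using F_modification[OF st(1) a] by blast
    have ev: "a' \<in> events" "b \<in> events" using indep_setD_ev1[OF ind] a' inc_sets b by auto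
    have aP: "a \<in> sets P" using gP a by blast
    have "measure P (a \<inter> b) = measure P (a' \<inter> b)"
    proof (rule P.finite_measure_eq_AE)
      show "AE \<omega> in P. \<omega> \<in> a \<inter> b \<longleftrightarrow> \<omega> \<in> a' \<inter> b" using ae by eventually_elim auto
    qed (use aP ev in \<open>auto intro!: sets.Int\<close>)
    also have "\<dots> = prob (a' \<inter> b)" using ev by (intro measure_completion) auto
    also have "\<dots> = prob a' * prob b" by (rule indep_setD[OF ind a' b])
    also have "\<dots> = measure P a' * measure P b" using ev by simp
    also have "measure P a' = measure P a"
      by (rule P.finite_measure_eq_AE) (use ae aP ev in auto)
    finally show "measure P (a \<inter> b) = measure P a * measure P b" .
  qed
  then have gi: "P.indep_set (sets (F s)) (sigma_sets (space M) (increments s t))" by (simp add: F_sets)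
  have Zs: "sigma_sets (space M) {Z -` A \<inter> space M | A. A \<in> sets borel} \<subseteq> sets (F s)"
  proof -
    have "{Z -` A \<inter> space M | A. A \<in> sets borel} \<subseteq> sets (F s)"
      using measurable_sets[OF Z] by (auto simp: F_space)
    from sets.sigma_sets_subset[OF this] show ?thesis by (simp add: F_space)
  qed
  have Ds: "{?D -` A \<inter> space M | A. A \<in> sets borel} = increments s t"
    by (auto simp: increments_def increment_in_def vimage_def Int_def conj_commute)
  have "P.indep_set (sigma_sets (space M) {Z -` A \<inter> space M | A. A \<in> sets borel})
      (sigma_sets (space M) {?D -` A \<inter> space M | A. A \<in> sets borel})"
    unfolding Ds
  proof (rule P.indep_setI)
    show "sigma_sets (space M) {Z -` A \<inter> space M |A. A \<in> sets borel} \<subseteq> P.events"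
      using Zs P.indep_setD_ev1[OF gi] by blast
    show "sigma_sets (space M) (increments s t) \<subseteq> P.events" by (rule P.indep_setD_ev2[OF gi])
    show "measure P (a \<inter> b) = measure P a * measure P b"
      if "a \<in> sigma_sets (space M) {Z -` A \<inter> space M |A. A \<in> sets borel}" "b \<in> sigma_sets (space M) (increments s t)" for a b
      using P.indep_setD[OF gi] Zs that by blast
  qed
  moreover have "Z \<in> borel_measurable P" using measurable_from_subalg[OF F_subalgebra Z] .
  ultimately show ?thesis unfolding P.indep_var_eq using Dm by (simp add: measurable_completion)
qed

lemma increment_moments:
  assumes st: "0 \<le> s" "s < t"
  shows "integrable P (\<lambda>\<omega>. W t \<omega> - W s \<omega>)" "(\<integral>\<omega>. W t \<omega> - W s \<omega> \<partial>P) = 0"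
    and "integrable P (\<lambda>\<omega>. (W t \<omega> - W s \<omega>)\<^sup>2)" "(\<integral>\<omega>. (W t \<omega> - W s \<omega>)\<^sup>2 \<partial>P) = t - s"
proof -
  let ?D = "\<lambda>\<omega>. W t \<omega> - W s \<omega>" and ?\<sigma> = "sqrt (t - s)"
  have Dm: "?D \<in> borel_measurable M" using st by (intro borel_measurable_diff W_measurable) auto
  have \<sigma>: "0 < ?\<sigma>" using st by simp
  note d = W_normal[OF st]
  have 0: "expectation ?D = 0" by (rule normal_distributed_expectation[OF \<sigma> d])
  have 1: "integrable M ?D"
    using distributed_integrable[OF d, of "\<lambda>x. x"] integrable_normal_moment[OF \<sigma>, of 0 1] by simp
  have 2: "integrable M (\<lambda>\<omega>. (?D \<omega>)\<^sup>2)"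
    using distributed_integrable[OF d, of "\<lambda>x. x\<^sup>2"] integrable_normal_moment[OF \<sigma>, of 0 2] by simp
  have "variance ?D = ?\<sigma>\<^sup>2" by (rule normal_distributed_variance[OF \<sigma> d])
  then have 3: "expectation (\<lambda>\<omega>. (?D \<omega>)\<^sup>2) = t - s" using 0 st by simp
  have Dm2: "(\<lambda>\<omega>. (?D \<omega>)\<^sup>2) \<in> borel_measurable M" using Dm by measurable
  show "integrable P ?D" "(\<integral>\<omega>. ?D \<omega> \<partial>P) = 0" "integrable P (\<lambda>\<omega>. (?D \<omega>)\<^sup>2)" "(\<integral>\<omega>. (?D \<omega>)\<^sup>2 \<partial>P) = t - s"
    using 0 1 2 3 Dm Dm2 by (simp_all add: integrable_completion integral_completion)
qed

lemma brownian_filtration: "brownian_filtration P F W"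
proof
  fix s t :: real
  show "subalgebra P (F t)" by (rule F_subalgebra)
  show "subalgebra (F t) (F s)" if "s \<le> t" by (rule F_mono[OF that])
  show "W t \<in> borel_measurable (F t)" if "0 \<le> t" by (rule W_F_measurable[OF that])
next
  fix s t :: real and Z :: "'w \<Rightarrow> real" assume st: "0 \<le> s" "s \<le> t" and Z: "Z \<in> borel_measurable (F s)" "integrable P Z"
  let ?D = "\<lambda>\<omega>. W t \<omega> - W s \<omega>"
  show "integrable P (\<lambda>\<omega>. ?D \<omega> * Z \<omega>) \<and> (\<integral>\<omega>. ?D \<omega> * Z \<omega> \<partial>P) = 0"
  \<comment> \<open>An increment of length zero has no density and is treated apart.\<close>
  proof (cases "s = t")
    case False
    note m = increment_moments[of s t]
    have ind: "P.indep_var borel Z borel ?D" by (rule F_increment_indep_var[OF st Z(1)])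
    show ?thesis
      using P.indep_var_integrable[OF ind Z(2) m(1)] P.indep_var_lebesgue_integral[OF ind Z(2) m(1)] m(2) st False
      by (simp add: mult.commute)
  qed simp
  show "integrable P (\<lambda>\<omega>. (?D \<omega>)\<^sup>2 * Z \<omega>) \<and> (\<integral>\<omega>. (?D \<omega>)\<^sup>2 * Z \<omega> \<partial>P) = (t - s) * (\<integral>\<omega>. Z \<omega> \<partial>P)"
  proof (cases "s = t")
    case False
    note m = increment_moments[of s t]
    have "P.indep_var borel ((\<lambda>x. x) \<circ> Z) borel ((\<lambda>x. x\<^sup>2) \<circ> ?D)"
      by (rule P.indep_var_compose[OF F_increment_indep_var[OF st Z(1)]]) auto
    then have ind: "P.indep_var borel Z borel (\<lambda>\<omega>. (?D \<omega>)\<^sup>2)" by (simp add: comp_def)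
    show ?thesis
      using P.indep_var_integrable[OF ind Z(2) m(3)] P.indep_var_lebesgue_integral[OF ind Z(2) m(3)] m(4) st False
      by (simp add: mult.commute)
  qed simp
qed

end

section \<open>Solutions with completed filtration\<close>

lemma (in brownian_initial) L2_initial:
  fixes Y :: "'w \<Rightarrow> real ^ 'n"
  assumes Y: "Y \<in> borel_measurable M" "Y \<in> borel_measurable (F 0)"
    and fin: "(\<integral>\<^sup>+\<omega>. ennreal (norm (Y \<omega>) ^ 4) \<partial>M) < \<infinity>"
  shows "brownian_filtration.L2 P F 0 Y"
proof -
  interpret BF: brownian_filtration P F W by (rule brownian_filtration)
  have "(\<integral>\<^sup>+\<omega>. ennreal ((norm (Y \<omega>))\<^sup>2) \<partial>M) \<le> (\<integral>\<^sup>+\<omega>. 1 + ennreal (norm (Y \<omega>) ^ 4) \<partial>M)"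
  proof (rule nn_integral_mono)
    fix \<omega>
    have "2 * (norm (Y \<omega>))\<^sup>2 \<le> 1 + ((norm (Y \<omega>))\<^sup>2)\<^sup>2"
      using sum_squares_bound[of 1 "(norm (Y \<omega>))\<^sup>2"] by simp
    moreover have "((norm (Y \<omega>))\<^sup>2)\<^sup>2 = norm (Y \<omega>) ^ 4" by (simp add: power_mult[symmetric])
    ultimately have "(norm (Y \<omega>))\<^sup>2 \<le> 1 + norm (Y \<omega>) ^ 4"
      using zero_le_power2[of "norm (Y \<omega>)"] by linarith
    then have "ennreal ((norm (Y \<omega>))\<^sup>2) \<le> ennreal (1 + norm (Y \<omega>) ^ 4)" by (rule ennreal_leI)
    also have "\<dots> = 1 + ennreal (norm (Y \<omega>) ^ 4)" by (simp add: ennreal_plus)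
    finally show "ennreal ((norm (Y \<omega>))\<^sup>2) \<le> 1 + ennreal (norm (Y \<omega>) ^ 4)" .
  qed
  also have "\<dots> = (\<integral>\<^sup>+\<omega>. 1 \<partial>M) + (\<integral>\<^sup>+\<omega>. ennreal (norm (Y \<omega>) ^ 4) \<partial>M)"
    using Y(1) by (intro nn_integral_add) auto
  also have "\<dots> < \<infinity>" using fin by (simp add: emeasure_space_1)
  finally have "integrable M (\<lambda>\<omega>. (norm (Y \<omega>))\<^sup>2)"
    using Y(1) by (intro integrableI_bounded) auto
  then have "integrable P (\<lambda>\<omega>. (norm (Y \<omega>))\<^sup>2)"
    using Y(1) by (subst integrable_completion) auto
  then show ?thesis using Y(2) by (simp add: BF.L2_def)
qed

text \<open>Almost sure statements pass to the completion, and \<open>simple_process\<close> depends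
  on the measure only through its space, so the equation over M becomes the locale over the
  completion.\<close>

lemma admissible_pantograph:
  fixes A B S \<Theta> :: "real ^ 'n ^ 'n"
  assumes M: "prob_space M" and bm: "brownian_motion M W" and q: "0 < q" "q < 1"
    and adm: "admissible_solution M W q A B S \<Theta> X0 X"
  shows "pantograph (completion M) (completed_filtration M X0 W) W q A B S \<Theta> X0 X"
proof -
  have X0: "X0 \<in> borel_measurable M" "indep_of_process M X0 W" "(\<integral>\<^sup>+\<omega>. ennreal (norm (X0 \<omega>) ^ 4) \<partial>M) < \<infinity>"
    and sol: "pantograph_solution M W q A B S \<Theta> X0 X"
    using adm by (simp_all add: admissible_solution_def)
  interpret prob_space M by (rule M)
  interpret BI: brownian_initial M W X0 using bm X0 by unfold_locales
  interpret BF: brownian_filtration BI.P BI.F W by (rule BI.brownian_filtration)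
  have X0F: "X0 \<in> borel_measurable (BI.F 0)"
    by (rule measurableI) (auto simp: BI.F_space BI.F_sets BI.gens_def intro!: sigma_sets.Basic)
  show ?thesis
  proof
    show "BF.L2 0 X0" by (rule BI.L2_initial[OF X0(1) X0F X0(3)])
    show "AE \<omega> in BI.P. continuous_on {0..} (\<lambda>t. X t \<omega>)" "AE \<omega> in BI.P. X 0 \<omega> = X0 \<omega>"
      using sol by (auto simp: pantograph_solution_def intro: AE_completion)
    fix t :: real assume t: "0 \<le> t"
    show "X t \<in> borel_measurable (BI.F t)" using sol t by (simp add: pantograph_solution_def)
    obtain I where ito: "has_ito_integral M BI.F W (\<lambda>s \<omega>. S *v X s \<omega> + \<Theta> *v X (q * s) \<omega>) t I"
      and eq: "AE \<omega> in M. X t \<omega> = X0 \<omega> + integral {0..t} (\<lambda>s. A *v X s \<omega> + B *v X (q * s) \<omega>) + I \<omega>"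
      using sol t unfolding pantograph_solution_def by blast
    obtain N \<tau> \<xi> where simple: "\<forall>n. simple_process M BI.F t (N n) (\<tau> n) (\<xi> n)"
      and v: "vanishes_in_probability BI.P (\<lambda>n \<omega>. \<integral>\<^sup>+s\<in>{0..t}.
          ennreal ((norm (simple_value (N n) (\<tau> n) (\<xi> n) s \<omega> - (S *v X s \<omega> + \<Theta> *v X (q * s) \<omega>)))\<^sup>2) \<partial>lborel)"
        "vanishes_in_probability BI.P (\<lambda>n \<omega>. ennreal (norm (simple_integral_wrt W (N n) (\<tau> n) (\<xi> n) \<omega> - I \<omega>)))"
      using ito unfolding has_ito_integral_def by blast
    have "simple_process BI.P BI.F t (N n) (\<tau> n) (\<xi> n)" for n
      using simple by (simp add: simple_process_def)
    then have "BF.ito_approximable t (\<lambda>s \<omega>. S *v X s \<omega> + \<Theta> *v X (q * s) \<omega>) I"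
      unfolding BF.ito_approximable_def using v by blast
    with AE_completion[OF eq] show "\<exists>I. BF.ito_approximable t (\<lambda>s \<omega>. S *v X s \<omega> + \<Theta> *v X (q * s) \<omega>) I \<and>
        (AE \<omega> in BI.P. X t \<omega> = X0 \<omega> + integral {0..t} (\<lambda>s. A *v X s \<omega> + B *v X (q * s) \<omega>) + I \<omega>)"
      by blast
  qed (use q in simp_all)
qed

text \<open>The constant is chosen before \<open>X0\<close> and X, which gives the uniformity in the
  stability notions. The mean-square estimate holds with \<alpha> already; it is weakened to
  \<alpha>' so that both estimates share one exponent.\<close>

lemma estimates_from_supersolution:
  fixes A B S \<Theta> C :: "real ^ 'n ^ 'n"
  assumes M: "prob_space M" and bm: "brownian_motion M W" and q: "0 < q" "q < 1"
    and sym: "transpose C = C" and lyap: "transpose A ** C + C ** A = - mat 1"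
    and form: "\<And>x. l * (norm x)\<^sup>2 \<le> x \<bullet> (C *v x)" "\<And>x. x \<bullet> (C *v x) \<le> u * (norm x)\<^sup>2"
    and l: "0 < l" and u: "0 < u" and r: "0 < r" and e: "0 < e"
    and a: "a = - 1 / u + (opnorm (transpose S ** C ** S)
        + r * (opnorm (transpose B ** C) + opnorm (transpose S ** C ** \<Theta>))) / l"
    and b: "b = (opnorm (transpose \<Theta> ** C ** \<Theta>)
        + (opnorm (transpose B ** C) + opnorm (transpose S ** C ** \<Theta>)) / r) / l"
    and super: "supersolution q (a + e) (b + e) \<alpha> \<phi> K h2" and \<alpha>': "\<alpha> < \<alpha>'"
  shows "\<exists>K>0. \<forall>X0 X. admissible_solution M W q A B S \<Theta> X0 X \<longrightarrow>
    ms_estimate M X0 X K \<alpha>' \<and> as_estimate M X (1 / 2 * (\<alpha>' + 1))"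
proof -
  obtain h1 where h1: "0 < h1" and step: "\<And>h x y. 0 < h \<Longrightarrow> h < h1 \<Longrightarrow>
      (x + h *\<^sub>R (A *v x + B *v y)) \<bullet> (C *v (x + h *\<^sub>R (A *v x + B *v y)))
        + h * ((S *v x + \<Theta> *v y) \<bullet> (C *v (S *v x + \<Theta> *v y)))
      \<le> (1 + (a + e) * h) * (x \<bullet> (C *v x)) + (b + e) * h * (y \<bullet> (C *v y))"
    using lyapunov_step[OF sym lyap form l u r e a b] by blast
  have b0: "0 \<le> b" unfolding b using l r
    by (intro divide_nonneg_nonneg add_nonneg_nonneg opnorm_ge0) auto
  have K: "0 < K" using super by (simp add: supersolution_def)
  have "ms_estimate M X0 X (u / l * K) \<alpha>' \<and> as_estimate M X (1 / 2 * (\<alpha>' + 1))"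
    if adm: "admissible_solution M W q A B S \<Theta> X0 X" for X0 X
  proof -
    interpret L: pantograph_lyapunov "completion M" "completed_filtration M X0 W" W q A B S \<Theta> X0 X
      C l u "a + e" "b + e" \<alpha> K h1 h2 \<phi>
      using admissible_pantograph[OF M bm q adm] form l u b0 e h1 step super
      by (intro pantograph_lyapunov.intro pantograph_lyapunov_axioms.intro) auto
    have int: "integrable (completion M) (\<lambda>\<omega>. (norm (X0 \<omega>))\<^sup>2)" using L.X0 by (simp add: L.L2_def)
    have ms0: "mean_square M X0 = ennreal L.initial_ms"
      unfolding mean_square_def L.initial_ms_def by (rule nn_integral_eq_integral[OF int]) simp
    have "mean_square M (X t) \<le> ennreal (u / l * K) * mean_square M X0 * ennreal ((1 + t) powr \<alpha>')"
      if t: "0 \<le> t" for t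
    proof -
      have "(1 + t) powr \<alpha> \<le> (1 + t) powr \<alpha>'" using t \<alpha>' by (intro powr_mono) auto
      then have "L.ms_const * L.initial_ms * (1 + t) powr \<alpha> \<le> L.ms_const * L.initial_ms * (1 + t) powr \<alpha>'"
        using L.ms_const_pos L.initial_ms_nonneg by (intro mult_left_mono) auto
      then have "mean_square M (X t) \<le> ennreal (L.ms_const * L.initial_ms * (1 + t) powr \<alpha>')"
        using L.mean_square_bound[OF t] unfolding mean_square_def by (meson ennreal_leI order_trans)
      also have "\<dots> = ennreal (u / l * K) * mean_square M X0 * ennreal ((1 + t) powr \<alpha>')"
        unfolding ms0 L.ms_const_def[symmetric] using less_imp_le[OF L.ms_const_pos] L.initial_ms_nonneg by (simp add: ennreal_mult)
      finally show ?thesis .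
    qed
    moreover have "as_estimate M X (1 / 2 * (\<alpha>' + 1))"
      using L.almost_sure_bound[OF \<alpha>'] unfolding as_estimate_def by (simp only: AE_completion_iff)
    ultimately show ?thesis by (simp add: ms_estimate_def)
  qed
  moreover have "0 < u / l * K" using u l K by simp
  ultimately show ?thesis by blast
qed

theorem theorem9:
  fixes M :: "'w measure" and W :: "real \<Rightarrow> 'w \<Rightarrow> real"
    and q :: real and A B S \<Theta> C :: "real ^ 'n ^ 'n" and gl gu :: real
  defines "Sol \<equiv> admissible_solution M W q A B S \<Theta>"
  assumes "prob_space M" and "brownian_motion M W"
    and "0 < q" and "q < 1"
    and "\<And>k. matrix_eigenvalue (cmatrix A) k \<Longrightarrow> Re k < 0"
    and "positive_definite C" and "transpose A ** C + C ** A = - mat 1"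
    and "matrix_eigenvalue C (gl\<^sup>2)" and "\<And>k. matrix_eigenvalue C k \<Longrightarrow> gl\<^sup>2 \<le> k"
    and "matrix_eigenvalue C (gu\<^sup>2)" and "\<And>k. matrix_eigenvalue C k \<Longrightarrow> k \<le> gu\<^sup>2"
    and "0 < gl\<^sup>2" and "gl\<^sup>2 \<le> gu\<^sup>2"
  shows
    "(- 1 / gu\<^sup>2 + 1 / gl\<^sup>2 * opnorm (transpose S ** C ** S) < 0 \<longrightarrow>
        (\<exists>\<alpha> K. 0 < K \<and>
           (\<forall>X0 X. Sol X0 X \<longrightarrow> ms_estimate M X0 X K \<alpha> \<and> as_estimate M X (1 / 2 * (\<alpha> + 1)))) \<and>
        ms_polynomially_bounded M Sol \<and> as_polynomially_bounded M Sol)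
     \<and>
     (- 1 / gu\<^sup>2 + 1 / gl\<^sup>2 *
          (opnorm (transpose S ** C ** S) + opnorm (transpose \<Theta> ** C ** \<Theta>)
           + 2 * opnorm (transpose B ** C) + 2 * opnorm (transpose S ** C ** \<Theta>)) < 0 \<longrightarrow>
        (\<exists>\<alpha> K. \<alpha> < 0 \<and> 0 < K \<and>
           (\<forall>X0 X. Sol X0 X \<longrightarrow> ms_estimate M X0 X K \<alpha> \<and> as_estimate M X (1 / 2 * (\<alpha> + 1)))) \<and>
        ms_polynomially_stable M Sol \<and> as_polynomially_bounded M Sol)
     \<and>
     (- 1 / gu\<^sup>2 + 1 / gl\<^sup>2 *
          (opnorm (transpose S ** C ** S) + opnorm (transpose \<Theta> ** C ** \<Theta>) / q
           + 2 / sqrt q * opnorm (transpose B ** C) + 2 / sqrt q * opnorm (transpose S ** C ** \<Theta>)) < 0 \<longrightarrow>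
        (\<exists>\<alpha> K. \<alpha> < -1 \<and> 0 < K \<and>
           (\<forall>X0 X. Sol X0 X \<longrightarrow> ms_estimate M X0 X K \<alpha> \<and> as_estimate M X (1 / 2 * (\<alpha> + 1)))) \<and>
        ms_polynomially_stable M Sol \<and> as_polynomially_stable M Sol)"
proof -
  let ?s = "opnorm (transpose S ** C ** S)" and ?t = "opnorm (transpose \<Theta> ** C ** \<Theta>)"
  let ?c = "opnorm (transpose B ** C) + opnorm (transpose S ** C ** \<Theta>)"
  \<comment> \<open>The coefficients of \<open>lyapunov_step\<close> as functions of the Young
    weight, which each case chooses separately.\<close>
  define a where "a r = - 1 / gu\<^sup>2 + (?s + r * ?c) / gl\<^sup>2" for r :: real
  define b where "b r = (?t + ?c / r) / gl\<^sup>2" for r :: real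
  have sym: "transpose C = C" using \<open>positive_definite C\<close> by (simp add: positive_definite_def)
  note form = min_eigenvalue_form[OF sym \<open>\<And>k. matrix_eigenvalue C k \<Longrightarrow> gl\<^sup>2 \<le> k\<close>]
    max_eigenvalue_form[OF sym \<open>\<And>k. matrix_eigenvalue C k \<Longrightarrow> k \<le> gu\<^sup>2\<close>]
  have gu: "0 < gu\<^sup>2" using \<open>0 < gl\<^sup>2\<close> \<open>gl\<^sup>2 \<le> gu\<^sup>2\<close> by linarith
  have c0: "0 \<le> ?c" by (intro add_nonneg_nonneg opnorm_ge0)
  have b0: "0 \<le> b r" if "0 < r" for r
    unfolding b_def using that c0 opnorm_ge0 by (intro divide_nonneg_nonneg add_nonneg_nonneg) auto
  have est: "\<exists>K>0. \<forall>X0 X. Sol X0 X \<longrightarrow> ms_estimate M X0 X K \<alpha>' \<and> as_estimate M X (1 / 2 * (\<alpha>' + 1))"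
    if "0 < r" "0 < e" "supersolution q (a r + e) (b r + e) \<alpha> \<phi> K h2" "\<alpha> < \<alpha>'" for r e \<alpha> \<phi> K h2 \<alpha>'
    unfolding Sol_def
    using estimates_from_supersolution[OF \<open>prob_space M\<close> \<open>brownian_motion M W\<close> \<open>0 < q\<close> \<open>q < 1\<close> sym
        \<open>transpose A ** C + C ** A = - mat 1\<close> form \<open>0 < gl\<^sup>2\<close> gu that(1,2) a_def b_def that(3,4)] .
  have decay: "\<exists>\<alpha>'<\<alpha>. \<exists>K>0. \<forall>X0 X. Sol X0 X \<longrightarrow> ms_estimate M X0 X K \<alpha>' \<and> as_estimate M X (1 / 2 * (\<alpha>' + 1))"
    if r: "0 < r" and \<alpha>: "\<alpha> \<le> 0" and ab: "a r + b r * q powr \<alpha> < 0" for r \<alpha>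
  proof -
    obtain e where e: "0 < e" "(a r + e) + (b r + e) * q powr (\<alpha> - e) < 0"
      using exponent_slack[OF \<open>0 < q\<close> ab] by blast
    obtain \<phi> K h2 where "supersolution q (a r + e) (b r + e) (\<alpha> - e) \<phi> K h2"
      using supersolution_decay[OF \<open>0 < q\<close> \<open>q < 1\<close> _ _ e(2)] b0[OF r] e(1) \<alpha> by auto
    \<comment> \<open>The exponent lies strictly between that of the supersolution, \<alpha> - e,
      and the threshold \<alpha>.\<close>
    from est[OF r e(1) this, of "\<alpha> - e / 2"] e(1) show ?thesis by (intro exI[of _ "\<alpha> - e / 2"]) auto
  qed
  have conseq: "ms_polynomially_bounded M Sol" "as_polynomially_bounded M Sol"
    "\<alpha> < 0 \<Longrightarrow> ms_polynomially_stable M Sol" "\<alpha> < -1 \<Longrightarrow> as_polynomially_stable M Sol"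
    if K: "0 < K" and *: "\<forall>X0 X. Sol X0 X \<longrightarrow> ms_estimate M X0 X K \<alpha> \<and> as_estimate M X (1 / 2 * (\<alpha> + 1))" for \<alpha> K
  proof -
    show "ms_polynomially_bounded M Sol" unfolding ms_polynomially_bounded_def using K * by blast
    show "as_polynomially_bounded M Sol" unfolding as_polynomially_bounded_def using * by blast
    show "ms_polynomially_stable M Sol" if "\<alpha> < 0" unfolding ms_polynomially_stable_def using K * that by blast
    show "as_polynomially_stable M Sol" if "\<alpha> < -1"
      unfolding as_polynomially_stable_def
      by (rule exI[of _ "1 / 2 * (\<alpha> + 1)"]) (use * that in simp)
  qed
  have H1: "(\<exists>\<alpha> K. 0 < K \<and> (\<forall>X0 X. Sol X0 X \<longrightarrow> ms_estimate M X0 X K \<alpha> \<and> as_estimate M X (1 / 2 * (\<alpha> + 1))))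
      \<and> ms_polynomially_bounded M Sol \<and> as_polynomially_bounded M Sol"
    if "- 1 / gu\<^sup>2 + 1 / gl\<^sup>2 * ?s < 0"
  proof -
    define d where "d = - (- 1 / gu\<^sup>2 + 1 / gl\<^sup>2 * ?s)"
    have d: "0 < d" using that by (simp add: d_def)
    \<comment> \<open>So small that the cross terms use up at most half of the margin
      \<open>d\<close>, which leaves room for the slack d / 4; the coefficient \<open>b r\<close>
      may become large.\<close>
    define r where "r = d * gl\<^sup>2 / (2 * (?c + 1))"
    have r: "0 < r" unfolding r_def using d \<open>0 < gl\<^sup>2\<close> c0 by (intro divide_pos_pos mult_pos_pos) auto
    have "r * ?c \<le> r * (?c + 1)" using r by (intro mult_left_mono) auto
    also have "\<dots> = d * gl\<^sup>2 / 2"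
    proof -
      have "x / (2 * y) * y = x / 2" if "y \<noteq> 0" for x y :: real using that by simp
      moreover have "?c + 1 \<noteq> 0" using c0 by linarith
      ultimately show ?thesis unfolding r_def by blast
    qed
    finally have "r * ?c / gl\<^sup>2 \<le> d / 2" using \<open>0 < gl\<^sup>2\<close> by (simp add: field_simps)
    moreover have "a r = - d + r * ?c / gl\<^sup>2" by (simp add: a_def d_def add_divide_distrib)
    ultimately have "a r + d / 4 < 0" using d by linarith
    moreover have "0 \<le> b r + d / 4" using b0[OF r] d by simp
    ultimately obtain \<alpha> \<phi> K h2 where "supersolution q (a r + d / 4) (b r + d / 4) \<alpha> \<phi> K h2"
      using supersolution_growth[OF \<open>0 < q\<close> \<open>q < 1\<close>] by metis
    then obtain K where "0 < K" "\<forall>X0 X. Sol X0 X \<longrightarrow> ms_estimate M X0 X K (\<alpha> + 1) \<and> as_estimate M X (1 / 2 * (\<alpha> + 1 + 1))"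
      using est[OF r _ _ less_add_one[of \<alpha>]] d by (metis divide_pos_pos zero_less_numeral)
    with conseq[OF this] show ?thesis by blast
  qed
  have H2: "(\<exists>\<alpha> K. \<alpha> < 0 \<and> 0 < K \<and>
      (\<forall>X0 X. Sol X0 X \<longrightarrow> ms_estimate M X0 X K \<alpha> \<and> as_estimate M X (1 / 2 * (\<alpha> + 1))))
      \<and> ms_polynomially_stable M Sol \<and> as_polynomially_bounded M Sol"
    if "- 1 / gu\<^sup>2 + 1 / gl\<^sup>2 * (?s + ?t + 2 * opnorm (transpose B ** C) + 2 * opnorm (transpose S ** C ** \<Theta>)) < 0"
  proof -
    have "a 1 + b 1 * q powr 0 < 0"
      using that \<open>0 < q\<close> by (simp add: a_def b_def add_divide_distrib algebra_simps)
    then obtain \<alpha> K where "\<alpha> < 0" "0 < K"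
      "\<forall>X0 X. Sol X0 X \<longrightarrow> ms_estimate M X0 X K \<alpha> \<and> as_estimate M X (1 / 2 * (\<alpha> + 1))"
      using decay[of 1 0] by auto
    with conseq[OF this(2,3)] show ?thesis by blast
  qed
  have H3: "(\<exists>\<alpha> K. \<alpha> < -1 \<and> 0 < K \<and>
      (\<forall>X0 X. Sol X0 X \<longrightarrow> ms_estimate M X0 X K \<alpha> \<and> as_estimate M X (1 / 2 * (\<alpha> + 1))))
      \<and> ms_polynomially_stable M Sol \<and> as_polynomially_stable M Sol"
    if "- 1 / gu\<^sup>2 + 1 / gl\<^sup>2 * (?s + ?t / q + 2 / sqrt q * opnorm (transpose B ** C)
        + 2 / sqrt q * opnorm (transpose S ** C ** \<Theta>)) < 0"
  proof -
    \<comment> \<open>With this weight the cross terms in a and in b / q are equal, which minimises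
      their sum and produces the factor 2 / sqrt q of the hypothesis.\<close>
    let ?r = "1 / sqrt q"
    have r: "0 < ?r" using \<open>0 < q\<close> by simp
    have "x / (1 / w) / (w * w) = x * (1 / w)" if "0 < w" for x w :: real using that by simp
    from this[of "sqrt q" ?c] have c: "?c / ?r / q = ?c * ?r" using \<open>0 < q\<close> by simp
    have "(x + y) / z / w = (x / w + y / w) / z" for x y z w :: real
      by (simp add: add_divide_distrib mult.commute)
    then have "b ?r / q = (?t / q + ?c * ?r) / gl\<^sup>2" unfolding b_def c[symmetric] .
    moreover have "q powr (-1) = 1 / q" using \<open>0 < q\<close> by (simp add: powr_minus_divide)
    ultimately have "a ?r + b ?r * q powr (-1) = a ?r + (?t / q + ?c * ?r) / gl\<^sup>2" by simp
    also have "\<dots> < 0" using that by (simp add: a_def add_divide_distrib algebra_simps)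
    finally have "a ?r + b ?r * q powr (-1) < 0" .
    then obtain \<alpha> K where \<alpha>: "\<alpha> < -1" "0 < K"
      "\<forall>X0 X. Sol X0 X \<longrightarrow> ms_estimate M X0 X K \<alpha> \<and> as_estimate M X (1 / 2 * (\<alpha> + 1))"
      using decay[OF r, of "-1"] by auto
    moreover from \<alpha>(1) have "\<alpha> < 0" by simp
    ultimately show ?thesis using conseq[OF \<alpha>(2,3)] by blast
  qed
  show ?thesis by (rule conjI[OF impI[OF H1] conjI[OF impI[OF H2] impI[OF H3]]])
qed

end
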